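(* Let $N\sim\mathcal{P}(dN|\rho,\eta)$ and $\mu(dy)=\int_{\mathcal{S}}h(s)N(ds,dy)\sim\mathcal{P}(d\mu|\rho,\eta)$ be as in the context, let $f$ be a positive measurable function on $\mathcal{S}\times\mathcal{Y}$, and suppose $w(\mu)$ is a positive integrable function of $\mu$ that is representable as $w(\mu)=e^{-N(f)}$ (almost surely). Then: (i) $w(\mu)\,\mathcal{P}(d\mu|\rho,\eta)=\mathcal{P}(d\mu|e^{-f}\rho,\eta)\,E[w(\mu)|\rho,\eta]=\mathcal{P}(d\mu|e^{-f}\rho,\eta)\,\mathcal{L}_N(f|\rho,\eta)$. (ii) If $\kappa_n(e^{-f}\rho|y)<\infty$ (for each $n$ and $y$), then for each $n$, $$w(\mu)\prod_{i=1}^n\mu(dY_i)\,\mathcal{P}(d\mu|\rho,\eta)=\mathcal{P}(d\mu|e^{-f}\rho,\eta,\mathbf{Y})\,\mathcal{L}_N(f|\rho,\eta)\,M_\mu(d\mathbf{Y}|e^{-f}\rho,\eta).$$ (iii) If $\kappa_n(\rho|y)<\infty$ (for each $n$ and $y$), then (for $M_\mu(\cdot|\rho,\eta)$-almost every $\mathbf{Y}$) $$w(\mu)\,\mathcal{P}(d\mu|\rho,\eta,\mathbf{Y})=\mathcal{P}(d\mu|e^{-f}\rho,\eta,\mathbf{Y})\,E[w(\mu)|\rho,\eta,\mathbf{Y}],$$ and $$\mathcal{L}_N(f|\rho,\eta)\,M_\mu(d\mathbf{Y}|e^{-f}\rho,\eta)=E[w(\mu)|\rho,\eta,\mathbf{Y}]\,M_\mu(d\mathbf{Y}|\rho,\eta),$$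 where $E[w(\mu)|\rho,\eta,\mathbf{Y}]=\mathcal{L}_N(f|\rho,\eta)\prod_{j=1}^{n(\mathbf{p})}\left[\int_{\mathcal{S}}e^{-f(s,Y_j^* )}\Pr(J_{j,n}\in ds|\rho,Y_j^* )\right]$.
   Context: $\mathcal{S},\mathcal{Y}$ are Polish spaces; $\eta$ is a $\sigma$-finite non-atomic measure on $\mathcal{Y}$; $\rho(ds|y)$ is a measurable kernel of ($\sigma$-finite, Lévy-type) measures on $\mathcal{S}$; $h:\mathcal{S}\to(0,\infty)$ is measurable; and $\int_B\int_{\mathcal{S}}\min(h(s),1)\rho(ds|y)\eta(dy)<\infty$ for each bounded $B\subset\mathcal{Y}$. $\mathcal{P}(dN|\rho,\eta)$ is the law of a Poisson random measure on $\mathcal{S}\times\mathcal{Y}$ with intensity $\rho(ds|y)\eta(dy)$; $\mathcal{P}(d\mu|\rho,\eta)$ is the law of $\mu(dy)=\int_{\mathcal{S}}h(s)N(ds,dy)$. $N(f)=\int f\,dN$ and $\mathcal{L}_N(f|\rho,\eta)=\exp(-\int_{\mathcal{Y}}\int_{\mathcal{S}}(1-e^{-f(s,y)})\rho(ds|y)\eta(dy))$. $e^{-f}\rho$ denotes the kernel $e^{-f(s,y)}\rho(ds|y)$; all notation below is used with $\rho$ replaced by $e^{-f}\rho$ as well. $\kappa_n(\rho|y)=\int h(s)^n\rho(ds|y)$. $M_\mu(d\mathbf{Y}|\rho,\eta)=\int\prod_{i=1}^n\mu(dY_i)\mathcal{P}(d\mu|\rho,\eta)$. $\mathbf{Y}=(Y_1,\dots,Y_n)$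 is encoded as $(\mathbf{Y}^*,\mathbf{p})$: $Y_1^*,\dots,Y^*_{n(\mathbf{p})}$ are the distinct values, $\mathbf{p}=\{C_1,\dots,C_{n(\mathbf{p})}\}$ is the partition of $\{1,\dots,n\}$ with $Y_i=Y_j^*$ iff $i\in C_j$, $e_{j,n}=|C_j|$. $\mathcal{P}(d\mu|\rho,\eta,\mathbf{Y})$ is the law of $\mu+\sum_{j=1}^{n(\mathbf{p})}h(J_{j,n})\delta_{Y_j^*}$, with $\mu\sim\mathcal{P}(d\mu|\rho,\eta)$ independent of the independent variables $J_{j,n}$ having laws $\Pr(J_{j,n}\in ds|\rho,Y_j^* )=h(s)^{e_{j,n}}\rho(ds|Y_j^* )/\kappa_{e_{j,n}}(\rho|Y_j^* )$. Identities between measures of the form $w(\mu)Q(d\mu)$ are equalities of measures on the space of boundedly finite measures on $\mathcal{Y}$ (jointly with $\mathbf{Y}\in\mathcal{Y}^n$ in (ii)). *)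

theory Defs
  imports "HOL-Probability.Probability"
begin

definition non_atomic :: "'a measure \<Rightarrow> bool" where
  "non_atomic M \<longleftrightarrow>
     (\<forall>A\<in>sets M. 0 < emeasure M A \<longrightarrow>
        (\<exists>B\<in>sets M. B \<subseteq> A \<and> 0 < emeasure M B \<and> emeasure M B < emeasure M A))"

definition sigma_finite_kernel ::
  "('y::topological_space \<Rightarrow> 's::topological_space measure) \<Rightarrow> bool" where
  "sigma_finite_kernel \<rho> \<longleftrightarrow>
     (\<forall>y. sets (\<rho> y) = sets borel \<and> sigma_finite_measure (\<rho> y)) \<and>
     (\<forall>A\<in>sets borel. (\<lambda>y. emeasure (\<rho> y) A) \<in> borel_measurable borel)"

text \<open>
  The measure \<open>M(dx) K(x, dz)\<close> on the product of \<open>M\<close> and \<open>R\<close>. The kernels that occur here are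
  not probability kernels, so the Giry monad of the library does not apply.
\<close>

definition kernel_prod :: "'a measure \<Rightarrow> 'b measure \<Rightarrow> ('a \<Rightarrow> 'b measure) \<Rightarrow> ('a \<times> 'b) measure" where
  "kernel_prod M R K =
     measure_of (space (M \<Otimes>\<^sub>M R)) (sets (M \<Otimes>\<^sub>M R))
       (\<lambda>A. \<integral>\<^sup>+x. (\<integral>\<^sup>+z. indicator A (x, z) \<partial>K x) \<partial>M)"

lemma sets_kernel_prod [simp, measurable_cong]: "sets (kernel_prod M R K) = sets (M \<Otimes>\<^sub>M R)"
  unfolding kernel_prod_def by (simp add: sets.sigma_sets_eq sets.space_closed)

lemma space_kernel_prod [simp]: "space (kernel_prod M R K) = space (M \<Otimes>\<^sub>M R)"
  by (rule sets_eq_imp_space_eq) simp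

lemma emeasure_kernel_prod:
  assumes K: "\<And>x. x \<in> space M \<Longrightarrow> sets (K x) = sets R"
    and meas: "\<And>A. A \<in> sets (M \<Otimes>\<^sub>M R) \<Longrightarrow>
      \<exists>g\<in>borel_measurable M. AE x in M. (\<integral>\<^sup>+z. indicator A (x, z) \<partial>K x) = g x"
    and A: "A \<in> sets (M \<Otimes>\<^sub>M R)"
  shows "emeasure (kernel_prod M R K) A = (\<integral>\<^sup>+x. (\<integral>\<^sup>+z. indicator A (x, z) \<partial>K x) \<partial>M)"
proof (rule emeasure_measure_of[OF kernel_prod_def])
  let ?S = "\<lambda>A x. \<integral>\<^sup>+z. indicator A (x, z) \<partial>K x"
  show "sets (M \<Otimes>\<^sub>M R) \<subseteq> Pow (space (M \<Otimes>\<^sub>M R))"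
    by (rule sets.space_closed)
  show "A \<in> sets (kernel_prod M R K)" using A by simp
  show "positive (sets (kernel_prod M R K)) (\<lambda>A. \<integral>\<^sup>+x. ?S A x \<partial>M)"
    by (simp add: positive_def)
  show "countably_additive (sets (kernel_prod M R K)) (\<lambda>A. \<integral>\<^sup>+x. ?S A x \<partial>M)"
  proof (rule countably_additiveI)
    fix F :: "nat \<Rightarrow> ('a \<times> 'b) set"
    assume F: "range F \<subseteq> sets (kernel_prod M R K)" and disj: "disjoint_family F"
    have Fi: "F i \<in> sets (M \<Otimes>\<^sub>M R)" for i using F by auto
    have "\<forall>i. \<exists>g\<in>borel_measurable M. AE x in M. ?S (F i) x = g x"
      using meas Fi by blast
    then obtain g where g: "\<And>i. g i \<in> borel_measurable M" "\<And>i. AE x in M. ?S (F i) x = g i x"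
      by metis
    have suminf: "?S (\<Union>i. F i) x = (\<Sum>i. ?S (F i) x)" if x: "x \<in> space M" for x
    proof -
      have "(\<lambda>z. indicator (F i) (x, z) :: ennreal) \<in> borel_measurable (K x)" for i
      proof -
        have "(\<lambda>z. indicator (F i) (x, z) :: ennreal) \<in> borel_measurable R"
          using measurable_compose[OF measurable_Pair1'[OF x] borel_measurable_indicator[OF Fi[of i]]]
          by simp
        then show ?thesis by (subst measurable_cong_sets[OF K[OF x] refl])
      qed
      then have "(\<Sum>i. ?S (F i) x) = (\<integral>\<^sup>+z. (\<Sum>i. indicator (F i) (x, z)) \<partial>K x)"
        by (simp add: nn_integral_suminf)
      also have "\<dots> = ?S (\<Union>i. F i) x"
        by (simp add: suminf_indicator[OF disj])
      finally show ?thesis by simp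
    qed
    have "(\<Sum>i. \<integral>\<^sup>+x. ?S (F i) x \<partial>M) = (\<Sum>i. \<integral>\<^sup>+x. g i x \<partial>M)"
      by (intro suminf_cong nn_integral_cong_AE g)
    also have "\<dots> = (\<integral>\<^sup>+x. (\<Sum>i. g i x) \<partial>M)"
      using g by (simp add: nn_integral_suminf)
    also have "\<dots> = (\<integral>\<^sup>+x. ?S (\<Union>i. F i) x \<partial>M)"
    proof (rule nn_integral_cong_AE)
      have "AE x in M. \<forall>i. ?S (F i) x = g i x" using g(2) by (simp add: AE_all_countable)
      then show "AE x in M. (\<Sum>i. g i x) = ?S (\<Union>i. F i) x"
        using AE_space by eventually_elim (simp add: suminf)
    qed
    finally show "(\<Sum>i. \<integral>\<^sup>+x. ?S (F i) x \<partial>M) = (\<integral>\<^sup>+x. ?S (\<Union>i. F i) x \<partial>M)" .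
  qed
qed

text \<open>\<open>e\<^sup>-\<^sup>x\<close> on \<open>[0, \<infinity>]\<close>, with \<open>e\<^sup>-\<^sup>\<infinity> = 0\<close>.\<close>

definition exp_neg :: "ennreal \<Rightarrow> real" where
  "exp_neg x = (if x = \<infinity> then 0 else exp (- enn2real x))"

text \<open>The measurable space of measures in \<open>C\<close>, generated by the evaluations \<open>\<mu> \<mapsto> \<mu>(A)\<close>.\<close>

definition measures_algebra :: "'a::topological_space measure set \<Rightarrow> 'a measure measure" where
  "measures_algebra C = (SUP A\<in>sets borel. vimage_algebra C (\<lambda>M. emeasure M A) borel)"

abbreviation borel_measures :: "'a::topological_space measure measure" where
  "borel_measures \<equiv> measures_algebra {M. sets M = sets borel}"

definition boundedly_finite :: "'a::metric_space measure \<Rightarrow> bool" where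
  "boundedly_finite M \<longleftrightarrow>
     sets M = sets borel \<and> (\<forall>B\<in>sets borel. bounded B \<longrightarrow> emeasure M B < \<infinity>)"

abbreviation boundedly_finite_measures :: "'a::metric_space measure measure" where
  "boundedly_finite_measures \<equiv> measures_algebra (Collect boundedly_finite)"

text \<open>
  Probabilities of the Poisson distribution are written out because \<open>poisson_pmf\<close> needs a
  positive rate, whereas \<open>\<nu>(A) = 0\<close> is allowed here.
\<close>

definition poisson_random_measure ::
  "'w measure \<Rightarrow> ('w \<Rightarrow> 'a::topological_space measure) \<Rightarrow> 'a measure \<Rightarrow> bool" where
  "poisson_random_measure \<Omega> N \<nu> \<longleftrightarrow>
     prob_space \<Omega> \<and> N \<in> measurable \<Omega> borel_measures \<and>
     (\<forall>A\<in>sets borel. emeasure \<nu> A < \<infinity> \<longrightarrow>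
        (\<forall>k::nat. measure \<Omega> {\<omega>\<in>space \<Omega>. emeasure (N \<omega>) A = of_nat k} =
           exp (- measure \<nu> A) * measure \<nu> A ^ k / fact k)) \<and>
     (\<forall>A\<in>sets borel. emeasure \<nu> A = \<infinity> \<longrightarrow> (AE \<omega> in \<Omega>. emeasure (N \<omega>) A = \<infinity>)) \<and>
     (\<forall>(n::nat) A. A ` {..<n} \<subseteq> sets borel \<longrightarrow> disjoint_family_on A {..<n} \<longrightarrow>
        prob_space.indep_vars \<Omega> (\<lambda>_. borel) (\<lambda>i \<omega>. emeasure (N \<omega>) (A i)) {..<n})"

definition intensity ::
  "('y \<Rightarrow> 's measure) \<Rightarrow> 'y measure \<Rightarrow> ('s::topological_space \<times> 'y::topological_space) measure" where
  "intensity \<rho> \<eta> = distr (kernel_prod \<eta> borel \<rho>) borel prod.swap"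

text \<open>The law \<open>P(dN | \<rho>, \<eta>)\<close>.\<close>

definition prm_law ::
  "('y \<Rightarrow> 's measure) \<Rightarrow> 'y measure \<Rightarrow>
   ('s::topological_space \<times> 'y::topological_space) measure measure" where
  "prm_law \<rho> \<eta> =
     (THE P. sets P = sets borel_measures \<and> poisson_random_measure P (\<lambda>N. N) (intensity \<rho> \<eta>))"

text \<open>The functional \<open>L\<^sub>N(f | \<rho>, \<eta>)\<close>.\<close>

definition laplace_prm :: "('s \<times> 'y \<Rightarrow> real) \<Rightarrow> ('y \<Rightarrow> 's measure) \<Rightarrow> 'y measure \<Rightarrow> real" where
  "laplace_prm f \<rho> \<eta> =
     exp_neg (\<integral>\<^sup>+y. (\<integral>\<^sup>+s. ennreal (1 - exp (- f (s, y))) \<partial>\<rho> y) \<partial>\<eta>)"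

text \<open>The kernel \<open>e\<^sup>-\<^sup>f\<rho>\<close>.\<close>

definition exp_tilt :: "('s \<times> 'y \<Rightarrow> real) \<Rightarrow> ('y \<Rightarrow> 's measure) \<Rightarrow> 'y \<Rightarrow> 's measure" where
  "exp_tilt f \<rho> = (\<lambda>y. density (\<rho> y) (\<lambda>s. ennreal (exp (- f (s, y)))))"

text \<open>
  \<open>\<mu>(dy) = \<integral> h(s) N(ds, dy)\<close>. The realisations of \<open>N\<close> for which this is not boundedly finite
  form a null set, on which \<open>\<mu>\<close> is set to \<open>0\<close>.
\<close>

definition mixed_measure ::
  "('s \<Rightarrow> real) \<Rightarrow> ('s::metric_space \<times> 'y::metric_space) measure \<Rightarrow> 'y measure" where
  "mixed_measure h N =
     (let m = distr (density N (\<lambda>(s, y). ennreal (h s))) borel snd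
      in if boundedly_finite m then m else null_measure borel)"

text \<open>The law \<open>P(d\<mu> | \<rho>, \<eta>)\<close>.\<close>

definition crm_law ::
  "('s \<Rightarrow> real) \<Rightarrow> ('y \<Rightarrow> 's::metric_space measure) \<Rightarrow> 'y measure \<Rightarrow> 'y::metric_space measure measure" where
  "crm_law h \<rho> \<eta> = distr (prm_law \<rho> \<eta>) boundedly_finite_measures (mixed_measure h)"

definition kappa :: "('s \<Rightarrow> real) \<Rightarrow> nat \<Rightarrow> ('y \<Rightarrow> 's measure) \<Rightarrow> 'y \<Rightarrow> ennreal" where
  "kappa h n \<rho> y = (\<integral>\<^sup>+s. ennreal (h s ^ n) \<partial>\<rho> y)"

text \<open>
  Points \<open>Y \<in> \<Y>\<^sup>n\<close> are functions in \<open>space (borel_tuples n)\<close>; \<open>power_measure n \<mu>\<close> is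
  \<open>\<Prod>\<^sub>i \<mu>(dY\<^sub>i)\<close>.
\<close>

abbreviation borel_tuples :: "nat \<Rightarrow> (nat \<Rightarrow> 'y::topological_space) measure" where
  "borel_tuples n \<equiv> PiM {1..n} (\<lambda>_. borel)"

definition power_measure :: "nat \<Rightarrow> 'y measure \<Rightarrow> (nat \<Rightarrow> 'y) measure" where
  "power_measure n \<mu> = PiM {1..n} (\<lambda>_. \<mu>)"

text \<open>The moment measure \<open>M\<^sub>\<mu>(dY | \<rho>, \<eta>)\<close>.\<close>

definition moment_measure ::
  "('s \<Rightarrow> real) \<Rightarrow> nat \<Rightarrow> ('y \<Rightarrow> 's::metric_space measure) \<Rightarrow> 'y measure \<Rightarrow>
   (nat \<Rightarrow> 'y::metric_space) measure" where
  "moment_measure h n \<rho> \<eta> =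
     distr (kernel_prod (crm_law h \<rho> \<eta>) (borel_tuples n) (power_measure n)) (borel_tuples n) snd"

text \<open>
  The blocks of the partition \<open>p\<close> of \<open>{1..n}\<close> induced by \<open>Y\<close> are in bijection with the distinct
  values of \<open>Y\<close>, so we index by the latter: \<open>j\<close> becomes the value \<open>v = Y\<^sub>j\<^sup>*\<close>, and \<open>C\<^sub>j\<close>
  becomes \<open>block n Y v\<close>.
\<close>

definition distinct_values :: "nat \<Rightarrow> (nat \<Rightarrow> 'y) \<Rightarrow> 'y set" where
  "distinct_values n Y = Y ` {1..n}"

definition block :: "nat \<Rightarrow> (nat \<Rightarrow> 'y) \<Rightarrow> 'y \<Rightarrow> nat set" where
  "block n Y v = {i\<in>{1..n}. Y i = v}"

text \<open>The law \<open>Pr(J \<in> ds | \<rho>, v)\<close> of the jump at \<open>v\<close>, for a block of size \<open>e\<close>.\<close>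

definition jump_law :: "('s \<Rightarrow> real) \<Rightarrow> nat \<Rightarrow> ('y \<Rightarrow> 's measure) \<Rightarrow> 'y \<Rightarrow> 's measure" where
  "jump_law h e \<rho> v = density (\<rho> v) (\<lambda>s. ennreal (h s ^ e) / kappa h e \<rho> v)"

definition add_atoms ::
  "('s \<Rightarrow> real) \<Rightarrow> 'y set \<Rightarrow> 'y::topological_space measure \<Rightarrow> ('y \<Rightarrow> 's) \<Rightarrow> 'y measure" where
  "add_atoms h V \<mu> J =
     measure_of UNIV (sets borel)
       (\<lambda>A. emeasure \<mu> A + (\<Sum>v\<in>V. ennreal (h (J v)) * indicator A v))"

text \<open>The law \<open>P(d\<mu> | \<rho>, \<eta>, Y)\<close>.\<close>

definition posterior_law ::
  "('s \<Rightarrow> real) \<Rightarrow> nat \<Rightarrow> ('y \<Rightarrow> 's::metric_space measure) \<Rightarrow> 'y measure \<Rightarrow> (nat \<Rightarrow> 'y) \<Rightarrow>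
   'y::metric_space measure measure" where
  "posterior_law h n \<rho> \<eta> Y =
     distr
       (crm_law h \<rho> \<eta> \<Otimes>\<^sub>M
          PiM (distinct_values n Y) (\<lambda>v. jump_law h (card (block n Y v)) \<rho> v))
       boundedly_finite_measures
       (\<lambda>(\<mu>, J). add_atoms h (distinct_values n Y) \<mu> J)"

end

theory Submission
  imports Defs
begin

text \<open>
  Everything reduces to Laplace functionals, which determine the law of a random measure.
  The Poisson law with intensity \<open>\<nu>\<close> is characterised by \<open>E e\<^sup>-\<^sup>N\<^sup>(\<^sup>g\<^sup>) = exp (- \<integral> (1 - e\<^sup>-\<^sup>g) d\<nu>)\<close>, so the
  identity \<open>1 - e\<^sup>-\<^sup>(\<^sup>f\<^sup>+\<^sup>g\<^sup>) = (1 - e\<^sup>-\<^sup>f) + e\<^sup>-\<^sup>f (1 - e\<^sup>-\<^sup>g)\<close> shows that the law of \<open>N\<close> reweighted by \<open>e\<^sup>-\<^sup>N\<^sup>(\<^sup>f\<^sup>)\<close> is,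
  up to the constant \<open>L\<^sub>N(f)\<close>, the Poisson law with intensity \<open>e\<^sup>-\<^sup>f\<nu>\<close>; this is (i), and it also
  provides the existence of the tilted process. Differentiating the Laplace functional gives the
  Mecke formula for \<open>\<mu>\<close>, and iterating it one coordinate of \<open>Y\<close> at a time gives the joint law of
  \<open>\<mu>\<close> and \<open>Y\<close> as \<open>\<Prod>\<^sub>j \<kappa>(Y\<^sub>j\<^sup>*) \<eta>(dY\<^sub>j\<^sup>*)\<close> times the posterior law; non-atomicity of \<open>\<eta>\<close> ensures
  that a fresh coordinate differs from the earlier ones. Applied to the tilted kernel this is (ii).
  For (iii), the disintegrations for \<open>\<rho>\<close> and \<open>e\<^sup>-\<^sup>f\<rho>\<close> are related by (i), and they are unique because the
  moment measures are \<open>\<sigma>\<close>-finite and countably many Laplace functionals determine a law.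
\<close>

section \<open>Laplace functionals of random measures\<close>

text \<open>\<open>prm_law\<close> is a definite description, so it has a meaning only once a
  Poisson random measure with the given intensity is exhibited. For \<open>\<rho>\<close> the
  hypothesis supplies \<open>N\<close>; for the tilted kernel the reweighted law of \<open>N\<close>
  plays this role, and normalising it requires \<open>L_N(f) > 0\<close>, which is drawn from the
  positivity of \<open>w\<close>. Three degeneracies shape the rest. \<open>N(f)\<close> and
  \<open>\<mu>(B)\<close> may be infinite, hence an exponential on \<open>[0, \<infinity>]\<close>
  that vanishes at \<open>\<infinity>\<close>. Measurability of the tilted kernel is secured in
  general only up to an \<open>\<eta>\<close>-null set of \<open>y\<close>, hence the work with
  versions of kernels. And \<open>kappa\<close> may vanish at a point, where \<open>jump_law\<close>
  is the null measure rather than a probability; the moment measure gives no mass to tuples with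
  such values.\<close>

definition nexp :: "ennreal \<Rightarrow> ennreal" where
  "nexp x = ennreal (exp_neg x)"

lemma exp_neg_nonneg [simp]: "0 \<le> exp_neg x"
  by (simp add: exp_neg_def)

lemma exp_neg_le_1 [simp]: "exp_neg x \<le> 1"
  by (simp add: exp_neg_def)

lemma exp_neg_add: "exp_neg (x + y) = exp_neg x * exp_neg y"
  by (cases x; cases y) (auto simp: exp_neg_def exp_add[symmetric] simp flip: ennreal_plus)

lemma nexp_0 [simp]: "nexp 0 = 1"
  by (simp add: nexp_def exp_neg_def)

lemma nexp_top [simp]: "nexp \<top> = 0"
  by (simp add: nexp_def exp_neg_def)

lemma nexp_add: "nexp (x + y) = nexp x * nexp y"
  by (simp add: nexp_def exp_neg_add ennreal_mult)

lemma nexp_sum: "nexp (sum f I) = (\<Prod>i\<in>I. nexp (f i))"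
  by (induction I rule: infinite_finite_induct) (auto simp: nexp_add)

lemma nexp_ennreal: "0 \<le> r \<Longrightarrow> nexp (ennreal r) = ennreal (exp (- r))"
  by (simp add: nexp_def exp_neg_def)

lemma nexp_le_1 [simp]: "nexp x \<le> 1"
  by (simp add: nexp_def)

lemma nexp_less_top [simp]: "nexp x < \<top>"
  by (simp add: nexp_def)

lemma nexp_neq_top [simp]: "nexp x \<noteq> \<top>"
  by (simp add: nexp_def)

lemma nexp_eq_0_iff [simp]: "nexp x = 0 \<longleftrightarrow> x = \<top>"
  by (cases x) (auto simp: nexp_ennreal)

lemma nexp_antimono: "x \<le> y \<Longrightarrow> nexp y \<le> nexp x"
  by (cases x; cases y) (auto simp: nexp_ennreal top_unique)

lemma borel_measurable_exp_neg [measurable]: "exp_neg \<in> borel_measurable borel"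
  unfolding exp_neg_def by measurable

lemma borel_measurable_nexp [measurable]: "nexp \<in> borel_measurable borel"
  unfolding nexp_def by measurable

text \<open>Subtraction in \<open>ennreal\<close> truncates, but all terms lie in
  \<open>[0, 1]\<close>, so the identity can be checked in the reals. Besides tilting it drives the
  derivative of the Laplace functional and, with \<open>x = y\<close>, the monotonicity of dyadic
  difference quotients.\<close>

lemma one_minus_nexp_add: "1 - nexp (x + y) = (1 - nexp x) + nexp x * (1 - nexp y)"
proof -
  have "exp_neg x * exp_neg y \<le> 1"
    by (intro mult_le_one) auto
  then have "1 - nexp (x + y) = ennreal (1 - exp_neg x * exp_neg y)"
    by (simp add: nexp_def exp_neg_add ennreal_minus flip: ennreal_1)
  also have "1 - exp_neg x * exp_neg y = (1 - exp_neg x) + exp_neg x * (1 - exp_neg y)"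
    by (simp add: algebra_simps)
  also have "ennreal \<dots> = (1 - nexp x) + nexp x * (1 - nexp y)"
    by (simp add: nexp_def ennreal_minus ennreal_mult ennreal_plus flip: ennreal_1)
  finally show ?thesis .
qed

lemma tendsto_nexp:
  assumes "(f \<longlongrightarrow> x) F"
  shows "((\<lambda>i. nexp (f i)) \<longlongrightarrow> nexp x) F"
proof (cases x)
  case (real r)
  have "((\<lambda>i. enn2real (f i)) \<longlongrightarrow> r) F"
    using assms real by (intro tendsto_enn2real) simp_all
  then have "((\<lambda>i. exp (- enn2real (f i))) \<longlongrightarrow> exp (- r)) F"
    by (intro tendsto_exp tendsto_minus)
  then have "((\<lambda>i. ennreal (exp (- enn2real (f i)))) \<longlongrightarrow> nexp x) F"
    using real by (simp add: nexp_ennreal)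
  moreover have "\<forall>\<^sub>F i in F. f i < \<top>"
    using assms real by (intro order_tendstoD(2)[OF assms]) auto
  then have "\<forall>\<^sub>F i in F. ennreal (exp (- enn2real (f i))) = nexp (f i)"
    by eventually_elim (auto simp: nexp_def exp_neg_def)
  ultimately show ?thesis
    by (rule Lim_transform_eventually)
next
  case top
  show ?thesis unfolding top nexp_top
  proof (rule order_tendstoI)
    fix a :: ennreal assume "0 < a"
    then obtain e where e: "0 < e" "ennreal e < a"
      by (metis ennreal_less_zero_iff dense ennreal_cases infinity_ennreal_def not_top_less order.strict_trans order_less_imp_not_less top.not_eq_extremum)
    \<comment> \<open>Past \<open>-ln e\<close> the values drop below \<open>e\<close>;
      \<open>max 0\<close> covers \<open>e > 1\<close>, where the bound \<open>1 \<le> e\<close> is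
      enough.\<close>
    have "\<forall>\<^sub>F i in F. ennreal (max 0 (- ln e)) < f i"
      using assms top by (intro order_tendstoD(1)[OF assms]) auto
    then show "\<forall>\<^sub>F i in F. nexp (f i) < a"
    proof eventually_elim
      case (elim i)
      have "nexp (f i) \<le> nexp (ennreal (max 0 (- ln e)))"
        using elim by (intro nexp_antimono) simp
      also have "\<dots> \<le> ennreal e"
        using e by (auto simp: nexp_ennreal max_def intro!: ennreal_leI)
      finally show ?case using e by simp
    qed
  qed auto
qed

text \<open>The moments determine the characteristic function.\<close>

lemma real_distribution_eqI_moments:
  fixes M N :: "real measure"
  assumes "real_distribution M" "real_distribution N"
    and M: "AE x in M. x \<in> {0..1}" and N: "AE x in N. x \<in> {0..1}"
    and eq: "\<And>k. (\<integral>x. x ^ k \<partial>M) = (\<integral>x. x ^ k \<partial>N)"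
  shows "M = N"
proof (rule Levy_uniqueness[OF assms(1,2)], rule ext)
  fix t :: real
  \<comment> \<open>The Taylor polynomial of the characteristic function at \<open>t\<close>.
    Moments on \<open>[0, 1]\<close> are at most \<open>1\<close>, so the remainder is at most
    \<open>2 |t|^n / n!\<close> and the sums converge for every \<open>t\<close>.\<close>
  let ?S = "\<lambda>(M :: real measure) n. (\<Sum>k\<le>n. ((\<i> * complex_of_real t)^k / fact k) * complex_of_real (\<integral>x. x ^ k \<partial>M))"
  have bd: "(\<lambda>n. ?S M n) \<longlonglongrightarrow> char M t"
    if "real_distribution M" "AE x in M. x \<in> {0..1}" for M :: "real measure"
  proof -
    interpret real_distribution M by fact
    have int: "integrable M (\<lambda>x. x ^ k)" for k
    proof (rule integrable_const_bound[of _ 1])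
      show "AE x in M. norm (x ^ k) \<le> 1"
        using that(2) by eventually_elim (simp add: power_le_one)
    qed simp
    have le: "cmod (?S M n - char M t) \<le> 2 * (\<bar>t\<bar> ^ n / fact n)" for n
    proof -
      have 1: "cmod (char M t - ?S M n) \<le> (2 * \<bar>t\<bar>^n / fact n) * expectation (\<lambda>x. \<bar>x\<bar>^n)"
        by (rule char_approx1) (rule int)
      have "expectation (\<lambda>x. \<bar>x\<bar>^n) \<le> expectation (\<lambda>x. 1)"
      proof (intro integral_mono_AE)
        show "AE x in M. \<bar>x\<bar> ^ n \<le> 1"
          using that(2) by eventually_elim (simp add: power_le_one)
      qed (use integrable_abs[OF int[of n]] in \<open>auto simp: power_abs\<close>)
      also have "expectation (\<lambda>x. 1) = (1::real)"
        using prob_space by simp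
      finally have "(2 * \<bar>t\<bar>^n / fact n) * expectation (\<lambda>x. \<bar>x\<bar>^n) \<le> (2 * \<bar>t\<bar>^n / fact n) * 1"
        by (intro mult_left_mono) auto
      then show ?thesis using 1 by (simp add: norm_minus_commute)
    qed
    have "(\<lambda>n. \<bar>t\<bar> ^ n / fact n) \<longlonglongrightarrow> 0"
      using summable_LIMSEQ_zero[OF summable_exp[of "\<bar>t\<bar>"]] by (simp add: field_simps)
    then have "(\<lambda>n. 2 * (\<bar>t\<bar> ^ n / fact n)) \<longlonglongrightarrow> 0"
      using tendsto_mult_right_zero by blast
    then have "(\<lambda>n. ?S M n - char M t) \<longlonglongrightarrow> 0"
      by (rule Lim_null_comparison[OF always_eventually, rotated]) (use le in blast)
    then show ?thesis by (simp add: LIM_zero_iff)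
  qed
  show "char M t = char N t"
    using bd[OF assms(1) M] bd[OF assms(2) N] unfolding eq by (rule LIMSEQ_unique)
qed

lemma nexp_of_nat_mult: "nexp (of_nat m * x) = ennreal (exp_neg x ^ m)"
  by (induction m) (auto simp: nexp_add distrib_right ennreal_mult nexp_def[symmetric])

text \<open>The map \<open>x \<mapsto> e^{-x}\<close> carries \<open>[0, \<infinity>]\<close> onto
  \<open>[0, 1]\<close> and turns the Laplace transform at the integers into moments, so the moment
  problem on a compact interval settles uniqueness, mass at \<open>\<infinity>\<close>
  included.\<close>

lemma finite_measure_eqI_laplace:
  fixes M N :: "ennreal measure"
  assumes fM: "finite_measure M" and fN: "finite_measure N"
    and sM: "sets M = sets borel" and sN: "sets N = sets borel"
    and eq: "\<And>m::nat. (\<integral>\<^sup>+x. nexp (of_nat m * x) \<partial>M) = (\<integral>\<^sup>+x. nexp (of_nat m * x) \<partial>N)"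
  shows "M = N"
proof -
  interpret M: finite_measure M by fact
  interpret N: finite_measure N by fact
  note [measurable_cong] = sM sN
  define c where "c = measure M UNIV"
  have spM: "space M = UNIV" and spN: "space N = UNIV"
    using sets_eq_imp_space_eq[OF sM] sets_eq_imp_space_eq[OF sN] by auto
  have cN: "emeasure M UNIV = emeasure N UNIV"
    using eq[of 0] spM spN by simp
  show ?thesis
  proof (cases "c = 0")
    case True
    then have "emeasure M UNIV = 0" unfolding c_def
      using M.emeasure_eq_measure by simp
    then have "emeasure M A = 0" "emeasure N A = 0" if "A \<in> sets borel" for A
      using cN emeasure_space[of M A] emeasure_space[of N A] spM spN by auto
    then show ?thesis by (intro measure_eqI) (auto simp: sM sN)
  next
    case False
    then have c: "c > 0" unfolding c_def using measure_nonneg[of M UNIV] by linarith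
    have cM: "emeasure M UNIV = ennreal c" "emeasure N UNIV = ennreal c"
      using cN M.emeasure_eq_measure[of UNIV] unfolding c_def by auto
    \<comment> \<open>The moment criterion is about probability laws on the reals, hence the
      division by the total mass \<open>c\<close>; the case \<open>c = 0\<close> has been split
      off.\<close>
    define D where "D = (\<lambda>M. distr (density M (\<lambda>_. ennreal (1 / c))) borel exp_neg)"
    have D: "real_distribution (D L) \<and> (AE x in D L. x \<in> {0..1}) \<and>
        (\<forall>k. (\<integral>x. x ^ k \<partial>D L) = enn2real (ennreal (1 / c) * (\<integral>\<^sup>+x. nexp (of_nat k * x) \<partial>L)))"
      if L[measurable_cong]: "sets L = sets borel" and e: "emeasure L UNIV = ennreal c" for L
    proof (intro conjI allI)
      have spL: "space L = UNIV" using sets_eq_imp_space_eq[OF L] by auto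
      have "prob_space (density L (\<lambda>_. ennreal (1 / c)))"
        using c e spL by (intro prob_spaceI) (simp add: emeasure_density ennreal_mult[symmetric] del: ennreal_1)
      then show "real_distribution (D L)"
        unfolding D_def real_distribution_def real_distribution_axioms_def
        by (auto intro!: prob_space.prob_space_distr)
      show "AE x in D L. x \<in> {0..1}"
        unfolding D_def by (subst AE_distr_iff) auto
      fix k
      have "(\<integral>x. x ^ k \<partial>D L) = (\<integral>x. exp_neg x ^ k \<partial>density L (\<lambda>_. ennreal (1 / c)))"
        unfolding D_def by (subst integral_distr) auto
      also have "\<dots> = enn2real (\<integral>\<^sup>+x. ennreal (exp_neg x ^ k) \<partial>density L (\<lambda>_. ennreal (1 / c)))"
        by (rule integral_eq_nn_integral) auto
      also have "\<dots> = enn2real (ennreal (1 / c) * (\<integral>\<^sup>+x. nexp (of_nat k * x) \<partial>L))"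
        unfolding nexp_of_nat_mult by (subst nn_integral_density) (auto simp: nn_integral_cmult)
      finally show "(\<integral>x. x ^ k \<partial>D L) = enn2real (ennreal (1 / c) * (\<integral>\<^sup>+x. nexp (of_nat k * x) \<partial>L))" .
    qed
    have DD: "D M = D N"
      using D[OF sM cM(1)] D[OF sN cM(2)] by (intro real_distribution_eqI_moments) (auto simp: eq)
    \<comment> \<open>A measurable left inverse of \<open>exp_neg\<close>, sending \<open>0\<close>
      back to \<open>\<infinity>\<close>: preimages under \<open>q\<close> recover the mass of every
      Borel set from the image law.\<close>
    define q where "q = (\<lambda>z::real. if z \<le> 0 then \<top> else ennreal (- ln z))"
    have q[measurable]: "q \<in> borel_measurable borel" unfolding q_def by measurable
    have inv: "q (exp_neg x) = x" for x
      by (cases x) (auto simp: q_def exp_neg_def)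
    show ?thesis
    proof (rule measure_eqI)
      fix A assume "A \<in> sets M"
      then have [measurable]: "A \<in> sets borel" by (simp add: sM)
      have "emeasure (D L) (q -` A) = ennreal (1 / c) * emeasure L A" if L[measurable_cong]: "sets L = sets borel" for L
      proof -
        have spL: "space L = UNIV" using sets_eq_imp_space_eq[OF L] by auto
        have "q -` A \<in> sets borel" using measurable_sets[OF q, of A] by simp
        then have "emeasure (D L) (q -` A) = emeasure (density L (\<lambda>_. ennreal (1 / c))) A"
          unfolding D_def using spL by (subst emeasure_distr) (auto simp: vimage_def inv)
        also have "\<dots> = ennreal (1 / c) * emeasure L A"
          by (simp add: emeasure_density nn_integral_cmult)
        finally show ?thesis .
      qed
      from this[OF sM] this[OF sN] DD have "ennreal (1 / c) * emeasure M A = ennreal (1 / c) * emeasure N A" by simp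
      then show "emeasure M A = emeasure N A"
        using c by (subst (asm) ennreal_mult_cancel_left) auto
    qed (simp add: sM sN)
  qed
qed

text \<open>Exponential factors are replaced by indicators one coordinate at a time. With all other
  factors kept as a density, the law of the current coordinate is a finite measure on
  \<open>[0, \<infinity>]\<close>, and the one-dimensional uniqueness applies to it.\<close>

lemma emeasure_joint_eqI_laplace:
  fixes X :: "'i \<Rightarrow> 'a \<Rightarrow> ennreal"
  assumes fP: "finite_measure P" and fQ: "finite_measure Q" and sets: "sets P = sets Q"
    and X: "\<And>i. i \<in> K \<Longrightarrow> X i \<in> borel_measurable P"
    and eq: "\<And>J m. finite J \<Longrightarrow> J \<subseteq> K \<Longrightarrow>
      (\<integral>\<^sup>+x. nexp (\<Sum>i\<in>J. of_nat (m i) * X i x) \<partial>P) = (\<integral>\<^sup>+x. nexp (\<Sum>i\<in>J. of_nat (m i) * X i x) \<partial>Q)"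
    and I: "finite I" "I \<subseteq> K" and B: "\<And>i. i \<in> I \<Longrightarrow> B i \<in> sets borel"
  shows "emeasure P {x\<in>space P. \<forall>i\<in>I. X i x \<in> B i} = emeasure Q {x\<in>space Q. \<forall>i\<in>I. X i x \<in> B i}"
proof -
  have X': "X i \<in> borel_measurable Q" if "i \<in> K" for i
    using X[OF that] by (simp cong: measurable_cong_sets add: sets)
  \<comment> \<open>Indicators for the coordinates in \<open>I\<close>, exponentials for those in
    \<open>J\<close>: the induction moves coordinates from the second kind to the first.\<close>
  define F where "F = (\<lambda>I J m x. (\<Prod>i\<in>I. indicator (B i) (X i x) :: ennreal) * nexp (\<Sum>i\<in>J. of_nat (m i) * X i x))"
  have Fle: "F I J m x \<le> 1" for I J m x
    unfolding F_def by (intro mult_le_one prod_le_1) (auto simp: indicator_def)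
  have Fm: "F I J m \<in> borel_measurable P" "F I J m \<in> borel_measurable Q"
    if "I \<subseteq> K" "J \<subseteq> K" "\<And>i. i \<in> I \<Longrightarrow> B i \<in> sets borel" for I J m
  proof -
    have "F I J m \<in> borel_measurable L" if "\<And>i. i \<in> K \<Longrightarrow> X i \<in> borel_measurable L" for L
    proof -
      have [measurable]: "i \<in> I \<Longrightarrow> X i \<in> borel_measurable L" "i \<in> J \<Longrightarrow> X i \<in> borel_measurable L" for i
        using that \<open>I \<subseteq> K\<close> \<open>J \<subseteq> K\<close> by auto
      have [measurable]: "i \<in> I \<Longrightarrow> B i \<in> sets borel" for i by fact
      show ?thesis unfolding F_def by measurable
    qed
    with X X' show "F I J m \<in> borel_measurable P" "F I J m \<in> borel_measurable Q" by auto
  qed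
  \<comment> \<open>The claim is for all \<open>J\<close> and \<open>m\<close> at once: to convert
    \<open>a\<close>, the hypothesis is used with \<open>a\<close> placed in \<open>J\<close> under
    every exponent \<open>k\<close>, which gives the full transform of \<open>X a\<close> under the
    density \<open>F I J m\<close>.\<close>
  have "\<forall>J m. finite J \<longrightarrow> J \<subseteq> K \<longrightarrow> J \<inter> I = {} \<longrightarrow> integral\<^sup>N P (F I J m) = integral\<^sup>N Q (F I J m)"
    using I B
  proof (induction I rule: finite_induct)
    case empty
    then show ?case using eq by (simp add: F_def)
  next
    case (insert a I)
    show ?case
    proof (intro allI impI)
      fix J and m :: "'i \<Rightarrow> nat" assume J: "finite J" "J \<subseteq> K" "J \<inter> insert a I = {}"
      have aK: "a \<in> K" "I \<subseteq> K" "B a \<in> sets borel" "\<And>i. i \<in> I \<Longrightarrow> B i \<in> sets borel"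
        using insert.prems by auto
      have mF: "F I J m \<in> borel_measurable P" "F I J m \<in> borel_measurable Q"
        using Fm[OF aK(2) J(2) aK(4)] by auto
      have fin: "finite_measure (distr (density L (F I J m)) borel (X a))"
        if "finite_measure L" "X a \<in> borel_measurable L" "F I J m \<in> borel_measurable L" for L
      proof -
        interpret finite_measure L by fact
        have "(\<integral>\<^sup>+x. F I J m x \<partial>L) \<le> (\<integral>\<^sup>+x. 1 \<partial>L)" by (intro nn_integral_mono Fle)
        also have "\<dots> < \<infinity>" by (simp add: less_top[symmetric])
        finally show ?thesis using that
          by (intro finite_measureI) (simp add: emeasure_distr emeasure_density less_top[symmetric] cong: nn_integral_cong)
      qed
      have eq: "distr (density P (F I J m)) borel (X a) = distr (density Q (F I J m)) borel (X a)"
      proof (rule finite_measure_eqI_laplace)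
        fix k :: nat
        have L: "(\<integral>\<^sup>+x. nexp (of_nat k * x) \<partial>distr (density L (F I J m)) borel (X a))
           = integral\<^sup>N L (F I (insert a J) (m(a := k)))"
          if [measurable]: "X a \<in> borel_measurable L" "F I J m \<in> borel_measurable L" for L
        proof -
          have "(\<integral>\<^sup>+x. nexp (of_nat k * x) \<partial>distr (density L (F I J m)) borel (X a))
             = (\<integral>\<^sup>+x. F I J m x * nexp (of_nat k * X a x) \<partial>L)"
            by (simp add: nn_integral_distr nn_integral_density)
          also have "\<dots> = integral\<^sup>N L (F I (insert a J) (m(a := k)))"
          proof (intro nn_integral_cong)
            fix x
            have "(\<Sum>i\<in>J. of_nat ((m(a := k)) i) * X i x) = (\<Sum>i\<in>J. of_nat (m i) * X i x)"
              using J by (intro sum.cong) auto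
            then show "F I J m x * nexp (of_nat k * X a x) = F I (insert a J) (m(a := k)) x"
              using J by (auto simp: F_def nexp_add mult_ac)
          qed
          finally show ?thesis .
        qed
        have "integral\<^sup>N P (F I (insert a J) (m(a := k))) = integral\<^sup>N Q (F I (insert a J) (m(a := k)))"
          using insert.IH[OF aK(2,4)] J aK(1) insert.hyps(2) by (simp add: Int_insert_left)
        then show "(\<integral>\<^sup>+x. nexp (of_nat k * x) \<partial>distr (density P (F I J m)) borel (X a))
          = (\<integral>\<^sup>+x. nexp (of_nat k * x) \<partial>distr (density Q (F I J m)) borel (X a))"
          using L X[OF aK(1)] X'[OF aK(1)] mF by auto
      qed (use fin fP fQ X[OF aK(1)] X'[OF aK(1)] mF in auto)
      have L: "integral\<^sup>N L (F (insert a I) J m) = emeasure (distr (density L (F I J m)) borel (X a)) (B a)"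
        if [measurable]: "X a \<in> borel_measurable L" "F I J m \<in> borel_measurable L" for L
      proof -
        have "emeasure (distr (density L (F I J m)) borel (X a)) (B a) =
            (\<integral>\<^sup>+y. indicator (B a) y \<partial>distr (density L (F I J m)) borel (X a))"
          using aK(3) by simp
        also have "\<dots> = (\<integral>\<^sup>+x. F I J m x * indicator (B a) (X a x) \<partial>L)"
          using aK(3) by (subst nn_integral_distr) (auto simp: nn_integral_density)
        also have "\<dots> = integral\<^sup>N L (F (insert a I) J m)"
          using insert.hyps by (intro nn_integral_cong) (simp add: F_def mult_ac)
        finally show ?thesis ..
      qed
      show "integral\<^sup>N P (F (insert a I) J m) = integral\<^sup>N Q (F (insert a I) J m)"
        using eq L X[OF aK(1)] X'[OF aK(1)] mF by metis
    qed
  qed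
  then have *: "integral\<^sup>N P (F I {} (\<lambda>_. 0)) = integral\<^sup>N Q (F I {} (\<lambda>_. 0))" by auto
  have L: "integral\<^sup>N L (F I {} (\<lambda>_. 0)) = emeasure L {x\<in>space L. \<forall>i\<in>I. X i x \<in> B i}"
    if "\<And>i. i \<in> K \<Longrightarrow> X i \<in> borel_measurable L" for L
  proof -
    have [measurable]: "i \<in> I \<Longrightarrow> X i \<in> borel_measurable L" "i \<in> I \<Longrightarrow> B i \<in> sets borel" for i
      using that I B by auto
    have "{x\<in>space L. \<forall>i\<in>I. X i x \<in> B i} \<in> sets L"
      using I by measurable
    then have "emeasure L {x\<in>space L. \<forall>i\<in>I. X i x \<in> B i} = (\<integral>\<^sup>+x. indicator {x\<in>space L. \<forall>i\<in>I. X i x \<in> B i} x \<partial>L)"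
      by simp
    also have "\<dots> = integral\<^sup>N L (F I {} (\<lambda>_. 0))"
    proof (intro nn_integral_cong)
      fix x assume "x \<in> space L"
      then have "indicator {x\<in>space L. \<forall>i\<in>I. X i x \<in> B i} x = (\<Prod>i\<in>I. indicator (B i) (X i x) :: ennreal)"
        using I(1) by (auto simp: indicator_def intro: prod.neutral intro!: prod_zero[symmetric])
      then show "indicator {x\<in>space L. \<forall>i\<in>I. X i x \<in> B i} x = F I {} (\<lambda>_. 0) x"
        by (simp add: F_def)
    qed
    finally show ?thesis ..
  qed
  show ?thesis using * L[OF X] L[OF X'] by simp
qed

text \<open>Multiplicities become repetitions in a list. Lists over a countable set are countable,
  which is why Laplace functionals are indexed by lists of sets.\<close>

lemma sum_list_as_sum:
  fixes f :: "'i \<Rightarrow> ennreal"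
  assumes "finite J"
  shows "\<exists>l. set l \<subseteq> J \<and> (\<forall>f::'i \<Rightarrow> ennreal. sum_list (map f l) = (\<Sum>i\<in>J. of_nat (m i) * f i))"
  using assms
proof (induction J rule: finite_induct)
  case empty
  then show ?case by simp
next
  case (insert a J)
  then obtain l where l: "set l \<subseteq> J" "\<And>f::'i \<Rightarrow> ennreal. sum_list (map f l) = (\<Sum>i\<in>J. of_nat (m i) * f i)"
    by auto
  show ?case
    using insert l by (intro exI[of _ "replicate (m a) a @ l"]) (auto simp: sum_list_replicate)
qed

section \<open>Measurability and uniqueness on spaces of measures\<close>

lemma space_measures_algebra [simp]: "space (measures_algebra C) = C"
  by (auto simp add: measures_algebra_def space_Sup_eq_UN)

lemma measurable_emeasure_measures_algebra [measurable]:
  "A \<in> sets borel \<Longrightarrow> (\<lambda>M. emeasure M A) \<in> borel_measurable (measures_algebra C)"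
  by (auto intro!: measurable_Sup1 measurable_vimage_algebra1 simp: measures_algebra_def)

lemma measurable_measures_algebra:
  "(\<And>a. a \<in> space M \<Longrightarrow> K a \<in> C) \<Longrightarrow>
   (\<And>A. A \<in> sets borel \<Longrightarrow> (\<lambda>a. emeasure (K a) A) \<in> borel_measurable M) \<Longrightarrow>
   K \<in> measurable M (measures_algebra C)"
  by (auto intro!: measurable_Sup2 measurable_vimage_algebra2 simp: measures_algebra_def)

lemma measurable_nn_integral_measures_algebra:
  assumes C: "\<And>M. M \<in> C \<Longrightarrow> sets M = sets borel" and f: "f \<in> borel_measurable borel"
  shows "(\<lambda>M. integral\<^sup>N M f) \<in> borel_measurable (measures_algebra C)"
  using f
proof (induction rule: borel_measurable_induct)
  case (cong f g)
  then have "f = g" by auto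
  with cong show ?case by simp
next
  case (set A)
  then show ?case
    by (subst measurable_cong[where g = "\<lambda>M. emeasure M A"]) (auto simp: C)
next
  case (mult u c)
  have m: "u \<in> borel_measurable M" if "M \<in> C" for M
    using mult(2) C[OF that] by (simp cong: measurable_cong_sets)
  show ?case
    by (subst measurable_cong[where g = "\<lambda>M. c * integral\<^sup>N M u"])
      (use mult in \<open>auto simp: nn_integral_cmult m\<close>)
next
  case (add u v)
  have m: "u \<in> borel_measurable M" "v \<in> borel_measurable M" if "M \<in> C" for M
    using add C[OF that] by (simp_all cong: measurable_cong_sets)
  show ?case
    by (subst measurable_cong[where g = "\<lambda>M. integral\<^sup>N M u + integral\<^sup>N M v"])
      (use add in \<open>auto simp: nn_integral_add m add.commute\<close>)
next
  case (seq U)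
  have m: "U i \<in> borel_measurable M" if "M \<in> C" for M i
    using seq(1)[of i] C[OF that] by (simp cong: measurable_cong_sets)
  show ?case
    by (subst measurable_cong[where g = "\<lambda>M. SUP i. integral\<^sup>N M (U i)"])
      (use seq in \<open>auto simp: SUP_apply[abs_def] nn_integral_monotone_convergence_SUP m image_comp\<close>)
qed

text \<open>A Dynkin argument on the truncated sets \<open>A \<inter> D k\<close>: there all masses
  are finite, so complements can be treated by subtraction. The truncation is removed by a supremum
  over \<open>k\<close>.\<close>

lemma measurable_emeasure_generated:
  assumes sets: "\<And>a. a \<in> space M \<Longrightarrow> sets (K a) = sets borel"
    and G: "Int_stable G" "sigma_sets UNIV G = sets borel"
    and D: "range D \<subseteq> G" "incseq D" "(\<Union>k. D k) = UNIV"
    and fin: "\<And>a k. a \<in> space M \<Longrightarrow> emeasure (K a) (D k) < \<infinity>"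
    and meas: "\<And>A. A \<in> G \<Longrightarrow> (\<lambda>a. emeasure (K a) A) \<in> borel_measurable M"
    and A: "A \<in> sets borel"
  shows "(\<lambda>a. emeasure (K a) A) \<in> borel_measurable M"
proof -
  have GB: "A \<in> sets borel" if "A \<in> G" for A
    using that G(2) by blast
  have Dk: "D k \<in> G" for k using D(1) by auto
  note [measurable] = GB[OF Dk]
  have *: "(\<lambda>a. emeasure (K a) (A \<inter> D k)) \<in> borel_measurable M" for k
  proof -
    have "A \<in> sigma_sets UNIV G" using A G by simp
    with G(1) subset_UNIV[of G, folded Pow_UNIV] show ?thesis
    proof (induction rule: sigma_sets_induct_disjoint)
      case (basic A)
      then show ?case using meas G(1) Dk by (auto simp: Int_stable_def)
    next
      case empty
      then show ?case by simp
    next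
      case (compl A)
      have A: "A \<in> sets borel" using compl G(2) by simp
      have "(\<lambda>a. emeasure (K a) (D k) - emeasure (K a) (A \<inter> D k)) \<in> borel_measurable M"
        using compl(2) meas[OF Dk] by measurable
      moreover have "emeasure (K a) ((UNIV - A) \<inter> D k) = emeasure (K a) (D k) - emeasure (K a) (A \<inter> D k)"
        if a: "a \<in> space M" for a
      proof -
        have "emeasure (K a) (A \<inter> D k) \<le> emeasure (K a) (D k)"
          by (rule emeasure_mono) (auto simp: sets[OF a])
        also have "\<dots> < \<infinity>" using fin[OF a] .
        finally have fi: "emeasure (K a) (A \<inter> D k) \<noteq> \<infinity>" by simp
        have "(UNIV - A) \<inter> D k = D k - (A \<inter> D k)" by auto
        then show ?thesis
          using A fi by (subst emeasure_Diff[symmetric]) (auto simp: sets[OF a])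
      qed
      ultimately show ?case by (simp cong: measurable_cong)
    next
      case (union F)
      have F: "F i \<in> sets borel" for i using union G(2) by auto
      have "(\<lambda>a. \<Sum>i. emeasure (K a) (F i \<inter> D k)) \<in> borel_measurable M"
        using union by measurable
      moreover have "emeasure (K a) ((\<Union>i. F i) \<inter> D k) = (\<Sum>i. emeasure (K a) (F i \<inter> D k))"
        if a: "a \<in> space M" for a
        using F union(1) by (subst suminf_emeasure) (auto simp: sets[OF a] disjoint_family_on_def)
      ultimately show ?case by (simp cong: measurable_cong)
    qed
  qed
  have "(\<lambda>a. SUP k. emeasure (K a) (A \<inter> D k)) \<in> borel_measurable M"
    using * by measurable
  moreover have "emeasure (K a) A = (SUP k. emeasure (K a) (A \<inter> D k))" if a: "a \<in> space M" for a
  proof -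
    have "incseq (\<lambda>k. A \<inter> D k)" using D(2) by (auto simp: incseq_def)
    then have "(SUP k. emeasure (K a) (A \<inter> D k)) = emeasure (K a) (\<Union>k. A \<inter> D k)"
      using A by (intro SUP_emeasure_incseq) (auto simp: sets[OF a])
    also have "(\<Union>k. A \<inter> D k) = A" using D(3) by auto
    finally show ?thesis ..
  qed
  ultimately show ?thesis by (simp cong: measurable_cong)
qed

text \<open>Countability lets almost sure identities indexed by the generator hold simultaneously;
  boundedness keeps its masses finite under boundedly finite measures.\<close>

lemma bounded_generator_exists:
  obtains G :: "'y::{metric_space, second_countable_topology} set set" and D :: "nat \<Rightarrow> 'y set"
  where "countable G" "Int_stable G" "sigma_sets UNIV G = sets borel"
    "\<And>A. A \<in> G \<Longrightarrow> bounded A"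
    "range D \<subseteq> G" "incseq D" "(\<Union>k. D k) = UNIV"
proof -
  obtain a :: 'y where True by simp
  obtain \<B> :: "'y set set" where B: "countable \<B>" "topological_basis \<B>"
    using ex_countable_basis by blast
  define D where "D = (\<lambda>k::nat. ball a (real k))"
  \<comment> \<open>Intersecting the empty family gives the whole space, so the balls
    \<open>D k\<close> themselves belong to \<open>G\<close> and form its exhaustion.\<close>
  define G where "G = (\<lambda>(k, S). D k \<inter> \<Inter>S) ` (UNIV \<times> {S. finite S \<and> S \<subseteq> \<B>})"
  have opn: "open A" if "A \<in> G" for A
    using that topological_basis_open[OF B(2)] by (auto simp: G_def D_def intro!: open_Int open_Inter)
  have inc: "incseq D" by (auto simp: D_def incseq_def)
  have DG: "D k \<in> G" for k
    unfolding G_def by (auto intro!: image_eqI[of _ _ "(k, {})"])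
  have UD: "(\<Union>k. D k) = UNIV"
    by (auto simp: D_def) (meson reals_Archimedean2)
  show ?thesis
  proof
    show "countable G"
      unfolding G_def using B(1) by (intro countable_image countable_SIGMA countable_Collect_finite_subset) auto
    show "Int_stable G"
    proof (rule Int_stableI)
      fix A A' assume "A \<in> G" "A' \<in> G"
      then obtain k S l T where A: "A = D k \<inter> \<Inter>S" "finite S" "S \<subseteq> \<B>" "A' = D l \<inter> \<Inter>T" "finite T" "T \<subseteq> \<B>"
        unfolding G_def by auto
      have "D k \<inter> D l = D (min k l)" by (auto simp: D_def)
      then have "A \<inter> A' = D (min k l) \<inter> \<Inter>(S \<union> T)" using A by auto
      then show "A \<inter> A' \<in> G"
        unfolding G_def using A by (intro image_eqI[of _ _ "(min k l, S \<union> T)"]) auto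
    qed
    show "sigma_sets UNIV G = sets borel"
    proof
      show "sigma_sets UNIV G \<subseteq> sets borel"
        using opn by (intro sets.sigma_sets_subset') auto
      have "A \<in> sigma_sets UNIV G" if "A \<in> \<B>" for A
      proof -
        have "A = (\<Union>k. D k \<inter> \<Inter>{A})" using UD by auto
        moreover have "D k \<inter> \<Inter>{A} \<in> G" for k
          unfolding G_def using that by (intro image_eqI[of _ _ "(k, {A})"]) auto
        ultimately show ?thesis
          by (metis (mono_tags, lifting) sigma_sets.Basic sigma_sets.Union)
      qed
      then have "sigma_sets UNIV \<B> \<subseteq> sigma_sets UNIV G"
        by (intro sigma_sets_mono) auto
      then show "sets borel \<subseteq> sigma_sets UNIV G"
        unfolding borel_eq_countable_basis[OF B] by (simp add: sets_measure_of)
    qed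
    show "bounded A" if "A \<in> G" for A
      using that by (auto simp: G_def D_def)
  qed (use inc DG UD in auto)
qed

text \<open>\<open>gen\<close> says that evaluations on \<open>G\<close> already generate the
  algebra on \<open>C\<close>. The cylinders over \<open>G\<close> are then an intersection-stable
  generator containing \<open>C\<close>, and joint transforms determine their masses. Keeping
  \<open>gen\<close> abstract admits both \<open>G = sets borel\<close> and a countable
  \<open>G\<close>.\<close>

lemma finite_measure_eqI_laplace_functional:
  fixes P Q :: "'a::topological_space measure measure"
  assumes fP: "finite_measure P" and fQ: "finite_measure Q"
    and sP: "sets P = sets (measures_algebra C)" and sQ: "sets Q = sets (measures_algebra C)"
    and G: "G \<subseteq> sets borel"
    and gen: "\<And>A M'. \<lbrakk>space M' = C; \<And>A. A \<in> G \<Longrightarrow> (\<lambda>M. emeasure M A) \<in> borel_measurable M'; A \<in> sets borel\<rbrakk>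
       \<Longrightarrow> (\<lambda>M. emeasure M A) \<in> borel_measurable M'"
    and eq: "\<And>l. set l \<subseteq> G \<Longrightarrow>
      (\<integral>\<^sup>+M. nexp (\<Sum>A\<leftarrow>l. emeasure M A) \<partial>P) = (\<integral>\<^sup>+M. nexp (\<Sum>A\<leftarrow>l. emeasure M A) \<partial>Q)"
  shows "P = Q"
proof -
  interpret P: finite_measure P by fact
  define E where "E = {{M\<in>C. \<forall>A\<in>I. emeasure M A \<in> B A} | I B. finite I \<and> I \<subseteq> G \<and> (\<forall>A. B A \<in> sets borel)}"
  note [measurable_cong] = sP sQ
  have spP: "space P = C" and spQ: "space Q = C"
    using sets_eq_imp_space_eq[OF sP] sets_eq_imp_space_eq[OF sQ] by auto
  have joint: "emeasure P {M\<in>C. \<forall>A\<in>I. emeasure M A \<in> B A} = emeasure Q {M\<in>C. \<forall>A\<in>I. emeasure M A \<in> B A}"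
    if I: "finite I" "I \<subseteq> G" "\<And>A. B A \<in> sets borel" for I B
  proof -
    have "emeasure P {M\<in>space P. \<forall>A\<in>I. emeasure M A \<in> B A} = emeasure Q {M\<in>space Q. \<forall>A\<in>I. emeasure M A \<in> B A}"
    proof (rule emeasure_joint_eqI_laplace[OF fP fQ _ _ _ I(1,2,3)])
      show "sets P = sets Q" using sP sQ by simp
      show "(\<lambda>M. emeasure M A) \<in> borel_measurable P" if "A \<in> G" for A
      proof -
        have [measurable]: "A \<in> sets borel" using that G by auto
        show ?thesis by measurable
      qed
      fix J and m :: "'a set \<Rightarrow> nat" assume J: "finite J" "J \<subseteq> G"
      obtain l where l: "set l \<subseteq> J" "\<And>f::'a set \<Rightarrow> ennreal. sum_list (map f l) = (\<Sum>i\<in>J. of_nat (m i) * f i)"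
        using sum_list_as_sum[OF J(1), of m] by blast
      show "(\<integral>\<^sup>+M. nexp (\<Sum>A\<in>J. of_nat (m A) * emeasure M A) \<partial>P) = (\<integral>\<^sup>+M. nexp (\<Sum>A\<in>J. of_nat (m A) * emeasure M A) \<partial>Q)"
        using eq[of l] l J by auto
    qed
    then show ?thesis using spP spQ by simp
  qed
  have E: "E \<subseteq> Pow C" by (auto simp: E_def)
  have "sets (measures_algebra C) = sigma_sets C E"
  proof
    \<comment> \<open>\<open>gen\<close> is applied to the algebra generated by the cylinders:
      evaluations at \<open>G\<close> are measurable there, hence all evaluations are.\<close>
    have "(\<lambda>M. M) \<in> measurable (sigma C E) (measures_algebra C)"
    proof (rule measurable_measures_algebra)
      show "M \<in> C" if "M \<in> space (sigma C E)" for M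
        using that E by simp
      fix A :: "'a set" assume A: "A \<in> sets borel"
      show "(\<lambda>M. emeasure M A) \<in> borel_measurable (sigma C E)"
      proof (rule gen)
        fix A :: "'a set" assume A: "A \<in> G"
        show "(\<lambda>M. emeasure M A) \<in> borel_measurable (sigma C E)"
        proof (rule measurableI)
          fix S :: "ennreal set" assume "S \<in> sets borel"
          then have "{M\<in>C. \<forall>A\<in>{A}. emeasure M A \<in> S} \<in> E"
            unfolding E_def using A by (intro CollectI exI[of _ "{A}"] exI[of _ "\<lambda>_. S"]) auto
          moreover have "{M\<in>C. \<forall>A\<in>{A}. emeasure M A \<in> S} = (\<lambda>M. emeasure M A) -` S \<inter> space (sigma C E)"
            using E by auto
          ultimately show "(\<lambda>M. emeasure M A) -` S \<inter> space (sigma C E) \<in> sets (sigma C E)"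
            using E by (auto simp: sets_measure_of)
        qed simp
      qed (use A E in auto)
    qed
    then show "sets (measures_algebra C) \<subseteq> sigma_sets C E"
    proof -
      assume id: "(\<lambda>M. M) \<in> measurable (sigma C E) (measures_algebra C)"
      show ?thesis
      proof
        fix X assume X: "X \<in> sets (measures_algebra C)"
        then have "(\<lambda>M. M) -` X \<inter> space (sigma C E) \<in> sets (sigma C E)"
          by (rule measurable_sets[OF id])
        moreover have "X \<subseteq> C" using sets.sets_into_space[OF X] by simp
        ultimately show "X \<in> sigma_sets C E"
          using E by (simp add: sets_measure_of Int_absorb2)
      qed
    qed
    have "X \<in> sets (measures_algebra C)" if "X \<in> E" for X
    proof -
      from that obtain I B where X: "X = {M\<in>C. \<forall>A\<in>I. emeasure M A \<in> B A}" "finite I" "I \<subseteq> G" "\<And>A. B A \<in> sets borel"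
        unfolding E_def by auto
      have [measurable]: "A \<in> I \<Longrightarrow> A \<in> sets borel" for A using X G by auto
      note [measurable] = X(4)
      have "{M\<in>space (measures_algebra C). \<forall>A\<in>I. emeasure M A \<in> B A} \<in> sets (measures_algebra C)"
        using X(2) by measurable
      then show ?thesis using X(1) by simp
    qed
    then show "sigma_sets C E \<subseteq> sets (measures_algebra C)"
      by (intro sets.sigma_sets_subset') (use sets.top[of "measures_algebra C"] in auto)
  qed
  note gE = this
  show ?thesis
  proof (rule measure_eqI_generator_eq[where E = E and \<Omega> = C and A = "\<lambda>_. C"])
    show "Int_stable E"
    proof (rule Int_stableI)
      fix X Y assume "X \<in> E" and "Y \<in> E"
      from \<open>X \<in> E\<close> obtain I B where
        X: "X = {M\<in>C. \<forall>A\<in>I. emeasure M A \<in> B A}" "finite I" "I \<subseteq> G" "\<And>A. B A \<in> sets borel"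
        unfolding E_def by auto
      from \<open>Y \<in> E\<close> obtain J B' where
        Y: "Y = {M\<in>C. \<forall>A\<in>J. emeasure M A \<in> B' A}" "finite J" "J \<subseteq> G" "\<And>A. B' A \<in> sets borel"
        unfolding E_def by auto
      define B'' where "B'' = (\<lambda>A. (if A \<in> I then B A else UNIV) \<inter> (if A \<in> J then B' A else UNIV))"
      have "X \<inter> Y = {M\<in>C. \<forall>A\<in>I\<union>J. emeasure M A \<in> B'' A}"
        unfolding X(1) Y(1) B''_def by (auto split: if_splits)
      moreover have "B'' A \<in> sets borel" for A
        using X(4) Y(4) unfolding B''_def by auto
      ultimately show "X \<inter> Y \<in> E"
        unfolding E_def using X Y by (intro CollectI exI[of _ "I \<union> J"] exI[of _ B'']) auto
    qed
    show "emeasure P X = emeasure Q X" if "X \<in> E" for X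
      using that joint unfolding E_def by auto
    show "range (\<lambda>_::nat. C) \<subseteq> E"
      unfolding E_def by (auto intro!: exI[of _ "{}"] exI[of _ "\<lambda>_. {}"])
  qed (use E sP sQ gE P.emeasure_finite in auto)
qed

text \<open>Subprobability kernels have measurable integrals. A kernel that is finite along one
  exhaustion \<open>D\<close> common to all \<open>x\<close> is brought into that form by
  restriction to \<open>D k\<close> and division by a measurable constant; the supremum over
  \<open>k\<close> undoes the restriction.\<close>

lemma measurable_nn_integral_kernel:
  assumes sets: "\<And>x. x \<in> space M \<Longrightarrow> sets (K x) = sets R"
    and K: "\<And>A. A \<in> sets R \<Longrightarrow> (\<lambda>x. emeasure (K x) A) \<in> borel_measurable M"
    and D: "range D \<subseteq> sets R" "incseq D" "(\<Union>k. D k) = space R"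
    and fin: "\<And>x (k::nat). x \<in> space M \<Longrightarrow> emeasure (K x) (D k) < \<infinity>"
    and f: "f \<in> borel_measurable (M \<Otimes>\<^sub>M R)"
  shows "(\<lambda>x. \<integral>\<^sup>+z. f (x, z) \<partial>K x) \<in> borel_measurable M"
\<comment> \<open>A subprobability space is nonempty by definition, so the empty space is treated
  apart.\<close>
proof (cases "space R = {}")
  case True
  then have "space (K x) = {}" if "x \<in> space M" for x
    using sets_eq_imp_space_eq[OF sets[OF that]] by simp
  then have "(\<integral>\<^sup>+z. f (x, z) \<partial>K x) = 0" if "x \<in> space M" for x
    using that nn_integral_empty[of "K x" "\<lambda>z. f (x, z)"] by simp
  then show ?thesis by (simp cong: measurable_cong)
next
  case False
  have Dk[measurable]: "D k \<in> sets R" for k using D(1) by auto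
  have sp: "space (K x) = space R" if "x \<in> space M" for x
    using sets_eq_imp_space_eq[OF sets[OF that]] .
  have fx: "(\<lambda>z. f (x, z)) \<in> borel_measurable (K x)" if "x \<in> space M" for x
    using measurable_compose[OF measurable_Pair1'[OF that] f] sets[OF that] by (simp cong: measurable_cong_sets)
  \<comment> \<open>The summand \<open>1\<close> keeps the normaliser away from \<open>0\<close>, so
    that it can be inverted for every \<open>x\<close>.\<close>
  define c where "c = (\<lambda>k x. 1 + emeasure (K x) (D k))"
  have c[measurable]: "c k \<in> borel_measurable M" for k
    unfolding c_def using K[OF Dk] by measurable
  have c1: "1 \<le> c k x" "c k x < \<infinity>" if "x \<in> space M" for k x
    using fin[OF that] by (auto simp: c_def)
  have ci: "c k x * inverse (c k x) = 1" if "x \<in> space M" for k x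
  proof -
    have "c k x \<noteq> 0" using c1[OF that, of k] by auto
    then show ?thesis
      using c1[OF that, of k] ennreal_divide_self[of "c k x"] by (simp add: divide_ennreal_def)
  qed
  define L where "L = (\<lambda>k x. density (K x) (\<lambda>z. inverse (c k x) * indicator (D k) z))"
  have meK: "emeasure (L k x) A = inverse (c k x) * emeasure (K x) (A \<inter> D k)"
    if "x \<in> space M" "A \<in> sets R" for k x A
    unfolding L_def using that sets[OF that(1)]
    by (simp add: emeasure_density nn_integral_cmult mult.assoc indicator_inter_arith[symmetric] Int_commute)
  have L: "L k \<in> measurable M (subprob_algebra R)" for k
  proof (rule measurable_subprob_algebra)
    fix x assume x: "x \<in> space M"
    show "sets (L k x) = sets R" using sets[OF x] by (simp add: L_def)
    show "subprob_space (L k x)"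
    proof (rule subprob_spaceI)
      have "emeasure (L k x) (space R) = inverse (c k x) * emeasure (K x) (space R \<inter> D k)"
        by (rule meK[OF x]) simp
      also have "space R \<inter> D k = D k" using sets.sets_into_space[OF Dk] by auto
      also have "inverse (c k x) * emeasure (K x) (D k) \<le> inverse (c k x) * c k x"
        by (intro mult_left_mono) (auto simp: c_def)
      also have "\<dots> = 1" using ci[OF x, of k] by (simp add: mult.commute)
      finally show "emeasure (L k x) (space (L k x)) \<le> 1" by (simp add: L_def sp[OF x])
    qed (use False in \<open>simp add: L_def sp[OF x]\<close>)
  next
    fix A assume A: "A \<in> sets R"
    have "(\<lambda>x. inverse (c k x) * emeasure (K x) (A \<inter> D k)) \<in> borel_measurable M"
      using K[of "A \<inter> D k"] A by measurable
    then show "(\<lambda>x. emeasure (L k x) A) \<in> borel_measurable M"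
      using A by (simp add: meK cong: measurable_cong)
  qed
  have "(\<lambda>x. SUP k. c k x * (\<integral>\<^sup>+z. f (x, z) \<partial>L k x)) \<in> borel_measurable M"
    using nn_integral_measurable_subprob_algebra2[OF _ L, of "\<lambda>x z. f (x, z)"] f by measurable
  moreover have "(\<integral>\<^sup>+z. f (x, z) \<partial>K x) = (SUP k. c k x * (\<integral>\<^sup>+z. f (x, z) \<partial>L k x))" if x: "x \<in> space M" for x
  proof -
    note [measurable_cong] = sets[OF x]
    note [measurable] = fx[OF x]
    have "c k x * (\<integral>\<^sup>+z. f (x, z) \<partial>L k x) = (\<integral>\<^sup>+z. f (x, z) * indicator (D k) z \<partial>K x)" for k
    proof -
      have "(\<integral>\<^sup>+z. f (x, z) \<partial>L k x) = (\<integral>\<^sup>+z. inverse (c k x) * (f (x, z) * indicator (D k) z) \<partial>K x)"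
        unfolding L_def by (subst nn_integral_density) (auto simp: mult_ac)
      also have "\<dots> = inverse (c k x) * (\<integral>\<^sup>+z. f (x, z) * indicator (D k) z \<partial>K x)"
        by (rule nn_integral_cmult) measurable
      finally have "c k x * (\<integral>\<^sup>+z. f (x, z) \<partial>L k x) = (c k x * inverse (c k x)) * (\<integral>\<^sup>+z. f (x, z) * indicator (D k) z \<partial>K x)"
        by (simp add: mult.assoc)
      also have "c k x * inverse (c k x) = 1"
        by (rule ci[OF x])
      finally show ?thesis by simp
    qed
    moreover have "(\<integral>\<^sup>+z. f (x, z) \<partial>K x) = (SUP k. \<integral>\<^sup>+z. f (x, z) * indicator (D k) z \<partial>K x)"
    proof -
      have "(SUP k. \<integral>\<^sup>+z. f (x, z) * indicator (D k) z \<partial>K x) = (\<integral>\<^sup>+z. (SUP k. f (x, z) * indicator (D k) z) \<partial>K x)"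
        using D(2) by (intro nn_integral_monotone_convergence_SUP[symmetric])
          (auto simp: incseq_def le_fun_def indicator_def split: if_splits)
      also have "\<dots> = (\<integral>\<^sup>+z. f (x, z) \<partial>K x)"
      proof (rule nn_integral_cong)
        fix z assume "z \<in> space (K x)"
        then obtain k where k: "z \<in> D k" using D(3) sp[OF x] by auto
        show "(SUP k. f (x, z) * indicator (D k) z) = f (x, z)"
        proof (rule antisym)
          show "(SUP k. f (x, z) * indicator (D k) z) \<le> f (x, z)"
            by (intro SUP_least) (auto simp: indicator_def)
          show "f (x, z) \<le> (SUP k. f (x, z) * indicator (D k) z)"
            by (rule SUP_upper2[of k]) (auto simp: k)
        qed
      qed
      finally show ?thesis ..
    qed
    ultimately show ?thesis by simp
  qed
  ultimately show ?thesis by (simp cong: measurable_cong)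
qed

text \<open>Measurability of inner integrals is an assumption on all test functions because its
  sources differ: common exhaustions, powers of a measure, posterior laws.\<close>

lemma nn_integral_kernel_prod:
  assumes sets: "\<And>x. x \<in> space M \<Longrightarrow> sets (K x) = sets R"
    and meas: "\<And>f. f \<in> borel_measurable (M \<Otimes>\<^sub>M R) \<Longrightarrow> (\<lambda>x. \<integral>\<^sup>+z. f (x, z) \<partial>K x) \<in> borel_measurable M"
    and f: "f \<in> borel_measurable (M \<Otimes>\<^sub>M R)"
  shows "integral\<^sup>N (kernel_prod M R K) f = (\<integral>\<^sup>+x. \<integral>\<^sup>+z. f (x, z) \<partial>K x \<partial>M)"
proof -
  have sect: "(\<lambda>z. g (x, z)) \<in> borel_measurable (K x)"
    if "x \<in> space M" "g \<in> borel_measurable (M \<Otimes>\<^sub>M R)" for x and g :: "_ \<Rightarrow> ennreal"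
    using measurable_compose[OF measurable_Pair1'[OF that(1)] that(2)] sets[OF that(1)] by (simp cong: measurable_cong_sets)
  show ?thesis
    using f
  proof (induction rule: borel_measurable_induct)
    case (cong f g)
    have "integral\<^sup>N (kernel_prod M R K) f = integral\<^sup>N (kernel_prod M R K) g"
      using cong by (intro nn_integral_cong) auto
    moreover have "(\<integral>\<^sup>+x. \<integral>\<^sup>+z. f (x, z) \<partial>K x \<partial>M) = (\<integral>\<^sup>+x. \<integral>\<^sup>+z. g (x, z) \<partial>K x \<partial>M)"
      using cong sets_eq_imp_space_eq[OF sets] by (intro nn_integral_cong) (auto simp: space_pair_measure)
    ultimately show ?case using cong by simp
  next
    case (set A)
    have "emeasure (kernel_prod M R K) A = (\<integral>\<^sup>+x. (\<integral>\<^sup>+z. indicator A (x, z) \<partial>K x) \<partial>M)"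
      using meas[OF borel_measurable_indicator] set by (intro emeasure_kernel_prod sets) auto
    with set show ?case by simp
  next
    case (mult u c)
    have m: "(\<lambda>z. u (x, z)) \<in> borel_measurable (K x)" if "x \<in> space M" for x
      using measurable_compose[OF measurable_Pair1'[OF that] mult(2)] sets[OF that] by (simp cong: measurable_cong_sets)
    have "integral\<^sup>N (kernel_prod M R K) (\<lambda>x. c * u x) = c * (\<integral>\<^sup>+x. \<integral>\<^sup>+z. u (x, z) \<partial>K x \<partial>M)"
      using mult by (subst nn_integral_cmult) (auto cong: measurable_cong_sets)
    also have "\<dots> = (\<integral>\<^sup>+x. c * (\<integral>\<^sup>+z. u (x, z) \<partial>K x) \<partial>M)"
      by (rule nn_integral_cmult[symmetric]) (rule meas, fact)
    also have "\<dots> = (\<integral>\<^sup>+x. (\<integral>\<^sup>+z. c * u (x, z) \<partial>K x) \<partial>M)"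
      by (intro nn_integral_cong nn_integral_cmult[symmetric] m)
    finally show ?case .
  next
    case (add u v)
    have m: "(\<lambda>z. u (x, z)) \<in> borel_measurable (K x)" "(\<lambda>z. v (x, z)) \<in> borel_measurable (K x)" if "x \<in> space M" for x
      using add by (auto intro: sect that)
    have "integral\<^sup>N (kernel_prod M R K) (\<lambda>x. v x + u x) = (\<integral>\<^sup>+x. \<integral>\<^sup>+z. v (x, z) \<partial>K x \<partial>M) + (\<integral>\<^sup>+x. \<integral>\<^sup>+z. u (x, z) \<partial>K x \<partial>M)"
      using add by (subst nn_integral_add) (auto cong: measurable_cong_sets)
    also have "\<dots> = (\<integral>\<^sup>+x. (\<integral>\<^sup>+z. v (x, z) \<partial>K x) + (\<integral>\<^sup>+z. u (x, z) \<partial>K x) \<partial>M)"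
      by (rule nn_integral_add[symmetric]) (rule meas, fact)+
    also have "\<dots> = (\<integral>\<^sup>+x. (\<integral>\<^sup>+z. v (x, z) + u (x, z) \<partial>K x) \<partial>M)"
      by (intro nn_integral_cong nn_integral_add[symmetric] m)
    finally show ?case .
  next
    case (seq U)
    have m: "(\<lambda>z. U i (x, z)) \<in> borel_measurable (K x)" if "x \<in> space M" for x i
      using measurable_compose[OF measurable_Pair1'[OF that] seq(1)] sets[OF that] by (simp cong: measurable_cong_sets)
    have incU: "incseq (\<lambda>i z. U i (x, z))" for x
      using seq(3) by (auto simp: incseq_def le_fun_def)
    have "integral\<^sup>N (kernel_prod M R K) (SUP i. U i) = (SUP i. integral\<^sup>N (kernel_prod M R K) (U i))"
      unfolding SUP_apply using seq by (subst nn_integral_monotone_convergence_SUP) (auto cong: measurable_cong_sets)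
    also have "\<dots> = (SUP i. (\<integral>\<^sup>+x. \<integral>\<^sup>+z. U i (x, z) \<partial>K x \<partial>M))"
      using seq by simp
    also have "\<dots> = (\<integral>\<^sup>+x. (SUP i. \<integral>\<^sup>+z. U i (x, z) \<partial>K x) \<partial>M)"
      using seq(3) meas[OF seq(1)] by (intro nn_integral_monotone_convergence_SUP[symmetric])
        (auto simp: incseq_def le_fun_def intro!: nn_integral_mono)
    also have "\<dots> = (\<integral>\<^sup>+x. (\<integral>\<^sup>+z. (SUP i. U i (x, z)) \<partial>K x) \<partial>M)"
      by (intro nn_integral_cong nn_integral_monotone_convergence_SUP[symmetric] m incU)
    finally show ?case by (simp add: SUP_apply[abs_def] image_comp)
  qed
qed

text \<open>The set functions under \<open>measure_of\<close> already coincide, before any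
  measurability enters; this is what makes passing to another version of a kernel cheap.\<close>

lemma kernel_prod_cong_AE:
  assumes "AE x in M. K x = K' x"
  shows "kernel_prod M R K = kernel_prod M R K'"
proof -
  have "(\<lambda>A. \<integral>\<^sup>+x. (\<integral>\<^sup>+z. indicator A (x, z) \<partial>K x) \<partial>M) = (\<lambda>A. \<integral>\<^sup>+x. (\<integral>\<^sup>+z. indicator A (x, z) \<partial>K' x) \<partial>M)"
    using assms by (intro ext nn_integral_cong_AE) auto
  then show ?thesis by (simp add: kernel_prod_def)
qed

section \<open>Poisson random measures\<close>

lemma suminf_poisson: "(\<Sum>k. ennreal (z ^ k) * ennreal (exp (- c0) * c0 ^ k / fact k)) = ennreal (exp (- c0 * (1 - z)))"
  if "0 \<le> c0" "0 \<le> z"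
proof -
  have *: "(\<lambda>k. exp (- c0) * ((c0 * z) ^ k /\<^sub>R fact k)) sums (exp (- c0) * exp (c0 * z))"
    by (intro sums_mult exp_converges)
  have "(\<Sum>k. ennreal (z ^ k) * ennreal (exp (- c0) * c0 ^ k / fact k)) =
      (\<Sum>k. ennreal (exp (- c0) * ((c0 * z) ^ k /\<^sub>R fact k)))"
    using that by (intro suminf_cong) (simp add: ennreal_mult[symmetric] power_mult_distrib field_simps)
  also have "\<dots> = ennreal (exp (- c0) * exp (c0 * z))"
    using that by (intro suminf_ennreal_eq *) auto
  finally show ?thesis by (simp add: exp_add[symmetric] algebra_simps)
qed

lemma (in prob_space) laplace_poisson:
  assumes X[measurable]: "X \<in> borel_measurable M" and c0: "0 \<le> c0"
    and pmf: "\<And>k::nat. measure M {\<omega>\<in>space M. X \<omega> = of_nat k} = exp (- c0) * c0 ^ k / fact k"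
  shows "(\<integral>\<^sup>+\<omega>. nexp (c * X \<omega>) \<partial>M) = nexp ((1 - nexp c) * ennreal c0)"
proof -
  let ?E = "\<lambda>k::nat. {\<omega>\<in>space M. X \<omega> = of_nat k}"
  have [measurable]: "?E k \<in> sets M" for k by measurable
  have p: "emeasure M (?E k) = ennreal (exp (- c0) * c0 ^ k / fact k)" for k
    by (simp add: emeasure_eq_measure pmf)
  have disj: "disjoint_family ?E" by (auto simp: disjoint_family_on_def)
  \<comment> \<open>The factor \<open>1 ^ k\<close> is \<open>z ^ k\<close> at \<open>z = 1\<close>:
    the integers carry the whole mass of \<open>X\<close>, so the transform is a series over
    them.\<close>
  have "emeasure M (\<Union>k. ?E k) = (\<Sum>k. ennreal (1 ^ k) * ennreal (exp (- c0) * c0 ^ k / fact k))"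
    using disj by (subst suminf_emeasure[symmetric]) (auto simp: p)
  also have "\<dots> = 1" using c0 by (subst suminf_poisson) auto
  finally have "AE \<omega> in M. \<omega> \<in> (\<Union>k. ?E k)"
    by (subst AE_in_set_eq_1) (auto simp: emeasure_eq_measure)
  then have "(\<integral>\<^sup>+\<omega>. nexp (c * X \<omega>) \<partial>M) = (\<integral>\<^sup>+\<omega>. (\<Sum>k. nexp (of_nat k * c) * indicator (?E k) \<omega>) \<partial>M)"
  proof (intro nn_integral_cong_AE, eventually_elim)
    case (elim \<omega>)
    then obtain k where k: "\<omega> \<in> ?E k" by auto
    have "(\<Sum>j. nexp (of_nat j * c) * indicator (?E j) \<omega>) = (\<Sum>j\<in>{k}. nexp (of_nat j * c) * indicator (?E j) \<omega>)"
      using k by (intro suminf_finite) (auto simp: indicator_def)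
    also have "\<dots> = nexp (c * X \<omega>)"
      using k by (simp add: mult.commute[of c])
    finally show ?case by (rule sym)
  qed
  also have "\<dots> = (\<Sum>k. nexp (of_nat k * c) * emeasure M (?E k))"
    by (subst nn_integral_suminf) (auto simp: nn_integral_cmult)
  also have "\<dots> = ennreal (exp (- c0 * (1 - exp_neg c)))"
    unfolding p nexp_of_nat_mult using c0 by (subst suminf_poisson) auto
  also have "\<dots> = nexp ((1 - nexp c) * ennreal c0)"
    using c0 by (simp add: nexp_def[of c] ennreal_minus ennreal_mult[symmetric] nexp_ennreal mult.commute flip: ennreal_1)
  finally show ?thesis .
qed

text \<open>A law to compare with: a mass of a random measure is recognised as Poisson by matching
  its transform with that of \<open>Q\<close>. Rate \<open>0\<close> gives the point mass at
  \<open>0\<close>.\<close>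

lemma poisson_law_exists:
  assumes c0: "0 \<le> c0"
  obtains Q :: "ennreal measure" where "prob_space Q" "sets Q = sets borel"
    "\<And>k::nat. measure Q {of_nat k} = exp (- c0) * c0 ^ k / fact k"
proof -
  define p where "p = (\<lambda>k. ennreal (exp (- c0) * c0 ^ k / fact k))"
  define Q :: "ennreal measure" where "Q = distr (density (count_space UNIV) p) borel of_nat"
  have "(\<Sum>k. ennreal (1 ^ k) * p k) = 1" unfolding p_def using c0 by (subst suminf_poisson) auto
  then have "prob_space (density (count_space UNIV) p)"
    by (intro prob_spaceI) (simp add: emeasure_density nn_integral_count_space_nat)
  then have Q: "prob_space Q" unfolding Q_def by (rule prob_space.prob_space_distr) simp
  have "emeasure Q {of_nat k} = p k" for k
  proof -
    have "emeasure Q {of_nat k} = emeasure (density (count_space UNIV) p) {k}"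
      unfolding Q_def by (subst emeasure_distr) (auto intro!: arg_cong[where f = "emeasure _"])
    also have "\<dots> = (\<Sum>j. p j * indicator {k} j)" by (simp add: emeasure_density nn_integral_count_space_nat)
    also have "\<dots> = (\<Sum>j\<in>{k}. p j * indicator {k} j)"
      by (intro suminf_finite) (auto simp: indicator_def)
    finally show ?thesis by simp
  qed
  then have "measure Q {of_nat k} = exp (- c0) * c0 ^ k / fact k" for k
    using c0 by (simp add: measure_def p_def)
  moreover have "sets Q = sets borel" by (simp add: Q_def)
  ultimately show ?thesis using that Q by blast
qed

lemma borel_measurable_sum_list_indicator:
  "set l \<subseteq> sets M \<Longrightarrow> (\<lambda>x. \<Sum>A\<leftarrow>l. indicator A x :: ennreal) \<in> borel_measurable M"
proof (induction l)
  case (Cons A l)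
  then have [measurable]: "A \<in> sets M" "(\<lambda>x. \<Sum>A\<leftarrow>l. indicator A x :: ennreal) \<in> borel_measurable M"
    by auto
  show ?case by simp
qed simp

lemma nn_integral_sum_list_indicator:
  "set l \<subseteq> sets M \<Longrightarrow> (\<integral>\<^sup>+x. (\<Sum>A\<leftarrow>l. indicator A x) \<partial>M) = (\<Sum>A\<leftarrow>l. emeasure M A)"
proof (induction l)
  case (Cons A l)
  then have [measurable]: "A \<in> sets M" "(\<lambda>x. \<Sum>A\<leftarrow>l. indicator A x :: ennreal) \<in> borel_measurable M"
    using borel_measurable_sum_list_indicator[of l M] by auto
  show ?case using Cons by (simp add: nn_integral_add)
qed simp

text \<open>Sums of indicators over a list are particular test functions, and with all Borel sets as
  generator the generation condition is immediate.\<close>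

lemma finite_measure_eqI_laplace_integral:
  fixes P Q :: "'a::topological_space measure measure"
  assumes fP: "finite_measure P" and fQ: "finite_measure Q"
    and sP: "sets P = sets (measures_algebra C)" and sQ: "sets Q = sets (measures_algebra C)"
    and C: "\<And>M. M \<in> C \<Longrightarrow> sets M = sets borel"
    and eq: "\<And>g. g \<in> borel_measurable borel \<Longrightarrow>
      (\<integral>\<^sup>+M. nexp (integral\<^sup>N M g) \<partial>P) = (\<integral>\<^sup>+M. nexp (integral\<^sup>N M g) \<partial>Q)"
  shows "P = Q"
proof (rule finite_measure_eqI_laplace_functional[OF fP fQ sP sQ, where G = "sets borel"])
  fix l :: "'a set list" assume l: "set l \<subseteq> sets borel"
  define g where "g = (\<lambda>x. \<Sum>A\<leftarrow>l. indicator A x :: ennreal)"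
  have g: "g \<in> borel_measurable borel" unfolding g_def using l by (rule borel_measurable_sum_list_indicator)
  have "(\<integral>\<^sup>+M. nexp (\<Sum>A\<leftarrow>l. emeasure M A) \<partial>R) = (\<integral>\<^sup>+M. nexp (integral\<^sup>N M g) \<partial>R)"
    if R: "sets R = sets (measures_algebra C)" for R
  proof (intro nn_integral_cong arg_cong[where f = nexp])
    fix M assume "M \<in> space R"
    then have "sets M = sets borel" using sets_eq_imp_space_eq[OF R] C by simp
    then show "(\<Sum>A\<leftarrow>l. emeasure M A) = integral\<^sup>N M g"
      unfolding g_def using l by (intro nn_integral_sum_list_indicator[symmetric]) simp
  qed
  with eq[OF g] sP sQ show "(\<integral>\<^sup>+M. nexp (\<Sum>A\<leftarrow>l. emeasure M A) \<partial>P) = (\<integral>\<^sup>+M. nexp (\<Sum>A\<leftarrow>l. emeasure M A) \<partial>Q)"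
    by simp
qed auto

section \<open>The Laplace functional of a Poisson random measure\<close>

locale poisson_rm =
  fixes \<Omega> :: "'w measure" and N :: "'w \<Rightarrow> 'a::topological_space measure" and \<nu> :: "'a measure"
  assumes prm: "poisson_random_measure \<Omega> N \<nu>" and sets_nu: "sets \<nu> = sets borel"
begin

sublocale prob_space \<Omega>
  using prm by (simp add: poisson_random_measure_def)

lemma measurable_N [measurable]: "N \<in> measurable \<Omega> borel_measures"
  using prm by (simp add: poisson_random_measure_def)

lemma sets_N: "\<omega> \<in> space \<Omega> \<Longrightarrow> sets (N \<omega>) = sets borel"
  using measurable_space[OF measurable_N] by simp

lemma laplace_set:
  assumes A[measurable]: "A \<in> sets borel" and c: "c < \<infinity>"
  shows "(\<integral>\<^sup>+\<omega>. nexp (c * emeasure (N \<omega>) A) \<partial>\<Omega>) = nexp ((1 - nexp c) * emeasure \<nu> A)"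
proof (cases "emeasure \<nu> A = \<infinity>")
  case True
  then have AE: "AE \<omega> in \<Omega>. emeasure (N \<omega>) A = \<infinity>"
    using prm A unfolding poisson_random_measure_def by blast
  show ?thesis
  \<comment> \<open>With \<open>0 * \<infinity> = 0\<close> both sides are \<open>1\<close> when
    \<open>c = 0\<close>; for \<open>c > 0\<close> both vanish.\<close>
  proof (cases "c = 0")
    case True
    then show ?thesis by (simp add: emeasure_space_1)
  next
    case False
    have "(\<integral>\<^sup>+\<omega>. nexp (c * emeasure (N \<omega>) A) \<partial>\<Omega>) = (\<integral>\<^sup>+\<omega>. 0 \<partial>\<Omega>)"
      using AE False by (intro nn_integral_cong_AE) (auto simp: ennreal_mult_top elim!: eventually_mono)
    moreover have "nexp c < 1"
      using False c by (cases c) (auto simp: nexp_ennreal ennreal_less_one_iff)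
    then have "1 - nexp c \<noteq> 0" by (simp add: diff_eq_0_iff_ennreal)
    ultimately show ?thesis using True by (simp add: ennreal_mult_top)
  qed
next
  case False
  then have "emeasure \<nu> A = ennreal (measure \<nu> A)"
    by (simp add: emeasure_eq_ennreal_measure)
  moreover have "(\<integral>\<^sup>+\<omega>. nexp (c * emeasure (N \<omega>) A) \<partial>\<Omega>) = nexp ((1 - nexp c) * ennreal (measure \<nu> A))"
    using prm A False unfolding poisson_random_measure_def
    by (intro laplace_poisson) (auto simp: less_top)
  ultimately show ?thesis by simp
qed

text \<open>The level sets of \<open>g\<close> are disjoint, so their masses are independent and the
  expectation factorises into transforms of single sets.\<close>

lemma laplace_simple:
  assumes g: "simple_function borel g" and fin: "\<And>x. g x < \<infinity>"
  shows "(\<integral>\<^sup>+\<omega>. nexp (integral\<^sup>N (N \<omega>) g) \<partial>\<Omega>) = nexp (\<integral>\<^sup>+x. 1 - nexp (g x) \<partial>\<nu>)"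
proof -
  have gm[measurable]: "g \<in> borel_measurable borel" using g by (rule borel_measurable_simple_function)
  have fr: "finite (range g)" using simple_functionD(1)[OF g] by simp
  define n where "n = card (range g)"
  \<comment> \<open>An enumeration by an initial segment, because independence of the masses is
    available for families indexed by \<open>{..<n}\<close>.\<close>
  obtain r where r: "bij_betw r {..<n} (range g)"
    using ex_bij_betw_nat_finite[OF fr] unfolding n_def atLeast0LessThan by blast
  define A where "A = (\<lambda>i. g -` {r i})"
  have A[measurable]: "A i \<in> sets borel" for i
    using measurable_sets[OF gm, of "{r i}"] by (simp add: A_def)
  have disj: "disjoint_family_on A {..<n}"
    using r by (auto simp: disjoint_family_on_def A_def bij_betw_def inj_on_def)
  have rf: "r i < \<infinity>" if "i < n" for i
  proof -
    have "r i \<in> range g" using r that by (auto simp: bij_betw_def)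
    then show ?thesis using fin by auto
  qed
  \<comment> \<open>\<open>F\<close> stays general: the identity function is needed under
    \<open>N\<close>, and \<open>1 - nexp\<close> under \<open>\<nu>\<close>.\<close>
  have gsum: "F (g x) = (\<Sum>i<n. F (r i) * indicator (A i) x)" for x and F :: "ennreal \<Rightarrow> ennreal"
  proof -
    have "g x \<in> r ` {..<n}" using r by (simp add: bij_betw_def)
    then obtain j where j: "j < n" "g x = r j" by auto
    have "indicator (A i) x = (if i = j then 1 else 0 :: ennreal)" if "i < n" for i
      using that j r by (auto simp: A_def bij_betw_def inj_on_def indicator_def)
    then have "(\<Sum>i<n. F (r i) * indicator (A i) x) = (\<Sum>i<n. if i = j then F (r j) else 0)"
      by (intro sum.cong) auto
    then show ?thesis using j by simp
  qed
  have int: "(\<integral>\<^sup>+x. F (g x) \<partial>L) = (\<Sum>i<n. F (r i) * emeasure L (A i))"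
    if [measurable_cong]: "sets L = sets borel" for L and F :: "ennreal \<Rightarrow> ennreal"
  proof -
    have "(\<integral>\<^sup>+x. F (g x) \<partial>L) = (\<integral>\<^sup>+x. (\<Sum>i<n. F (r i) * indicator (A i) x) \<partial>L)"
      by (intro nn_integral_cong gsum)
    also have "\<dots> = (\<Sum>i<n. F (r i) * emeasure L (A i))"
      by (subst nn_integral_sum) (auto simp: nn_integral_cmult)
    finally show ?thesis .
  qed
  have "(\<integral>\<^sup>+\<omega>. nexp (integral\<^sup>N (N \<omega>) g) \<partial>\<Omega>) = (\<integral>\<^sup>+\<omega>. (\<Prod>i<n. nexp (r i * emeasure (N \<omega>) (A i))) \<partial>\<Omega>)"
    using int[of "N _" "\<lambda>x. x"] by (intro nn_integral_cong) (simp add: sets_N nexp_sum)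
  also have "\<dots> = (\<Prod>i<n. \<integral>\<^sup>+\<omega>. nexp (r i * emeasure (N \<omega>) (A i)) \<partial>\<Omega>)"
  proof (rule indep_vars_nn_integral)
    have "indep_vars (\<lambda>_. borel) (\<lambda>i \<omega>. emeasure (N \<omega>) (A i)) {..<n}"
      using prm disj A unfolding poisson_random_measure_def by (auto simp: image_subset_iff)
    then show "indep_vars (\<lambda>_. borel) (\<lambda>i \<omega>. nexp (r i * emeasure (N \<omega>) (A i))) {..<n}"
      by (rule indep_vars_compose2) measurable
  qed auto
  also have "\<dots> = (\<Prod>i<n. nexp ((1 - nexp (r i)) * emeasure \<nu> (A i)))"
    by (intro prod.cong refl laplace_set) (use rf in \<open>auto simp: less_top\<close>)
  also have "\<dots> = nexp (\<integral>\<^sup>+x. 1 - nexp (g x) \<partial>\<nu>)"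
    using int[OF sets_nu, of "\<lambda>y. 1 - nexp y"] by (simp add: nexp_sum)
  finally show ?thesis .
qed

lemma measurable_integral_N [measurable]:
  assumes "g \<in> borel_measurable borel"
  shows "(\<lambda>\<omega>. integral\<^sup>N (N \<omega>) g) \<in> borel_measurable \<Omega>"
  by (rule measurable_compose[OF measurable_N measurable_nn_integral_measures_algebra]) (use assms in auto)

text \<open>Simple functions increase to \<open>g\<close>. On the left the integrands are bounded by
  \<open>1\<close>, on the right \<open>1 - nexp (U i x)\<close> is increasing, so both limits are
  legitimate even when the integrals of \<open>g\<close> are infinite.\<close>

lemma laplace:
  assumes g[measurable]: "g \<in> borel_measurable borel"
  shows "(\<integral>\<^sup>+\<omega>. nexp (integral\<^sup>N (N \<omega>) g) \<partial>\<Omega>) = nexp (\<integral>\<^sup>+x. 1 - nexp (g x) \<partial>\<nu>)"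
proof -
  obtain U where U: "\<And>i::nat. simple_function borel (U i)" "incseq U" "\<And>i x. U i x < top" "\<And>x. (SUP i. U i x) = g x"
    using borel_measurable_implies_simple_function_sequence'[OF g] by blast
  have [measurable]: "U i \<in> borel_measurable borel" for i
    using U(1) by (rule borel_measurable_simple_function)
  have incx: "incseq (\<lambda>i. U i x)" for x using U(2) by (auto simp: incseq_def le_fun_def)
  have lim: "(\<lambda>i. U i x) \<longlonglongrightarrow> g x" for x
    using LIMSEQ_SUP[OF incx] U(4) by metis
  have limI: "(\<lambda>i. integral\<^sup>N L (U i)) \<longlonglongrightarrow> integral\<^sup>N L g" if "sets L = sets borel" for L
    using lim U(2) that by (intro nn_integral_LIMSEQ) (auto cong: measurable_cong_sets)
  have "(\<lambda>i. \<integral>\<^sup>+\<omega>. nexp (integral\<^sup>N (N \<omega>) (U i)) \<partial>\<Omega>) \<longlonglongrightarrow> (\<integral>\<^sup>+\<omega>. nexp (integral\<^sup>N (N \<omega>) g) \<partial>\<Omega>)"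
  proof (rule nn_integral_dominated_convergence[where w = "\<lambda>_. 1"])
    show "AE \<omega> in \<Omega>. (\<lambda>i. nexp (integral\<^sup>N (N \<omega>) (U i))) \<longlonglongrightarrow> nexp (integral\<^sup>N (N \<omega>) g)"
      using limI sets_N by (intro AE_I2 tendsto_nexp) auto
  qed (auto simp: emeasure_space_1)
  moreover have "(\<lambda>i. nexp (\<integral>\<^sup>+x. 1 - nexp (U i x) \<partial>\<nu>)) \<longlonglongrightarrow> nexp (\<integral>\<^sup>+x. 1 - nexp (g x) \<partial>\<nu>)"
  proof (intro tendsto_nexp nn_integral_LIMSEQ)
    show "incseq (\<lambda>i x. 1 - nexp (U i x))"
      using U(2) by (auto simp: incseq_def le_fun_def intro!: ennreal_minus_mono nexp_antimono)
    show "(\<lambda>x. 1 - nexp (U i x)) \<in> borel_measurable \<nu>" for i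
      using sets_nu by (simp cong: measurable_cong_sets)
    show "(\<lambda>i. 1 - nexp (U i x)) \<longlonglongrightarrow> 1 - nexp (g x)" for x
      using lim by (intro tendsto_diff_ennreal tendsto_const tendsto_nexp) auto
  qed
  ultimately show ?thesis
    using laplace_simple U by (simp add: LIMSEQ_unique)
qed

end

lemma poisson_random_measure_unique:
  assumes "poisson_random_measure P (\<lambda>N. N) \<nu>" "poisson_random_measure Q (\<lambda>N. N) \<nu>"
    and sP: "sets P = sets borel_measures" and sQ: "sets Q = sets borel_measures"
    and \<nu>: "sets \<nu> = sets borel"
  shows "P = Q"
proof -
  interpret P: poisson_rm P "\<lambda>N. N" \<nu> using assms by unfold_locales
  interpret Q: poisson_rm Q "\<lambda>N. N" \<nu> using assms by unfold_locales
  show ?thesis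
    using P.finite_measure_axioms Q.finite_measure_axioms sP sQ
    by (rule finite_measure_eqI_laplace_integral) (simp_all add: P.laplace Q.laplace)
qed

text \<open>The converse of \<open>laplace\<close>: multiples of one indicator as test functions
  yield the Poisson law of a single mass, and combinations over disjoint sets make the joint
  transform factorise, which is independence.\<close>

lemma poisson_random_measureI_laplace:
  fixes \<nu> :: "'a::topological_space measure"
  assumes P: "prob_space P" and sP: "sets P = sets borel_measures" and \<nu>: "sets \<nu> = sets borel"
    and nexp: "\<And>g. g \<in> borel_measurable borel \<Longrightarrow>
      (\<integral>\<^sup>+N. nexp (integral\<^sup>N N g) \<partial>P) = nexp (\<integral>\<^sup>+x. 1 - nexp (g x) \<partial>\<nu>)"
  shows "poisson_random_measure P (\<lambda>N. N) \<nu>"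
proof -
  interpret prob_space P by fact
  note [measurable_cong] = sP
  have spP: "N \<in> space P \<Longrightarrow> sets N = sets borel" for N
    using sets_eq_imp_space_eq[OF sP] by auto
  have lapA: "(\<integral>\<^sup>+N. nexp (of_nat m * emeasure N A) \<partial>P) = nexp ((1 - nexp (of_nat m)) * emeasure \<nu> A)"
    if A[measurable]: "A \<in> sets borel" for A and m :: nat
  proof -
    have "(\<integral>\<^sup>+N. nexp (of_nat m * emeasure N A) \<partial>P) = (\<integral>\<^sup>+N. nexp (\<integral>\<^sup>+x. of_nat m * indicator A x \<partial>N) \<partial>P)"
      using A by (intro nn_integral_cong) (simp add: spP nn_integral_cmult_indicator)
    also have "\<dots> = nexp (\<integral>\<^sup>+x. 1 - nexp (of_nat m * indicator A x) \<partial>\<nu>)"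
      by (rule nexp) measurable
    also have "(\<integral>\<^sup>+x. 1 - nexp (of_nat m * indicator A x) \<partial>\<nu>) = (\<integral>\<^sup>+x. (1 - nexp (of_nat m)) * indicator A x \<partial>\<nu>)"
      by (intro nn_integral_cong) (auto simp: indicator_def)
    also have "\<dots> = (1 - nexp (of_nat m)) * emeasure \<nu> A"
      using A \<nu> by (intro nn_integral_cmult_indicator) simp
    finally show ?thesis .
  qed
  show ?thesis
    unfolding poisson_random_measure_def
  proof (intro conjI allI ballI impI)
    show "prob_space P" by fact
    show "(\<lambda>N. N) \<in> measurable P borel_measures" by measurable
  next
    fix A :: "'a set" and k :: nat assume A[measurable]: "A \<in> sets borel" and fin: "emeasure \<nu> A < \<infinity>"
    obtain Q :: "ennreal measure" where Q: "prob_space Q" "sets Q = sets borel"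
      "\<And>k::nat. measure Q {of_nat k} = exp (- measure \<nu> A) * measure \<nu> A ^ k / fact k"
      using poisson_law_exists[of "measure \<nu> A"] by auto
    interpret Q: prob_space Q by fact
    note [measurable_cong] = Q(2)
    have spQ: "space Q = UNIV" using sets_eq_imp_space_eq[OF Q(2)] by simp
    have e\<nu>: "emeasure \<nu> A = ennreal (measure \<nu> A)"
      using fin by (simp add: emeasure_eq_ennreal_measure)
    have "distr P borel (\<lambda>N. emeasure N A) = Q"
    proof (rule finite_measure_eqI_laplace)
      show "finite_measure (distr P borel (\<lambda>N. emeasure N A))"
        by (intro prob_space.finite_measure prob_space_distr) measurable
      show "finite_measure Q" by unfold_locales
      fix m :: nat
      have "(\<integral>\<^sup>+x. nexp (of_nat m * x) \<partial>distr P borel (\<lambda>N. emeasure N A)) = (\<integral>\<^sup>+N. nexp (of_nat m * emeasure N A) \<partial>P)"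
        by (subst nn_integral_distr) auto
      also have "\<dots> = (\<integral>\<^sup>+x. nexp (of_nat m * x) \<partial>Q)"
        unfolding lapA[OF A] e\<nu> using Q(3) spQ by (intro Q.laplace_poisson[symmetric]) auto
      finally show "(\<integral>\<^sup>+x. nexp (of_nat m * x) \<partial>distr P borel (\<lambda>N. emeasure N A)) = (\<integral>\<^sup>+x. nexp (of_nat m * x) \<partial>Q)" .
    qed (use Q in auto)
    then have "measure (distr P borel (\<lambda>N. emeasure N A)) {of_nat k} = exp (- measure \<nu> A) * measure \<nu> A ^ k / fact k"
      using Q(3) by simp
    then show "measure P {\<omega> \<in> space P. emeasure \<omega> A = of_nat k} = exp (- measure \<nu> A) * measure \<nu> A ^ k / fact k"
      by (subst (asm) measure_distr) (auto simp: vimage_def Int_def conj_commute)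
  next
    fix A :: "'a set" assume A[measurable]: "A \<in> sets borel" and "emeasure \<nu> A = \<infinity>"
    \<comment> \<open>At \<open>m = 1\<close> the transform is
      \<open>nexp ((1 - nexp 1) * \<infinity>) = 0\<close>, and a vanishing expectation of
      \<open>e^{-N(A)}\<close> means \<open>N(A) = \<infinity>\<close> almost surely.\<close>
    moreover have "1 - nexp 1 \<noteq> 0"
    proof -
      have "nexp 1 < 1" using nexp_ennreal[of 1] by (simp add: ennreal_less_one_iff)
      then show ?thesis by (simp add: diff_eq_0_iff_ennreal)
    qed
    ultimately have "(\<integral>\<^sup>+N. nexp (emeasure N A) \<partial>P) = 0"
      using lapA[OF A, of 1] by (simp add: ennreal_mult_top)
    then show "AE \<omega> in P. emeasure \<omega> A = \<infinity>"
      by (subst (asm) nn_integral_0_iff_AE) auto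
  next
    fix n :: nat and A :: "nat \<Rightarrow> 'a set"
    assume A: "A ` {..<n} \<subseteq> sets borel" and disj: "disjoint_family_on A {..<n}"
    let ?I = "{..<n}"
    have Am[measurable]: "i \<in> ?I \<Longrightarrow> A i \<in> sets borel" for i using A by auto
    have NA[measurable]: "i \<in> ?I \<Longrightarrow> (\<lambda>N. emeasure N (A i)) \<in> borel_measurable P" for i
      by measurable
    show "indep_vars (\<lambda>_. borel) (\<lambda>i \<omega>. emeasure \<omega> (A i)) ?I"
    \<comment> \<open>Independence is read off from the equality of joint and product law, a
      criterion for nonempty index sets.\<close>
    proof (cases "n = 0")
      case True
      then show ?thesis by (simp add: indep_vars_def indep_sets_def)
    next
      case False
      let ?X = "\<lambda>N. \<lambda>i\<in>?I. emeasure N (A i)"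
      let ?D = "\<lambda>i. distr P borel (\<lambda>N. emeasure N (A i))"
      let ?B = "PiM ?I (\<lambda>_. borel :: ennreal measure)"
      have X[measurable]: "?X \<in> measurable P ?B" by measurable
      have sD: "sets (PiM ?I ?D) = sets ?B" by (intro sets_PiM_cong) auto
      have pD: "prob_space (PiM ?I ?D)"
        by (intro prob_space_PiM prob_space_distr) measurable
      have "distr P ?B ?X = PiM ?I ?D"
      proof (rule measure_eqI_PiM_finite[where I = ?I and M = "\<lambda>_. borel" and A = "\<lambda>_. Pi\<^sub>E ?I (\<lambda>_. UNIV)"])
        fix B :: "nat \<Rightarrow> ennreal set" assume B: "\<And>i. i \<in> ?I \<Longrightarrow> B i \<in> sets borel"
        have eq: "Pi\<^sub>E ?I B = {x\<in>space ?B. \<forall>i\<in>?I. x i \<in> B i}"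
          by (auto simp: space_PiM PiE_def)
        have "emeasure (distr P ?B ?X) {x\<in>space (distr P ?B ?X). \<forall>i\<in>?I. x i \<in> B i} =
              emeasure (PiM ?I ?D) {x\<in>space (PiM ?I ?D). \<forall>i\<in>?I. x i \<in> B i}"
        proof (rule emeasure_joint_eqI_laplace[where K = ?I])
          show "finite_measure (distr P ?B ?X)"
            by (intro prob_space.finite_measure prob_space_distr) measurable
          show "finite_measure (PiM ?I ?D)" using pD by (rule prob_space.finite_measure)
          show "(\<lambda>x. x i) \<in> borel_measurable (distr P ?B ?X)" if "i \<in> ?I" for i
            using that by measurable
          fix J and m :: "nat \<Rightarrow> nat" assume J: "finite J" "J \<subseteq> ?I"
          \<comment> \<open>Padding the exponents with \<open>0\<close> turns sums over
            \<open>J\<close> into sums over the full index set.\<close>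
          define m' where "m' = (\<lambda>i. if i \<in> J then m i else 0)"
          have m': "(\<Sum>i\<in>J. of_nat (m i) * y i) = (\<Sum>i<n. of_nat (m' i) * y i :: ennreal)" for y
            using J by (intro sum.mono_neutral_cong_left) (auto simp: m'_def)
          have "(\<integral>\<^sup>+x. nexp (\<Sum>i<n. of_nat (m' i) * x i) \<partial>distr P ?B ?X) =
              (\<integral>\<^sup>+N. nexp (\<Sum>i<n. of_nat (m' i) * emeasure N (A i)) \<partial>P)"
            by (subst nn_integral_distr) auto
          also have "\<dots> = (\<integral>\<^sup>+N. nexp (\<integral>\<^sup>+x. (\<Sum>i<n. of_nat (m' i) * indicator (A i) x) \<partial>N) \<partial>P)"
          proof (intro nn_integral_cong arg_cong[where f = nexp])
            fix N :: "'a measure" assume "N \<in> space P"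
            then have "A i \<in> sets N" if "i \<in> ?I" for i using that Am spP by auto
            then show "(\<Sum>i<n. of_nat (m' i) * emeasure N (A i)) = (\<integral>\<^sup>+x. (\<Sum>i<n. of_nat (m' i) * indicator (A i) x) \<partial>N)"
              by (subst nn_integral_sum) (auto simp: nn_integral_cmult_indicator)
          qed
          also have "\<dots> = nexp (\<integral>\<^sup>+x. 1 - nexp (\<Sum>i<n. of_nat (m' i) * indicator (A i) x) \<partial>\<nu>)"
            by (rule nexp) measurable
          also have "(\<integral>\<^sup>+x. 1 - nexp (\<Sum>i<n. of_nat (m' i) * indicator (A i) x) \<partial>\<nu>) =
             (\<integral>\<^sup>+x. (\<Sum>i<n. (1 - nexp (of_nat (m' i))) * indicator (A i) x) \<partial>\<nu>)"
          proof (intro nn_integral_cong)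
            fix x
            \<comment> \<open>By disjointness at most one indicator is nonzero at \<open>x\<close>,
              so \<open>1 - nexp\<close> passes through the sum.\<close>
            show "1 - nexp (\<Sum>i<n. of_nat (m' i) * indicator (A i) x) = (\<Sum>i<n. (1 - nexp (of_nat (m' i))) * indicator (A i) x)"
            proof (cases "\<exists>j<n. x \<in> A j")
              case True
              then obtain j where j: "j < n" "x \<in> A j" by auto
              have ind: "indicator (A i) x = (if i = j then 1 else 0 :: ennreal)" if "i < n" for i
                using disj j that by (auto simp: disjoint_family_on_def indicator_def)
              show ?thesis using j by (simp add: ind if_distrib[of "\<lambda>x. _ * x"] cong: if_cong)
            next
              case False
              then show ?thesis by simp
            qed
          qed
          also have "\<dots> = (\<Sum>i<n. (1 - nexp (of_nat (m' i))) * emeasure \<nu> (A i))"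
          proof (subst nn_integral_sum)
            have "A i \<in> sets \<nu>" if "i \<in> ?I" for i using that Am \<nu> by auto
            then show "i \<in> ?I \<Longrightarrow> (\<lambda>x. (1 - nexp (of_nat (m' i))) * indicator (A i) x) \<in> borel_measurable \<nu>" for i
              by simp
            show "(\<Sum>i<n. \<integral>\<^sup>+x. (1 - nexp (of_nat (m' i))) * indicator (A i) x \<partial>\<nu>) = (\<Sum>i<n. (1 - nexp (of_nat (m' i))) * emeasure \<nu> (A i))"
              using Am \<nu> by (intro sum.cong refl nn_integral_cmult_indicator) auto
          qed
          also have "nexp (\<Sum>i<n. (1 - nexp (of_nat (m' i))) * emeasure \<nu> (A i)) = (\<Prod>i<n. \<integral>\<^sup>+N. nexp (of_nat (m' i) * emeasure N (A i)) \<partial>P)"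
            unfolding nexp_sum by (intro prod.cong refl lapA[symmetric]) auto
          also have "\<dots> = (\<Prod>i<n. \<integral>\<^sup>+x. nexp (of_nat (m' i) * x) \<partial>distr P borel (\<lambda>N. emeasure N (A i)))"
            by (intro prod.cong refl) (subst nn_integral_distr, auto)
          also have "\<dots> = (\<integral>\<^sup>+x. (\<Prod>i<n. nexp (of_nat (m' i) * x i)) \<partial>PiM ?I ?D)"
          proof -
            \<comment> \<open>\<open>product_sigma_finite\<close> speaks of every natural index, so
              a point mass fills in beyond \<open>n\<close>.\<close>
            define D' where "D' = (\<lambda>i. if i < n then ?D i else return borel 0)"
            have "sigma_finite_measure (D' i)" for i
            proof (cases "i < n")
              case True
              then show ?thesis
                using NA[of i] by (simp add: D'_def prob_space_distr prob_space_imp_sigma_finite)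
            next
              case False
              then show ?thesis by (simp add: D'_def prob_space_return prob_space_imp_sigma_finite)
            qed
            then interpret product_sigma_finite D' by (rule product_sigma_finite.intro)
            have "PiM ?I ?D = PiM ?I D'" by (intro PiM_cong) (auto simp: D'_def)
            then show ?thesis
              using product_nn_integral_prod[of ?I "\<lambda>i x. nexp (of_nat (m' i) * x)"]
              by (simp add: D'_def cong: prod.cong_simp)
          qed
          also have "\<dots> = (\<integral>\<^sup>+x. nexp (\<Sum>i<n. of_nat (m' i) * x i) \<partial>PiM ?I ?D)"
            by (simp add: nexp_sum)
          finally show "(\<integral>\<^sup>+x. nexp (\<Sum>i\<in>J. of_nat (m i) * x i) \<partial>distr P ?B ?X) = (\<integral>\<^sup>+x. nexp (\<Sum>i\<in>J. of_nat (m i) * x i) \<partial>PiM ?I ?D)"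
            unfolding m' .
        qed (use sD B in auto)
        then show "emeasure (distr P ?B ?X) (Pi\<^sub>E ?I B) = emeasure (PiM ?I ?D) (Pi\<^sub>E ?I B)"
          unfolding eq using sets_eq_imp_space_eq[OF sD] by simp
      next
        show "range (\<lambda>_::nat. Pi\<^sub>E ?I (\<lambda>_. UNIV :: ennreal set)) \<subseteq> prod_algebra ?I (\<lambda>_. borel)"
          by (auto intro!: prod_algebraI_finite)
        show "emeasure (distr P ?B ?X) (Pi\<^sub>E ?I (\<lambda>_. UNIV)) \<noteq> \<infinity>" for i :: nat
          using finite_measure.emeasure_finite[OF prob_space.finite_measure[OF prob_space_distr[OF X]]] by auto
      qed (use sD in \<open>auto simp: space_PiM\<close>)
      then show ?thesis
        using False NA by (subst indep_vars_iff_distr_eq_PiM') (simp_all add: lessThan_empty_iff)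
    qed
  qed
qed

section \<open>Completely random measures\<close>

lemma ennreal_tendsto_cmult_right:
  "(c::ennreal) < \<top> \<Longrightarrow> (f \<longlongrightarrow> x) F \<Longrightarrow> ((\<lambda>x. f x * c) \<longlongrightarrow> x * c) F"
  unfolding mult.commute[of _ c] by (rule ennreal_tendsto_cmult)

text \<open>Replaces the uncountable family of bounded sets by countably many balls, so that bounded
  finiteness can be handled measurably and almost surely.\<close>

lemma boundedly_finite_iff_ball:
  "boundedly_finite M \<longleftrightarrow> sets M = sets borel \<and> (\<forall>k::nat. emeasure M (ball a (real k)) < \<infinity>)"
proof
  assume M: "sets M = sets borel \<and> (\<forall>k::nat. emeasure M (ball a (real k)) < \<infinity>)"
  show "boundedly_finite M"
    unfolding boundedly_finite_def
  proof (intro conjI ballI impI)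
    fix B :: "'a set" assume B: "B \<in> sets borel" "bounded B"
    obtain r where r: "B \<subseteq> ball a r" using B(2) bounded_subset_ballD by blast
    obtain k :: nat where "r \<le> real k" using real_arch_simple by blast
    then have "B \<subseteq> ball a (real k)" using r by (meson subset_ball subset_trans)
    then have "emeasure M B \<le> emeasure M (ball a (real k))"
      using M by (intro emeasure_mono) auto
    then show "emeasure M B < \<infinity>" using M le_less_trans by blast
  qed (use M in simp)
qed (auto simp: boundedly_finite_def)

lemma UN_ball_nat: "(\<Union>k::nat. ball a (real k)) = UNIV"
  by (auto simp: dist_commute) (meson reals_Archimedean2)

lemma incseq_ball_nat: "incseq (\<lambda>k::nat. ball a (real k))"
  by (auto simp: incseq_def)

lemma boundedly_finite_null_measure: "boundedly_finite (null_measure borel)"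
  by (simp add: boundedly_finite_def)

text \<open>\<open>mixed_measure\<close> before the replacement by the null measure, so that its
  integrals are plain integrals against \<open>N\<close>.\<close>

definition premixed_measure :: "('s \<Rightarrow> real) \<Rightarrow> ('s::metric_space \<times> 'y::metric_space) measure \<Rightarrow> 'y measure" where
  "premixed_measure h N = distr (density N (\<lambda>(s, y). ennreal (h s))) borel snd"

lemma mixed_measure_eq:
  "mixed_measure h N = (if boundedly_finite (premixed_measure h N) then premixed_measure h N else null_measure borel)"
  by (simp add: mixed_measure_def premixed_measure_def Let_def)

lemma boundedly_finite_mixed_measure: "boundedly_finite (mixed_measure h N)"
  by (simp add: mixed_measure_eq boundedly_finite_null_measure)

context
  fixes h :: "'s::polish_space \<Rightarrow> real"
  assumes h [measurable]: "h \<in> borel_measurable borel"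
begin

lemma sets_premixed_measure [simp]: "sets (premixed_measure h N) = sets borel"
  by (simp add: premixed_measure_def)

lemma nn_integral_premixed_measure:
  fixes N :: "('s \<times> 'y::polish_space) measure"
  assumes N: "sets N = sets borel" and g[measurable]: "g \<in> borel_measurable borel"
  shows "integral\<^sup>N (premixed_measure h N) g = (\<integral>\<^sup>+x. ennreal (h (fst x)) * g (snd x) \<partial>N)"
proof -
  have [measurable_cong]: "sets N = sets (borel \<Otimes>\<^sub>M borel)" unfolding borel_prod by (rule N)
  show ?thesis
    unfolding premixed_measure_def
    by (subst nn_integral_distr) (auto simp: nn_integral_density case_prod_unfold)
qed

lemma measurable_mixed_measure [measurable]:
  "mixed_measure h \<in> measurable borel_measures (boundedly_finite_measures :: 'y::polish_space measure measure)"
proof (rule measurable_measures_algebra)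
  fix A :: "'y set" assume A[measurable]: "A \<in> sets borel"
  obtain a :: 'y where True by simp
  have bp: "borel_measurable (borel :: ('s \<times> 'y) measure) = (borel_measurable (borel \<Otimes>\<^sub>M borel) :: ('s \<times> 'y \<Rightarrow> ennreal) set)"
    by (simp add: borel_prod)
  let ?B = "borel_measures :: ('s \<times> 'y) measure measure"
  have pre: "(\<lambda>N. emeasure (premixed_measure h N) B) \<in> borel_measurable ?B" if [measurable]: "B \<in> sets borel" for B :: "'y set"
  proof -
    have g: "(\<lambda>x. ennreal (h (fst x)) * indicator B (snd x)) \<in> borel_measurable (borel :: ('s \<times> 'y) measure)"
      unfolding bp by measurable
    have "(\<lambda>N. \<integral>\<^sup>+x. ennreal (h (fst x)) * indicator B (snd x) \<partial>N) \<in> borel_measurable ?B"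
      by (rule measurable_nn_integral_measures_algebra[OF _ g]) auto
    moreover have "emeasure (premixed_measure h N) B = (\<integral>\<^sup>+x. ennreal (h (fst x)) * indicator B (snd x) \<partial>N)"
      if "N \<in> space ?B" for N :: "('s \<times> 'y) measure"
      using nn_integral_premixed_measure[of N "indicator B"] that by simp
    ultimately show ?thesis by (subst measurable_cong) (assumption, simp)
  qed
  note [measurable] = pre
  \<comment> \<open>Tested on countably many balls, the case distinction in
    \<open>mixed_measure\<close> becomes measurable.\<close>
  have "(\<lambda>N. if \<forall>k::nat. emeasure (premixed_measure h N) (ball a (real k)) < \<infinity>
      then emeasure (premixed_measure h N) A else 0) \<in> borel_measurable ?B"
    by measurable
  moreover have "emeasure (mixed_measure h N) A = (if \<forall>k::nat. emeasure (premixed_measure h N) (ball a (real k)) < \<infinity>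
      then emeasure (premixed_measure h N) A else 0)" for N :: "('s \<times> 'y) measure"
    by (simp add: mixed_measure_eq boundedly_finite_iff_ball[of _ a])
  ultimately show "(\<lambda>N. emeasure (mixed_measure h N) A) \<in> borel_measurable ?B"
    by simp
qed (simp add: boundedly_finite_mixed_measure)

end

text \<open>Ties the Laplace exponent to the integrability condition on the kernel:
  \<open>1 - e^{-h}\<close> is dominated by \<open>min h 1\<close>.\<close>

lemma one_minus_nexp_le: "0 \<le> r \<Longrightarrow> 1 - nexp (ennreal r) \<le> ennreal (min r 1)"
proof -
  assume r: "0 \<le> r"
  have "1 + - r \<le> exp (- r)" by (rule exp_ge_add_one_self)
  then have "1 - exp (- r) \<le> min r 1" by auto
  with r show ?thesis
    by (simp add: nexp_ennreal ennreal_minus flip: ennreal_1)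
qed

lemma sigma_finite_cover_nat:
  assumes "sigma_finite_measure M"
  obtains E :: "nat \<Rightarrow> 'a set" where "range E \<subseteq> sets M" "incseq E" "(\<Union>k. E k) = space M" "\<And>k. emeasure M (E k) < \<infinity>"
proof -
  interpret sigma_finite_measure M by fact
  obtain E where "range E \<subseteq> sets M" "(\<Union>k. E k) = space M" "\<And>k. emeasure M (E k) \<noteq> \<infinity>" "incseq E"
    using sigma_finite_incseq by metis
  then show ?thesis using that[of E] by (auto simp: less_top)
qed

text \<open>Only an almost everywhere defined version of the kernel is required to be measurable: this
  property passes to exponentially tilted kernels.\<close>

locale crm_base =
  fixes \<eta> :: "'y::polish_space measure" and \<rho> :: "'y \<Rightarrow> 's::polish_space measure" and h :: "'s \<Rightarrow> real"
  assumes sets_eta [measurable_cong]: "sets \<eta> = sets borel"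
    and sigma_finite_eta: "sigma_finite_measure \<eta>"
    and h_measurable [measurable]: "h \<in> borel_measurable borel"
    and h_pos: "\<And>s. 0 < h s"
    and sets_rho: "\<And>y. sets (\<rho> y) = sets borel"
    and version: "\<exists>\<rho>'. (\<forall>y. sets (\<rho>' y) = sets borel \<and> (\<integral>\<^sup>+s. ennreal (min (h s) 1) \<partial>\<rho>' y) < \<infinity>) \<and>
      (\<forall>A\<in>sets borel. (\<lambda>y. emeasure (\<rho>' y) A) \<in> borel_measurable borel) \<and> (AE y in \<eta>. \<rho> y = \<rho>' y)"
    and levy: "\<And>B. B \<in> sets borel \<Longrightarrow> bounded B \<Longrightarrow>
      (\<integral>\<^sup>+y\<in>B. (\<integral>\<^sup>+s. ennreal (min (h s) 1) \<partial>\<rho> y) \<partial>\<eta>) < \<infinity>"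
begin

definition rho_version :: "'y \<Rightarrow> 's measure" where
  "rho_version = (SOME \<rho>'. (\<forall>y. sets (\<rho>' y) = sets borel \<and> (\<integral>\<^sup>+s. ennreal (min (h s) 1) \<partial>\<rho>' y) < \<infinity>) \<and>
      (\<forall>A\<in>sets borel. (\<lambda>y. emeasure (\<rho>' y) A) \<in> borel_measurable borel) \<and> (AE y in \<eta>. \<rho> y = \<rho>' y))"

lemma sets_rho_version: "sets (rho_version y) = sets borel"
  and rho_version_finite: "(\<integral>\<^sup>+s. ennreal (min (h s) 1) \<partial>rho_version y) < \<infinity>"
  and rho_version_measurable: "A \<in> sets borel \<Longrightarrow> (\<lambda>y. emeasure (rho_version y) A) \<in> borel_measurable borel"
  and rho_version_AE: "AE y in \<eta>. \<rho> y = rho_version y"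
  using someI_ex[OF version, folded rho_version_def] by blast+

text \<open>On \<open>cover k\<close> the function \<open>min h 1\<close> is at least
  \<open>1 / (k + 1)\<close>, so its integral bounds the mass: one exhaustion that works for all
  \<open>y\<close>.\<close>

definition cover :: "nat \<Rightarrow> 's set" where
  "cover k = {s. 1 / real (Suc k) \<le> h s}"

lemma cover_sets [measurable]: "cover k \<in> sets borel"
  unfolding cover_def by measurable

lemma incseq_cover: "incseq cover"
proof (rule incseq_SucI, unfold cover_def, safe)
  fix k s assume "1 / real (Suc k) \<le> h s"
  moreover have "1 / real (Suc (Suc k)) \<le> 1 / real (Suc k)" by (simp add: field_simps)
  ultimately show "1 / real (Suc (Suc k)) \<le> h s" by simp
qed

lemma UN_cover: "(\<Union>k. cover k) = UNIV"
proof -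
  have "\<exists>k. s \<in> cover k" for s
    using nat_approx_posE[OF h_pos[of s]] unfolding cover_def by (metis mem_Collect_eq less_imp_le)
  then show ?thesis by auto
qed

lemma emeasure_cover_finite:
  assumes [measurable_cong]: "sets M = sets borel" and fin: "(\<integral>\<^sup>+s. ennreal (min (h s) 1) \<partial>M) < \<infinity>"
  shows "emeasure M (cover k) < \<infinity>"
proof -
  let ?c = "1 / real (Suc k)"
  have "ennreal ?c * emeasure M (cover k) = (\<integral>\<^sup>+s. ennreal ?c * indicator (cover k) s \<partial>M)"
    by (simp add: nn_integral_cmult_indicator)
  also have "\<dots> \<le> (\<integral>\<^sup>+s. ennreal (min (h s) 1) \<partial>M)"
    by (intro nn_integral_mono) (auto simp: cover_def indicator_def intro!: ennreal_leI)
  also note fin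
  finally show ?thesis
    by (auto simp: ennreal_mult_less_top less_top[symmetric] ennreal_eq_0_iff not_le split: if_splits)
qed

lemma measurable_nn_integral_rho_version:
  assumes "f \<in> borel_measurable (borel \<Otimes>\<^sub>M borel)"
  shows "(\<lambda>y. \<integral>\<^sup>+s. f (y, s) \<partial>rho_version y) \<in> borel_measurable borel"
  using assms rho_version_measurable sets_rho_version incseq_cover UN_cover emeasure_cover_finite[OF sets_rho_version rho_version_finite]
  by (intro measurable_nn_integral_kernel[where D = cover and R = borel]) auto

lemma sets_intensity [simp]: "sets (intensity \<rho> \<eta>) = sets borel"
  by (simp add: intensity_def)

text \<open>The iterated integral is justified for \<open>rho_version\<close>, which is measurable
  everywhere; the exchange with \<open>\<rho>\<close> happens on a null set of the outer
  integral.\<close>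

lemma nn_integral_intensity:
  assumes g[measurable]: "g \<in> borel_measurable (borel :: ('s \<times> 'y) measure)"
  shows "integral\<^sup>N (intensity \<rho> \<eta>) g = (\<integral>\<^sup>+y. \<integral>\<^sup>+s. g (s, y) \<partial>\<rho> y \<partial>\<eta>)"
proof -
  have gm: "(\<lambda>x. g (prod.swap x)) \<in> borel_measurable (borel \<Otimes>\<^sub>M borel)"
    using measurable_compose[OF measurable_pair_swap', of g borel borel borel] g
    by (simp add: borel_prod case_prod_unfold prod.swap_def)
  have [measurable]: "prod.swap \<in> measurable (kernel_prod \<eta> borel \<rho>) (borel :: ('s \<times> 'y) measure)"
    unfolding borel_prod[symmetric] prod.swap_def by measurable
  have "integral\<^sup>N (intensity \<rho> \<eta>) g = (\<integral>\<^sup>+x. g (prod.swap x) \<partial>kernel_prod \<eta> borel \<rho>)"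
    unfolding intensity_def by (rule nn_integral_distr) simp_all
  also have "kernel_prod \<eta> borel \<rho> = kernel_prod \<eta> borel rho_version"
    by (rule kernel_prod_cong_AE[OF rho_version_AE])
  also have "(\<integral>\<^sup>+x. g (prod.swap x) \<partial>kernel_prod \<eta> borel rho_version) = (\<integral>\<^sup>+y. \<integral>\<^sup>+s. g (prod.swap (y, s)) \<partial>rho_version y \<partial>\<eta>)"
    using measurable_nn_integral_rho_version gm
    by (intro nn_integral_kernel_prod) (auto simp: sets_rho_version cong: measurable_cong_sets)
  also have "\<dots> = (\<integral>\<^sup>+y. \<integral>\<^sup>+s. g (s, y) \<partial>\<rho> y \<partial>\<eta>)"
    using rho_version_AE by (intro nn_integral_cong_AE) auto
  finally show ?thesis .
qed

end

locale crm = crm_base \<eta> \<rho> h + poisson_rm \<Omega> N "intensity \<rho> \<eta>"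
  for \<eta> :: "'y::polish_space measure" and \<rho> :: "'y \<Rightarrow> 's::polish_space measure" and h :: "'s \<Rightarrow> real"
    and \<Omega> :: "'w measure" and N :: "'w \<Rightarrow> ('s \<times> 'y) measure"
begin

text \<open>Gives content to the description \<open>prm_law\<close>: existence comes from the law of
  \<open>N\<close>, whose Laplace functional identifies it as Poisson, and uniqueness from the same
  functional.\<close>

lemma prm_law_eq: "prm_law \<rho> \<eta> = distr \<Omega> borel_measures N"
proof -
  let ?P = "distr \<Omega> borel_measures N"
  have P: "prob_space ?P" by (rule prob_space_distr) simp
  have "poisson_random_measure ?P (\<lambda>N. N) (intensity \<rho> \<eta>)"
  proof (rule poisson_random_measureI_laplace[OF P])
    fix g :: "'s \<times> 'y \<Rightarrow> ennreal" assume g: "g \<in> borel_measurable borel"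
    have [measurable]: "(\<lambda>M. integral\<^sup>N M g) \<in> borel_measurable borel_measures"
      by (rule measurable_nn_integral_measures_algebra) (use g in auto)
    show "(\<integral>\<^sup>+N. nexp (integral\<^sup>N N g) \<partial>?P) = nexp (\<integral>\<^sup>+x. 1 - nexp (g x) \<partial>intensity \<rho> \<eta>)"
      by (subst nn_integral_distr) (auto intro!: laplace g)
  qed simp_all
  then show ?thesis
    unfolding prm_law_def by (intro the_equality conjI poisson_random_measure_unique[of _ "intensity \<rho> \<eta>"]) auto
qed

lemma measurable_mixed_N [measurable]: "(\<lambda>\<omega>. mixed_measure h (N \<omega>)) \<in> measurable \<Omega> boundedly_finite_measures"
  using measurable_compose[OF measurable_N measurable_mixed_measure[OF h_measurable]] .

lemma crm_law_eq: "crm_law h \<rho> \<eta> = distr \<Omega> boundedly_finite_measures (\<lambda>\<omega>. mixed_measure h (N \<omega>))"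
  unfolding crm_law_def prm_law_eq
  by (subst distr_distr) (auto simp: comp_def measurable_mixed_measure)

abbreviation "C \<equiv> crm_law h \<rho> \<eta>"

lemma sets_C [simp, measurable_cong]: "sets C = sets boundedly_finite_measures"
  by (simp add: crm_law_def)

lemma space_C [simp]: "space C = Collect boundedly_finite"
  by (simp add: crm_law_def)

lemma prob_space_C: "prob_space C"
  unfolding crm_law_eq by (rule prob_space_distr) simp

lemma measurable_hN [measurable]:
  assumes [measurable]: "g \<in> borel_measurable borel"
  shows "(\<lambda>x. ennreal (h (fst x)) * g (snd x)) \<in> borel_measurable (borel :: ('s \<times> 'y) measure)"
  unfolding borel_prod[symmetric] by measurable

lemma nn_integral_min_h_finite:
  assumes B[measurable]: "B \<in> sets borel" and "bounded B"
  shows "(\<integral>\<^sup>+x. ennreal (min (h (fst x)) 1) * indicator B (snd x) \<partial>intensity \<rho> \<eta>) < \<infinity>"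
proof -
  have [measurable]: "(\<lambda>x. ennreal (min (h (fst x)) 1) * indicator B (snd x)) \<in> borel_measurable (borel :: ('s \<times> 'y) measure)"
    unfolding borel_prod[symmetric] by measurable
  have "(\<integral>\<^sup>+x. ennreal (min (h (fst x)) 1) * indicator B (snd x) \<partial>intensity \<rho> \<eta>) =
     (\<integral>\<^sup>+y. \<integral>\<^sup>+s. ennreal (min (h s) 1) * indicator B y \<partial>\<rho> y \<partial>\<eta>)"
    by (subst nn_integral_intensity) auto
  also have "\<dots> = (\<integral>\<^sup>+y\<in>B. (\<integral>\<^sup>+s. ennreal (min (h s) 1) \<partial>\<rho> y) \<partial>\<eta>)"
    by (intro nn_integral_cong nn_integral_multc) (simp cong: measurable_cong_sets add: sets_rho)
  also have "\<dots> < \<infinity>" using levy assms by simp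
  finally show ?thesis .
qed

text \<open>As \<open>t \<rightarrow> 0\<close>, \<open>E e^{-tX}\<close> tends to
  \<open>P(X < \<infinity>)\<close>, since \<open>e^{-tX}\<close> stays \<open>0\<close> where
  \<open>X = \<infinity>\<close>. By the Laplace formula it also tends to \<open>1\<close>: the
  exponents go to \<open>0\<close> under the integrable majorant \<open>min h 1\<close> on
  \<open>B\<close>.\<close>

lemma AE_premixed_finite:
  assumes B[measurable]: "B \<in> sets borel" and bd: "bounded B"
  shows "AE \<omega> in \<Omega>. (\<integral>\<^sup>+x. ennreal (h (fst x)) * indicator B (snd x) \<partial>N \<omega>) < \<infinity>"
proof -
  define X where "X = (\<lambda>\<omega>. \<integral>\<^sup>+x. ennreal (h (fst x)) * indicator B (snd x) \<partial>N \<omega>)"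
  have X[measurable]: "X \<in> borel_measurable \<Omega>"
    unfolding X_def by (intro measurable_integral_N measurable_hN) simp
  \<comment> \<open>A null sequence in \<open>(0, 1]\<close>; the bound \<open>t n \<le> 1\<close>
    provides the majorant, and \<open>t n > 0\<close> keeps
    \<open>t n * \<infinity> = \<infinity>\<close>.\<close>
  define t where "t = (\<lambda>n. 1 / real (Suc n))"
  have t: "0 < t n" "t n \<le> 1" for n by (auto simp: t_def)
  have t0: "(\<lambda>n. ennreal (t n)) \<longlonglongrightarrow> 0"
    using tendsto_ennrealI[OF LIMSEQ_Suc[OF lim_1_over_n]] by (simp add: t_def)
  have lapX: "(\<integral>\<^sup>+\<omega>. nexp (ennreal (t n) * X \<omega>) \<partial>\<Omega>) =
     nexp (\<integral>\<^sup>+x. 1 - nexp (ennreal (t n * h (fst x)) * indicator B (snd x)) \<partial>intensity \<rho> \<eta>)" for n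
  proof -
    have m: "(\<lambda>x. ennreal (t n * h (fst x)) * indicator B (snd x)) \<in> borel_measurable (borel :: ('s \<times> 'y) measure)"
      unfolding borel_prod[symmetric] by measurable
    have "ennreal (t n) * X \<omega> = (\<integral>\<^sup>+x. ennreal (t n * h (fst x)) * indicator B (snd x) \<partial>N \<omega>)" if "\<omega> \<in> space \<Omega>" for \<omega>
      unfolding X_def using sets_N[OF that] t(1)[of n] measurable_hN[of "indicator B"] h_pos
      by (subst nn_integral_cmult[symmetric])
        (auto simp: ennreal_mult mult.assoc less_imp_le cong: measurable_cong_sets)
    then show ?thesis using laplace[OF m] by (simp cong: nn_integral_cong)
  qed
  have "(\<lambda>n. \<integral>\<^sup>+x. 1 - nexp (ennreal (t n * h (fst x)) * indicator B (snd x)) \<partial>intensity \<rho> \<eta>)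
     \<longlonglongrightarrow> (\<integral>\<^sup>+x. 0 \<partial>intensity \<rho> \<eta>)"
  proof (rule nn_integral_dominated_convergence[where w = "\<lambda>x. ennreal (min (h (fst x)) 1) * indicator B (snd x)"])
    have "(\<lambda>x. 1 - nexp (ennreal (t n * h (fst x)) * indicator B (snd x))) \<in> borel_measurable (borel :: ('s \<times> 'y) measure)" for n
      unfolding borel_prod[symmetric] by measurable
    then show "(\<lambda>x. 1 - nexp (ennreal (t n * h (fst x)) * indicator B (snd x))) \<in> borel_measurable (intensity \<rho> \<eta>)" for n
      by (simp cong: measurable_cong_sets)
    have "(\<lambda>x. ennreal (min (h (fst x)) 1) * indicator B (snd x)) \<in> borel_measurable (borel :: ('s \<times> 'y) measure)"
      unfolding borel_prod[symmetric] by measurable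
    then show "(\<lambda>x. ennreal (min (h (fst x)) 1) * indicator B (snd x)) \<in> borel_measurable (intensity \<rho> \<eta>)"
      by (simp cong: measurable_cong_sets)
    have "1 - nexp (ennreal (t n * h s)) \<le> ennreal (min (h s) 1)" for n s
    proof -
      have "1 - nexp (ennreal (t n * h s)) \<le> ennreal (min (t n * h s) 1)"
        using t(1)[of n] h_pos[of s] by (intro one_minus_nexp_le) simp
      also have "\<dots> \<le> ennreal (min (h s) 1)"
        using t[of n] h_pos[of s] mult_right_mono[of "t n" 1 "h s"]
        by (intro ennreal_leI min.mono) auto
      finally show ?thesis .
    qed
    then show "AE x in intensity \<rho> \<eta>. 1 - nexp (ennreal (t n * h (fst x)) * indicator B (snd x)) \<le> ennreal (min (h (fst x)) 1) * indicator B (snd x)" for n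
      by (intro AE_I2) (auto simp: indicator_def)
    show "(\<integral>\<^sup>+x. ennreal (min (h (fst x)) 1) * indicator B (snd x) \<partial>intensity \<rho> \<eta>) < \<infinity>"
      by (rule nn_integral_min_h_finite[OF B bd])
    show "AE x in intensity \<rho> \<eta>. (\<lambda>n. 1 - nexp (ennreal (t n * h (fst x)) * indicator B (snd x))) \<longlonglongrightarrow> 0"
    proof (intro AE_I2)
      fix x :: "'s \<times> 'y"
      have "(\<lambda>n. ennreal (t n) * (ennreal (h (fst x)) * indicator B (snd x))) \<longlonglongrightarrow> 0 * (ennreal (h (fst x)) * indicator B (snd x))"
        by (intro ennreal_tendsto_cmult_right t0) (auto simp: indicator_def ennreal_mult_less_top)
      then have "(\<lambda>n. 1 - nexp (ennreal (t n) * (ennreal (h (fst x)) * indicator B (snd x)))) \<longlonglongrightarrow> 1 - nexp 0"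
        by (intro tendsto_diff_ennreal tendsto_const tendsto_nexp) auto
      then show "(\<lambda>n. 1 - nexp (ennreal (t n * h (fst x)) * indicator B (snd x))) \<longlonglongrightarrow> 0"
        using t(1) h_pos by (simp add: ennreal_mult less_imp_le mult.assoc)
    qed
  qed simp
  then have "(\<lambda>n. \<integral>\<^sup>+\<omega>. nexp (ennreal (t n) * X \<omega>) \<partial>\<Omega>) \<longlonglongrightarrow> nexp 0"
    unfolding lapX by (intro tendsto_nexp) simp
  moreover have "(\<lambda>n. \<integral>\<^sup>+\<omega>. nexp (ennreal (t n) * X \<omega>) \<partial>\<Omega>) \<longlonglongrightarrow> (\<integral>\<^sup>+\<omega>. indicator {\<omega>\<in>space \<Omega>. X \<omega> < \<infinity>} \<omega> \<partial>\<Omega>)"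
  proof (rule nn_integral_dominated_convergence[where w = "\<lambda>_. 1"])
    show "AE \<omega> in \<Omega>. (\<lambda>n. nexp (ennreal (t n) * X \<omega>)) \<longlonglongrightarrow> indicator {\<omega>\<in>space \<Omega>. X \<omega> < \<infinity>} \<omega>"
    proof (intro AE_I2)
      fix \<omega> assume \<omega>: "\<omega> \<in> space \<Omega>"
      show "(\<lambda>n. nexp (ennreal (t n) * X \<omega>)) \<longlonglongrightarrow> indicator {\<omega>\<in>space \<Omega>. X \<omega> < \<infinity>} \<omega>"
      proof (cases "X \<omega> < \<infinity>")
        case True
        then have "(\<lambda>n. ennreal (t n) * X \<omega>) \<longlonglongrightarrow> 0 * X \<omega>"
          by (intro ennreal_tendsto_cmult_right t0) simp
        from tendsto_nexp[OF this] True \<omega> show ?thesis by simp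
      next
        case False
        then have "ennreal (t n) * X \<omega> = \<top>" for n
          using t(1)[of n] by (simp add: ennreal_mult_top less_top[symmetric] ennreal_eq_0_iff not_le)
        with False show ?thesis by simp
      qed
    qed
  qed (auto simp: emeasure_space_1)
  ultimately have "nexp 0 = (\<integral>\<^sup>+\<omega>. indicator {\<omega>\<in>space \<Omega>. X \<omega> < \<infinity>} \<omega> \<partial>\<Omega>)"
    by (rule LIMSEQ_unique)
  also have "\<dots> = emeasure \<Omega> {\<omega>\<in>space \<Omega>. X \<omega> < \<infinity>}"
    by (rule nn_integral_indicator) measurable
  finally have "AE \<omega> in \<Omega>. X \<omega> < \<infinity>" by (subst AE_iff_emeasure_eq_1) auto
  then show ?thesis by (simp add: X_def)
qed

lemma AE_mixed_eq_premixed: "AE \<omega> in \<Omega>. mixed_measure h (N \<omega>) = premixed_measure h (N \<omega>)"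
proof -
  obtain a :: 'y where True by simp
  have "AE \<omega> in \<Omega>. \<forall>k::nat. (\<integral>\<^sup>+x. ennreal (h (fst x)) * indicator (ball a (real k)) (snd x) \<partial>N \<omega>) < \<infinity>"
    unfolding AE_all_countable by (intro allI AE_premixed_finite) auto
  moreover have "AE \<omega> in \<Omega>. \<omega> \<in> space \<Omega>" by simp
  ultimately show ?thesis
  proof eventually_elim
    case (elim \<omega>)
    have "emeasure (premixed_measure h (N \<omega>)) B = (\<integral>\<^sup>+x. ennreal (h (fst x)) * indicator B (snd x) \<partial>N \<omega>)" if "B \<in> sets borel" for B
      using nn_integral_premixed_measure[OF h_measurable sets_N[OF elim(2)], of "indicator B"] that by (simp add: sets_premixed_measure[OF h_measurable])
    with elim show ?case
      by (simp add: mixed_measure_eq boundedly_finite_iff_ball[of _ a] sets_premixed_measure[OF h_measurable])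
  qed
qed

lemma AE_nn_integral_mixed:
  assumes "g \<in> borel_measurable borel"
  shows "AE \<omega> in \<Omega>. integral\<^sup>N (mixed_measure h (N \<omega>)) g = (\<integral>\<^sup>+x. ennreal (h (fst x)) * g (snd x) \<partial>N \<omega>)"
  using AE_mixed_eq_premixed AE_space
proof eventually_elim
  case (elim \<omega>)
  then show ?case using nn_integral_premixed_measure[OF h_measurable sets_N assms] by simp
qed

lemma laplace_C:
  assumes g[measurable]: "g \<in> borel_measurable borel"
  shows "(\<integral>\<^sup>+\<mu>. nexp (integral\<^sup>N \<mu> g) \<partial>C) = nexp (\<integral>\<^sup>+x. 1 - nexp (ennreal (h (fst x)) * g (snd x)) \<partial>intensity \<rho> \<eta>)"
proof -
  have [measurable]: "(\<lambda>\<mu>. integral\<^sup>N \<mu> g) \<in> borel_measurable boundedly_finite_measures"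
    by (rule measurable_nn_integral_measures_algebra) (use g in \<open>auto simp: boundedly_finite_def\<close>)
  have "(\<integral>\<^sup>+\<mu>. nexp (integral\<^sup>N \<mu> g) \<partial>C) = (\<integral>\<^sup>+\<omega>. nexp (integral\<^sup>N (mixed_measure h (N \<omega>)) g) \<partial>\<Omega>)"
    unfolding crm_law_eq by (subst nn_integral_distr) auto
  also have "\<dots> = (\<integral>\<^sup>+\<omega>. nexp (\<integral>\<^sup>+x. ennreal (h (fst x)) * g (snd x) \<partial>N \<omega>) \<partial>\<Omega>)"
    using AE_nn_integral_mixed[OF g] by (intro nn_integral_cong_AE) auto
  also have "\<dots> = nexp (\<integral>\<^sup>+x. 1 - nexp (ennreal (h (fst x)) * g (snd x)) \<partial>intensity \<rho> \<eta>)"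
    by (rule laplace) (rule measurable_hN[OF g])
  finally show ?thesis .
qed

end

section \<open>Exponential tilting\<close>

lemma nn_integral_exp_tilt:
  fixes \<rho> :: "'y::polish_space \<Rightarrow> 's::polish_space measure"
  assumes f[measurable]: "f \<in> borel_measurable (borel :: ('s \<times> 'y) measure)"
    and \<rho>[measurable_cong]: "sets (\<rho> y) = sets borel" and [measurable]: "g \<in> borel_measurable borel"
  shows "integral\<^sup>N (exp_tilt f \<rho> y) g = (\<integral>\<^sup>+s. ennreal (exp (- f (s, y))) * g s \<partial>\<rho> y)"
proof -
  have "(\<lambda>s. (s, y)) \<in> measurable borel (borel :: ('s \<times> 'y) measure)"
    unfolding borel_prod[symmetric] by measurable
  from measurable_compose[OF this f] have [measurable]: "(\<lambda>s. f (s, y)) \<in> borel_measurable borel" .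
  show ?thesis unfolding exp_tilt_def by (subst nn_integral_density) auto
qed

lemma sets_exp_tilt: "sets (exp_tilt f \<rho> y) = sets (\<rho> y)"
  by (simp add: exp_tilt_def)

lemma nn_integral_exp_tilt_le:
  fixes \<rho> :: "'y::polish_space \<Rightarrow> 's::polish_space measure"
  assumes f: "f \<in> borel_measurable (borel :: ('s \<times> 'y) measure)" "\<And>x. 0 \<le> f x"
    and "sets (\<rho> y) = sets borel" "g \<in> borel_measurable borel"
  shows "integral\<^sup>N (exp_tilt f \<rho> y) g \<le> integral\<^sup>N (\<rho> y) g"
proof -
  have "ennreal (exp (- f (s, y))) * g s \<le> 1 * g s" for s
    using f(2) by (intro mult_right_mono) auto
  then show ?thesis using nn_integral_exp_tilt[where \<rho> = \<rho> and y = y, OF f(1) assms(3,4)] by (auto intro!: nn_integral_mono)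
qed

context crm_base
begin

text \<open>Tilting commutes with a change of \<open>\<rho>\<close> on a null set, so the tilted
  \<open>rho_version\<close> serves as version; integrals only decrease because
  \<open>f \<ge> 0\<close>.\<close>

lemma crm_base_exp_tilt:
  assumes f: "f \<in> borel_measurable borel" "\<And>x. 0 \<le> f x"
  shows "crm_base \<eta> (exp_tilt f \<rho>) h"
proof (rule crm_base.intro)
  have [measurable]: "(\<lambda>(y, s). ennreal (exp (- f (s, y)))) \<in> borel_measurable (borel \<Otimes>\<^sub>M borel)"
  proof -
    have [measurable]: "(\<lambda>(y, s). (s, y)) \<in> measurable (borel \<Otimes>\<^sub>M borel) (borel :: ('s \<times> 'y) measure)"
      unfolding borel_prod[symmetric] by measurable
    note [measurable] = f(1)
    show ?thesis by measurable
  qed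
  show "sets (exp_tilt f \<rho> y) = sets borel" for y by (simp add: sets_exp_tilt sets_rho)
  show "\<exists>\<rho>'. (\<forall>y. sets (\<rho>' y) = sets borel \<and> (\<integral>\<^sup>+s. ennreal (min (h s) 1) \<partial>\<rho>' y) < \<infinity>) \<and>
      (\<forall>A\<in>sets borel. (\<lambda>y. emeasure (\<rho>' y) A) \<in> borel_measurable borel) \<and> (AE y in \<eta>. exp_tilt f \<rho> y = \<rho>' y)"
  proof (intro exI[of _ "exp_tilt f rho_version"] conjI allI ballI)
    show "sets (exp_tilt f rho_version y) = sets borel" for y by (simp add: sets_exp_tilt sets_rho_version)
    show "(\<integral>\<^sup>+s. ennreal (min (h s) 1) \<partial>exp_tilt f rho_version y) < \<infinity>" for y
      using rho_version_finite[of y] by (intro le_less_trans[OF nn_integral_exp_tilt_le[OF f]]) (auto simp: sets_rho_version)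
    show "AE y in \<eta>. exp_tilt f \<rho> y = exp_tilt f rho_version y"
      using rho_version_AE by eventually_elim (simp add: exp_tilt_def)
    fix A :: "'s set" assume [measurable]: "A \<in> sets borel"
    have "(\<lambda>y. \<integral>\<^sup>+s. (\<lambda>(y, s). ennreal (exp (- f (s, y))) * indicator A s) (y, s) \<partial>rho_version y) \<in> borel_measurable borel"
      by (rule measurable_nn_integral_rho_version) measurable
    moreover have "emeasure (exp_tilt f rho_version y) A = (\<integral>\<^sup>+s. ennreal (exp (- f (s, y))) * indicator A s \<partial>rho_version y)" for y
      using nn_integral_exp_tilt[where \<rho> = rho_version and y = y, OF f(1) sets_rho_version, of "indicator A"] by (simp add: sets_exp_tilt sets_rho_version)
    ultimately show "(\<lambda>y. emeasure (exp_tilt f rho_version y) A) \<in> borel_measurable borel" by simp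
  qed
  fix B :: "'y set" assume B: "B \<in> sets borel" "bounded B"
  have "(\<integral>\<^sup>+y\<in>B. (\<integral>\<^sup>+s. ennreal (min (h s) 1) \<partial>exp_tilt f \<rho> y) \<partial>\<eta>) \<le> (\<integral>\<^sup>+y\<in>B. (\<integral>\<^sup>+s. ennreal (min (h s) 1) \<partial>\<rho> y) \<partial>\<eta>)"
    by (intro nn_integral_mono mult_right_mono nn_integral_exp_tilt_le f) (auto simp: sets_rho)
  also have "\<dots> < \<infinity>" using levy B by blast
  finally show "(\<integral>\<^sup>+y\<in>B. (\<integral>\<^sup>+s. ennreal (min (h s) 1) \<partial>exp_tilt f \<rho> y) \<partial>\<eta>) < \<infinity>" .
qed (use sigma_finite_eta h_pos in \<open>simp_all add: sets_eta h_measurable\<close>)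

lemma laplace_prm_eq:
  assumes f: "f \<in> borel_measurable borel" "\<And>x. 0 \<le> f x"
  shows "ennreal (laplace_prm f \<rho> \<eta>) = nexp (\<integral>\<^sup>+x. 1 - nexp (ennreal (f x)) \<partial>intensity \<rho> \<eta>)"
proof -
  have "1 - nexp (ennreal (f x)) = ennreal (1 - exp (- f x))" for x
    using f(2)[of x] by (simp add: nexp_ennreal ennreal_minus flip: ennreal_1)
  moreover have "(\<integral>\<^sup>+x. 1 - nexp (ennreal (f x)) \<partial>intensity \<rho> \<eta>) = (\<integral>\<^sup>+y. \<integral>\<^sup>+s. 1 - nexp (ennreal (f (s, y))) \<partial>\<rho> y \<partial>\<eta>)"
    using f(1) by (intro nn_integral_intensity) measurable
  ultimately show ?thesis by (simp add: laplace_prm_def nexp_def)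
qed

lemma nn_integral_intensity_exp_tilt:
  assumes f: "f \<in> borel_measurable borel" "\<And>x. 0 \<le> f x" and g[measurable]: "g \<in> borel_measurable borel"
  shows "integral\<^sup>N (intensity (exp_tilt f \<rho>) \<eta>) g = (\<integral>\<^sup>+x. nexp (ennreal (f x)) * g x \<partial>intensity \<rho> \<eta>)"
proof -
  interpret T: crm_base \<eta> "exp_tilt f \<rho>" h by (rule crm_base_exp_tilt[OF f])
  note [measurable] = f(1)
  have gs: "(\<lambda>s. g (s, y)) \<in> borel_measurable borel" for y
  proof -
    have "(\<lambda>s. (s, y)) \<in> measurable borel (borel :: ('s \<times> 'y) measure)"
      unfolding borel_prod[symmetric] by measurable
    from measurable_compose[OF this g] show ?thesis .
  qed
  show ?thesis
    by (simp add: T.nn_integral_intensity nn_integral_intensity nn_integral_exp_tilt[where \<rho> = \<rho>, OF f(1) sets_rho gs] nexp_ennreal f(2))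
qed

end

text \<open>Integrability over every ball forces \<open>min h 1\<close> to be
  \<open>\<rho> y\<close>-integrable for almost every \<open>y\<close>; at the exceptional points
  the version is the null measure.\<close>

lemma crm_base_sigma_finite_kernel:
  fixes \<eta> :: "'y::polish_space measure" and \<rho> :: "'y \<Rightarrow> 's::polish_space measure"
  assumes sets_eta: "sets \<eta> = sets borel"
    and sigma_finite_eta: "sigma_finite_measure \<eta>"
    and kernel_rho: "sigma_finite_kernel \<rho>"
    and h_measurable[measurable]: "h \<in> borel_measurable borel"
    and h_pos: "\<And>s. 0 < h s"
    and levy: "\<And>B. B \<in> sets borel \<Longrightarrow> bounded B \<Longrightarrow>
      (\<integral>\<^sup>+y\<in>B. (\<integral>\<^sup>+s. ennreal (min (h s) 1) \<partial>\<rho> y) \<partial>\<eta>) < \<infinity>"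
  shows "crm_base \<eta> \<rho> h"
proof (rule crm_base.intro)
  note [measurable_cong] = sets_eta
  show sets_rho: "sets (\<rho> y) = sets borel" for y using kernel_rho by (simp add: sigma_finite_kernel_def)
  have rho[measurable]: "\<rho> \<in> measurable borel borel_measures"
    using kernel_rho by (intro measurable_measures_algebra) (auto simp: sigma_finite_kernel_def)
  define \<Phi> where "\<Phi> = (\<lambda>y. \<integral>\<^sup>+s. ennreal (min (h s) 1) \<partial>\<rho> y)"
  have [measurable]: "\<Phi> \<in> borel_measurable borel"
    unfolding \<Phi>_def by (rule measurable_compose[OF rho measurable_nn_integral_measures_algebra]) auto
  obtain a :: 'y where True by simp
  have "AE y in \<eta>. \<forall>k::nat. \<Phi> y * indicator (ball a (real k)) y \<noteq> \<infinity>"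
    unfolding AE_all_countable
  proof
    fix k :: nat
    have [measurable]: "ball a (real k) \<in> sets borel" by (rule borel_open[OF open_ball])
    show "AE y in \<eta>. \<Phi> y * indicator (ball a (real k)) y \<noteq> \<infinity>"
    proof (rule nn_integral_PInf_AE)
      show "(\<integral>\<^sup>+y\<in>ball a (real k). \<Phi> y \<partial>\<eta>) \<noteq> \<infinity>"
        using levy[of "ball a (real k)"] by (auto simp: \<Phi>_def)
      show "(\<lambda>y. \<Phi> y * indicator (ball a (real k)) y) \<in> borel_measurable \<eta>" by measurable
    qed
  qed
  then have AE: "AE y in \<eta>. \<Phi> y < \<infinity>"
  proof eventually_elim
    case (elim y)
    obtain k :: nat where "y \<in> ball a (real k)" using UN_ball_nat[of a] by blast
    with elim[rule_format, of k] show ?case by (simp add: less_top)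
  qed
  define \<rho>' where "\<rho>' = (\<lambda>y. if \<Phi> y < \<infinity> then \<rho> y else null_measure borel)"
  show "\<exists>\<rho>'. (\<forall>y. sets (\<rho>' y) = sets borel \<and> (\<integral>\<^sup>+s. ennreal (min (h s) 1) \<partial>\<rho>' y) < \<infinity>) \<and>
      (\<forall>A\<in>sets borel. (\<lambda>y. emeasure (\<rho>' y) A) \<in> borel_measurable borel) \<and> (AE y in \<eta>. \<rho> y = \<rho>' y)"
  proof (intro exI[of _ \<rho>'] conjI allI ballI)
    show "sets (\<rho>' y) = sets borel" for y by (simp add: \<rho>'_def sets_rho)
    show "(\<integral>\<^sup>+s. ennreal (min (h s) 1) \<partial>\<rho>' y) < \<infinity>" for y
      by (auto simp: \<rho>'_def \<Phi>_def)
    show "AE y in \<eta>. \<rho> y = \<rho>' y" using AE by eventually_elim (simp add: \<rho>'_def)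
    fix A :: "'s set" assume [measurable]: "A \<in> sets borel"
    have [measurable]: "(\<lambda>y. emeasure (\<rho> y) A) \<in> borel_measurable borel"
      using kernel_rho by (simp add: sigma_finite_kernel_def)
    have "(\<lambda>y. if \<Phi> y < \<infinity> then emeasure (\<rho> y) A else 0) \<in> borel_measurable borel" by measurable
    also have "(\<lambda>y. if \<Phi> y < \<infinity> then emeasure (\<rho> y) A else 0) = (\<lambda>y. emeasure (\<rho>' y) A)"
      by (auto simp: \<rho>'_def)
    finally show "(\<lambda>y. emeasure (\<rho>' y) A) \<in> borel_measurable borel" .
  qed
qed (use assms in auto)

section \<open>The tilted process and the reweighted law\<close>

context crm
begin

text \<open>The tilted process is realised on the space of measures itself, as the identity map
  under the law of \<open>N\<close> with density \<open>e^{-N(f)} / L_N(f)\<close>. At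
  \<open>g = 0\<close> the identity \<open>key\<close> says that this law has mass
  \<open>1\<close>.\<close>

lemma crm_exp_tilt:
  assumes f: "f \<in> borel_measurable borel" "\<And>x. 0 \<le> f x"
    and L: "laplace_prm f \<rho> \<eta> \<noteq> 0"
  obtains P where "crm \<eta> (exp_tilt f \<rho>) h P (\<lambda>N. N)"
proof -
  interpret T: crm_base \<eta> "exp_tilt f \<rho>" h by (rule crm_base_exp_tilt[OF f])
  define l where "l = ennreal (laplace_prm f \<rho> \<eta>)"
  have l: "l = nexp (\<integral>\<^sup>+x. 1 - nexp (ennreal (f x)) \<partial>intensity \<rho> \<eta>)"
    unfolding l_def by (rule laplace_prm_eq[OF f])
  have "0 \<le> laplace_prm f \<rho> \<eta>" by (simp add: laplace_prm_def)
  with L have l0: "l \<noteq> 0" "l < \<top>" by (simp_all add: l_def ennreal_eq_0_iff)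
  then have ll: "inverse l * l = 1"
    using ennreal_divide_self[of l] by (simp add: divide_ennreal_def mult.commute)
  have [measurable]: "(\<lambda>x. ennreal (f x)) \<in> borel_measurable borel" using f(1) by measurable
  have mI[measurable]: "(\<lambda>M. integral\<^sup>N M g) \<in> borel_measurable borel_measures"
    if "g \<in> borel_measurable borel" for g :: "'s \<times> 'y \<Rightarrow> ennreal"
    by (rule measurable_nn_integral_measures_algebra) (use that in auto)
  define P where "P = density (distr \<Omega> borel_measures N) (\<lambda>M. inverse l * nexp (\<integral>\<^sup>+x. ennreal (f x) \<partial>M))"
  have key: "(\<integral>\<^sup>+M. nexp (integral\<^sup>N M g) \<partial>P) = nexp (\<integral>\<^sup>+x. 1 - nexp (g x) \<partial>intensity (exp_tilt f \<rho>) \<eta>)"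
    if g[measurable]: "g \<in> borel_measurable borel" for g
  proof -
    have "(\<integral>\<^sup>+M. nexp (integral\<^sup>N M g) \<partial>P) =
        (\<integral>\<^sup>+\<omega>. inverse l * (nexp (\<integral>\<^sup>+x. ennreal (f x) \<partial>N \<omega>) * nexp (integral\<^sup>N (N \<omega>) g)) \<partial>\<Omega>)"
      unfolding P_def by (subst nn_integral_density) (auto simp: nn_integral_distr mult.assoc)
    also have "\<dots> = inverse l * (\<integral>\<^sup>+\<omega>. nexp (\<integral>\<^sup>+x. ennreal (f x) \<partial>N \<omega>) * nexp (integral\<^sup>N (N \<omega>) g) \<partial>\<Omega>)"
      by (rule nn_integral_cmult) measurable
    also have "(\<integral>\<^sup>+\<omega>. nexp (\<integral>\<^sup>+x. ennreal (f x) \<partial>N \<omega>) * nexp (integral\<^sup>N (N \<omega>) g) \<partial>\<Omega>) = (\<integral>\<^sup>+\<omega>. nexp (\<integral>\<^sup>+x. ennreal (f x) + g x \<partial>N \<omega>) \<partial>\<Omega>)"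
    proof (intro nn_integral_cong)
      fix \<omega> assume "\<omega> \<in> space \<Omega>"
      note [measurable_cong] = sets_N[OF this]
      have "(\<integral>\<^sup>+x. ennreal (f x) + g x \<partial>N \<omega>) = (\<integral>\<^sup>+x. ennreal (f x) \<partial>N \<omega>) + integral\<^sup>N (N \<omega>) g"
        by (rule nn_integral_add) measurable
      then show "nexp (\<integral>\<^sup>+x. ennreal (f x) \<partial>N \<omega>) * nexp (integral\<^sup>N (N \<omega>) g) = nexp (\<integral>\<^sup>+x. ennreal (f x) + g x \<partial>N \<omega>)"
        by (simp add: nexp_add)
    qed
    also have "\<dots> = nexp (\<integral>\<^sup>+x. 1 - nexp (ennreal (f x) + g x) \<partial>intensity \<rho> \<eta>)"
      by (rule laplace) measurable
    also have "(\<integral>\<^sup>+x. 1 - nexp (ennreal (f x) + g x) \<partial>intensity \<rho> \<eta>) =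
        (\<integral>\<^sup>+x. 1 - nexp (ennreal (f x)) \<partial>intensity \<rho> \<eta>) + (\<integral>\<^sup>+x. nexp (ennreal (f x)) * (1 - nexp (g x)) \<partial>intensity \<rho> \<eta>)"
      unfolding one_minus_nexp_add by (rule nn_integral_add) (simp_all cong: measurable_cong_sets)
    also have "(\<integral>\<^sup>+x. nexp (ennreal (f x)) * (1 - nexp (g x)) \<partial>intensity \<rho> \<eta>) =
       (\<integral>\<^sup>+x. 1 - nexp (g x) \<partial>intensity (exp_tilt f \<rho>) \<eta>)"
      by (rule nn_integral_intensity_exp_tilt[OF f, symmetric]) measurable
    finally show ?thesis
      by (simp add: nexp_add l[symmetric] mult.assoc[symmetric] ll)
  qed
  have "prob_space P"
    using key[of "\<lambda>_. 0"] by (intro prob_spaceI) simp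
  then have "poisson_random_measure P (\<lambda>N. N) (intensity (exp_tilt f \<rho>) \<eta>)"
    by (intro poisson_random_measureI_laplace key) (auto simp: P_def)
  then have "crm \<eta> (exp_tilt f \<rho>) h P (\<lambda>N. N)"
    by unfold_locales auto
  then show ?thesis by (rule that)
qed

text \<open>\<open>w\<close> is known through its almost sure representation along \<open>N\<close>,
  so integrals over the law of \<open>\<mu>\<close> are pulled back to \<open>\<Omega>\<close>,
  where \<open>e^{-N(f)}\<close> and \<open>e^{-\<mu>(g)}\<close> merge into the Laplace functional
  of \<open>f + h g\<close>. The process on \<open>P\<close> supplies the functional of the tilted
  law; the total mass is the case \<open>g = 0\<close>.\<close>

lemma density_crm_law:
  assumes f: "f \<in> borel_measurable borel" "\<And>x. 0 \<le> f x"
    and w[measurable]: "w \<in> borel_measurable boundedly_finite_measures"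
    and w_repr: "AE \<omega> in \<Omega>. w (mixed_measure h (N \<omega>)) = nexp (\<integral>\<^sup>+x. ennreal (f x) \<partial>N \<omega>)"
    and T: "crm \<eta> (exp_tilt f \<rho>) h P (\<lambda>N. N)"
  shows "density C w = scale_measure (ennreal (laplace_prm f \<rho> \<eta>)) (crm_law h (exp_tilt f \<rho>) \<eta>)"
    and "integral\<^sup>N C w = ennreal (laplace_prm f \<rho> \<eta>)"
proof -
  interpret T: crm \<eta> "exp_tilt f \<rho>" h P "\<lambda>N. N" by (rule T)
  have [measurable]: "(\<lambda>x. ennreal (f x)) \<in> borel_measurable borel" using f(1) by measurable
  define l where "l = ennreal (laplace_prm f \<rho> \<eta>)"
  have l: "l = nexp (\<integral>\<^sup>+x. 1 - nexp (ennreal (f x)) \<partial>intensity \<rho> \<eta>)"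
    unfolding l_def by (rule laplace_prm_eq[OF f])
  have key: "(\<integral>\<^sup>+\<mu>. w \<mu> * nexp (integral\<^sup>N \<mu> g) \<partial>C) = l * (\<integral>\<^sup>+\<mu>. nexp (integral\<^sup>N \<mu> g) \<partial>T.C)"
    if g[measurable]: "g \<in> borel_measurable borel" for g
  proof -
    have [measurable]: "(\<lambda>\<mu>. integral\<^sup>N \<mu> g) \<in> borel_measurable boundedly_finite_measures"
      by (rule measurable_nn_integral_measures_algebra) (use g in \<open>auto simp: boundedly_finite_def\<close>)
    let ?hg = "\<lambda>x. ennreal (h (fst x)) * g (snd x)"
    have [measurable]: "?hg \<in> borel_measurable (borel :: ('s \<times> 'y) measure)" by (rule measurable_hN[OF g])
    have "(\<integral>\<^sup>+\<mu>. w \<mu> * nexp (integral\<^sup>N \<mu> g) \<partial>C) =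
       (\<integral>\<^sup>+\<omega>. w (mixed_measure h (N \<omega>)) * nexp (integral\<^sup>N (mixed_measure h (N \<omega>)) g) \<partial>\<Omega>)"
      unfolding crm_law_eq by (subst nn_integral_distr) auto
    also have "\<dots> = (\<integral>\<^sup>+\<omega>. nexp (\<integral>\<^sup>+x. ennreal (f x) + ?hg x \<partial>N \<omega>) \<partial>\<Omega>)"
    proof (intro nn_integral_cong_AE, use w_repr AE_nn_integral_mixed[OF g] AE_space in eventually_elim)
      fix \<omega> assume elim: "w (mixed_measure h (N \<omega>)) = nexp (\<integral>\<^sup>+x. ennreal (f x) \<partial>N \<omega>)"
        "integral\<^sup>N (mixed_measure h (N \<omega>)) g = (\<integral>\<^sup>+x. ?hg x \<partial>N \<omega>)" "\<omega> \<in> space \<Omega>"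
      note [measurable_cong] = sets_N[OF elim(3)]
      have "(\<integral>\<^sup>+x. ennreal (f x) + ?hg x \<partial>N \<omega>) = (\<integral>\<^sup>+x. ennreal (f x) \<partial>N \<omega>) + (\<integral>\<^sup>+x. ?hg x \<partial>N \<omega>)"
        by (rule nn_integral_add) measurable
      with elim show "w (mixed_measure h (N \<omega>)) * nexp (integral\<^sup>N (mixed_measure h (N \<omega>)) g) = nexp (\<integral>\<^sup>+x. ennreal (f x) + ?hg x \<partial>N \<omega>)" by (simp add: nexp_add)
    qed
    also have "\<dots> = nexp (\<integral>\<^sup>+x. 1 - nexp (ennreal (f x) + ?hg x) \<partial>intensity \<rho> \<eta>)"
      by (rule laplace) measurable
    also have "(\<integral>\<^sup>+x. 1 - nexp (ennreal (f x) + ?hg x) \<partial>intensity \<rho> \<eta>) =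
        (\<integral>\<^sup>+x. 1 - nexp (ennreal (f x)) \<partial>intensity \<rho> \<eta>) + (\<integral>\<^sup>+x. nexp (ennreal (f x)) * (1 - nexp (?hg x)) \<partial>intensity \<rho> \<eta>)"
      unfolding one_minus_nexp_add by (rule nn_integral_add) (simp_all cong: measurable_cong_sets)
    also have "(\<integral>\<^sup>+x. nexp (ennreal (f x)) * (1 - nexp (?hg x)) \<partial>intensity \<rho> \<eta>) =
       (\<integral>\<^sup>+x. 1 - nexp (?hg x) \<partial>intensity (exp_tilt f \<rho>) \<eta>)"
      by (rule nn_integral_intensity_exp_tilt[OF f, symmetric]) measurable
    also have "nexp ((\<integral>\<^sup>+x. 1 - nexp (ennreal (f x)) \<partial>intensity \<rho> \<eta>) + (\<integral>\<^sup>+x. 1 - nexp (?hg x) \<partial>intensity (exp_tilt f \<rho>) \<eta>)) =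
       l * (\<integral>\<^sup>+\<mu>. nexp (integral\<^sup>N \<mu> g) \<partial>T.C)"
      by (simp add: nexp_add l T.laplace_C[OF g])
    finally show ?thesis .
  qed
  interpret TC: prob_space T.C by (rule T.prob_space_C)
  have w1: "integral\<^sup>N C w = l" using key[of "\<lambda>_. 0"] TC.emeasure_space_1 by simp
  then show "integral\<^sup>N C w = ennreal (laplace_prm f \<rho> \<eta>)" by (simp add: l_def)
  have "density C w = scale_measure l T.C"
  proof (rule finite_measure_eqI_laplace_integral)
    show "finite_measure (density C w)"
    proof (rule finite_measureI)
      have "emeasure (density C w) (space (density C w)) = (\<integral>\<^sup>+\<mu>. 1 \<partial>density C w)"
        by simp
      also have "\<dots> = integral\<^sup>N C w" by (subst nn_integral_density) auto
      finally show "emeasure (density C w) (space (density C w)) \<noteq> \<infinity>" by (simp add: w1 l_def)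
    qed
    show "finite_measure (scale_measure l T.C)"
      by (rule finite_measureI) (simp add: space_scale_measure l_def ennreal_mult_eq_top_iff)
    fix g :: "'y \<Rightarrow> ennreal" assume g: "g \<in> borel_measurable borel"
    have [measurable]: "(\<lambda>\<mu>. integral\<^sup>N \<mu> g) \<in> borel_measurable boundedly_finite_measures"
      by (rule measurable_nn_integral_measures_algebra) (use g in \<open>auto simp: boundedly_finite_def\<close>)
    show "(\<integral>\<^sup>+\<mu>. nexp (integral\<^sup>N \<mu> g) \<partial>density C w) = (\<integral>\<^sup>+\<mu>. nexp (integral\<^sup>N \<mu> g) \<partial>scale_measure l T.C)"
      using key[OF g] by (simp add: nn_integral_density nn_integral_scale_measure)
  qed (auto simp: boundedly_finite_def)
  then show "density C w = scale_measure (ennreal (laplace_prm f \<rho> \<eta>)) (crm_law h (exp_tilt f \<rho>) \<eta>)"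
    by (simp add: l_def)
qed

end

section \<open>The Mecke formula\<close>

lemma sets_add_atoms [simp]: "sets (add_atoms h V \<mu> J) = sets (borel :: 'y::topological_space measure)"
  unfolding add_atoms_def by (simp add: sets.sigma_sets_eq[of borel, simplified])

lemma emeasure_add_atoms:
  fixes \<mu> :: "'y::topological_space measure"
  assumes \<mu>: "sets \<mu> = sets borel" and V: "finite V" and A: "A \<in> sets borel"
  shows "emeasure (add_atoms h V \<mu> J) A = emeasure \<mu> A + (\<Sum>v\<in>V. ennreal (h (J v)) * indicator A v)"
proof (rule emeasure_measure_of[OF add_atoms_def])
  show "sets borel \<subseteq> Pow (UNIV :: 'y set)" by simp
  show "A \<in> sets (add_atoms h V \<mu> J)" using A by simp
  show "positive (sets (add_atoms h V \<mu> J)) (\<lambda>A. emeasure \<mu> A + (\<Sum>v\<in>V. ennreal (h (J v)) * indicator A v))"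
    by (simp add: positive_def)
  show "countably_additive (sets (add_atoms h V \<mu> J)) (\<lambda>A. emeasure \<mu> A + (\<Sum>v\<in>V. ennreal (h (J v)) * indicator A v))"
  proof (rule countably_additiveI)
    fix F :: "nat \<Rightarrow> 'y set" assume F: "range F \<subseteq> sets (add_atoms h V \<mu> J)" "disjoint_family F"
    have "(\<Sum>i. \<Sum>v\<in>V. ennreal (h (J v)) * indicator (F i) v) = (\<Sum>v\<in>V. \<Sum>i. ennreal (h (J v)) * indicator (F i) v)"
      by (intro suminf_sum) simp
    also have "\<dots> = (\<Sum>v\<in>V. ennreal (h (J v)) * indicator (\<Union>i. F i) v)"
      by (simp add: suminf_indicator[OF F(2)])
    finally have 1: "(\<Sum>i. \<Sum>v\<in>V. ennreal (h (J v)) * indicator (F i) v) = (\<Sum>v\<in>V. ennreal (h (J v)) * indicator (\<Union>i. F i) v)" .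
    have 2: "(\<Sum>i. emeasure \<mu> (F i)) = emeasure \<mu> (\<Union>i. F i)"
      using F \<mu> by (intro suminf_emeasure) auto
    show "(\<Sum>i. emeasure \<mu> (F i) + (\<Sum>v\<in>V. ennreal (h (J v)) * indicator (F i) v)) =
        emeasure \<mu> (\<Union>i. F i) + (\<Sum>v\<in>V. ennreal (h (J v)) * indicator (\<Union>i. F i) v)"
      unfolding 1[symmetric] 2[symmetric] by (intro suminf_add[symmetric]) simp_all
  qed
qed

lemma nn_integral_add_atoms:
  fixes \<mu> :: "'y::topological_space measure"
  assumes \<mu>: "sets \<mu> = sets borel" and V: "finite V" and g: "g \<in> borel_measurable borel"
  shows "integral\<^sup>N (add_atoms h V \<mu> J) g = integral\<^sup>N \<mu> g + (\<Sum>v\<in>V. ennreal (h (J v)) * g v)"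
  using g
proof (induction rule: borel_measurable_induct)
  case (cong f g)
  then have "f = g" by auto
  with cong show ?case by simp
next
  case (set A)
  then show ?case by (simp add: emeasure_add_atoms[OF \<mu> V] \<mu>)
next
  case (mult u c)
  note [measurable] = mult(2)
  show ?case using mult \<mu>
    by (subst (1 2) nn_integral_cmult)
      (auto simp: distrib_left sum_distrib_left mult_ac cong: measurable_cong_sets)
next
  case (add u v)
  have [measurable]: "u \<in> borel_measurable borel" "v \<in> borel_measurable borel" using add by auto
  show ?case using add \<mu>
    by (subst (1 2) nn_integral_add)
      (auto simp: distrib_left sum.distrib ac_simps cong: measurable_cong_sets)
next
  case (seq U)
  have U: "U i \<in> borel_measurable L" if "sets L = sets borel" for L i
    using seq(1) that by (simp cong: measurable_cong_sets)
  have inc: "incseq (\<lambda>i. integral\<^sup>N \<mu> (U i))"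
    using seq(3) by (auto simp: incseq_def le_fun_def intro!: nn_integral_mono)
  have incs: "incseq (\<lambda>i. ennreal (h (J v)) * U i v)" for v
    using seq(3) by (auto simp: incseq_def le_fun_def intro!: mult_left_mono)
  have "integral\<^sup>N (add_atoms h V \<mu> J) (SUP i. U i) = (SUP i. integral\<^sup>N (add_atoms h V \<mu> J) (U i))"
    unfolding SUP_apply[abs_def] using seq(3) U by (intro nn_integral_monotone_convergence_SUP) auto
  also have "\<dots> = (SUP i. integral\<^sup>N \<mu> (U i) + (\<Sum>v\<in>V. ennreal (h (J v)) * U i v))"
    using seq by simp
  also have "\<dots> = (SUP i. integral\<^sup>N \<mu> (U i)) + (SUP i. \<Sum>v\<in>V. ennreal (h (J v)) * U i v)"
    using inc incs by (intro ennreal_SUP_add) (auto simp: incseq_def intro!: sum_mono)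
  also have "(SUP i. \<Sum>v\<in>V. ennreal (h (J v)) * U i v) = (\<Sum>v\<in>V. SUP i. ennreal (h (J v)) * U i v)"
    using incs by (intro ennreal_SUP_sum) auto
  also have "(\<Sum>v\<in>V. SUP i. ennreal (h (J v)) * U i v) = (\<Sum>v\<in>V. ennreal (h (J v)) * (SUP i. U i) v)"
    by (simp add: SUP_mult_left_ennreal SUP_apply[abs_def] image_comp)
  also have "(SUP i. integral\<^sup>N \<mu> (U i)) = integral\<^sup>N \<mu> (SUP i. U i)"
    unfolding SUP_apply[abs_def] using seq(3) U[OF \<mu>] by (intro nn_integral_monotone_convergence_SUP[symmetric]) auto
  finally show ?case .
qed

lemma add_atoms_empty: "sets \<mu> = sets borel \<Longrightarrow> add_atoms h {} \<mu> J = \<mu>"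
  by (rule measure_eqI) (auto simp: emeasure_add_atoms)

lemma emeasure_add_atom:
  "sets \<mu> = sets borel \<Longrightarrow> A \<in> sets borel \<Longrightarrow>
    emeasure (add_atoms h {y} \<mu> (\<lambda>_. s)) A = emeasure \<mu> A + ennreal (h s) * indicator A y"
  by (cases "y \<in> A") (simp_all add: emeasure_add_atoms)

text \<open>Jumps at distinct points can be added successively; \<open>y \<notin> V\<close> ensures
  that overwriting \<open>J\<close> at \<open>y\<close> leaves the other jumps alone. The recursion
  for \<open>atoms_integral\<close> rests on this.\<close>

lemma add_atoms_insert:
  assumes \<mu>: "sets \<mu> = sets borel" and V: "finite V" "y \<notin> V"
  shows "add_atoms h V (add_atoms h {y} \<mu> (\<lambda>_. s)) J = add_atoms h (insert y V) \<mu> (J(y := s))"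
proof (rule measure_eqI)
  fix A assume "A \<in> sets (add_atoms h V (add_atoms h {y} \<mu> (\<lambda>_. s)) J)"
  then have A: "A \<in> sets borel" by simp
  have "(\<Sum>v\<in>insert y V. ennreal (h ((J(y := s)) v)) * indicator A v) =
      ennreal (h s) * indicator A y + (\<Sum>v\<in>V. ennreal (h ((J(y := s)) v)) * indicator A v)"
    using V by (subst sum.insert) (simp_all del: sum_mult_indicator)
  also have "(\<Sum>v\<in>V. ennreal (h ((J(y := s)) v)) * indicator A v) = (\<Sum>v\<in>V. ennreal (h (J v)) * indicator A v)"
    using V by (intro sum.cong) auto
  finally have eq: "(\<Sum>v\<in>insert y V. ennreal (h ((J(y := s)) v)) * indicator A v) =
      ennreal (h s) * indicator A y + (\<Sum>v\<in>V. ennreal (h (J v)) * indicator A v)" .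
  note emeasure_add_atom[OF \<mu> A, of h y s]
  then show "emeasure (add_atoms h V (add_atoms h {y} \<mu> (\<lambda>_. s)) J) A = emeasure (add_atoms h (insert y V) \<mu> (J(y := s))) A"
    using emeasure_add_atoms[where \<mu> = "add_atoms h {y} \<mu> (\<lambda>_. s)" and h = h and J = J, OF sets_add_atoms V(1) A]
      emeasure_add_atoms[OF \<mu> _ A, of "insert y V" h "J(y := s)"] V(1) eq
    by (simp add: add.assoc del: sum_mult_indicator)
qed simp

lemma boundedly_finite_add_atoms:
  "boundedly_finite \<mu> \<Longrightarrow> finite V \<Longrightarrow> boundedly_finite (add_atoms h V \<mu> J)"
  by (auto simp: boundedly_finite_def emeasure_add_atoms less_top[symmetric] ennreal_mult_eq_top_iff indicator_def)

lemma measurable_add_atoms: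
  fixes m :: "'x \<Rightarrow> 'y::metric_space measure" and h :: "'s::topological_space \<Rightarrow> real"
  assumes h[measurable]: "h \<in> borel_measurable borel"
    and m[measurable]: "m \<in> measurable M boundedly_finite_measures" and V: "finite V"
    and J[measurable]: "\<And>v. v \<in> V \<Longrightarrow> (\<lambda>x. J x v) \<in> measurable M borel"
  shows "(\<lambda>x. add_atoms h V (m x) (J x)) \<in> measurable M boundedly_finite_measures"
proof (rule measurable_measures_algebra)
  have bf: "boundedly_finite (m x)" if "x \<in> space M" for x
    using measurable_space[OF m that] by simp
  then show "add_atoms h V (m x) (J x) \<in> Collect boundedly_finite" if "x \<in> space M" for x
    using that V by (auto intro: boundedly_finite_add_atoms)
  fix A :: "'y set" assume [measurable]: "A \<in> sets borel"
  have "(\<lambda>x. emeasure (m x) A + (\<Sum>v\<in>V. ennreal (h (J x v)) * indicator A v)) \<in> borel_measurable M"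
    by measurable
  then show "(\<lambda>x. emeasure (add_atoms h V (m x) (J x)) A) \<in> borel_measurable M"
    by (subst measurable_cong) (use bf V in \<open>auto simp: emeasure_add_atoms boundedly_finite_def\<close>)
qed

text \<open>Here the location of the atom varies with \<open>x\<close>, while in
  \<open>measurable_add_atoms\<close> the set of locations is fixed.\<close>

lemma measurable_add_atom:
  fixes m :: "'x \<Rightarrow> 'y::metric_space measure" and h :: "'s::topological_space \<Rightarrow> real"
  assumes h[measurable]: "h \<in> borel_measurable borel"
    and m[measurable]: "m \<in> measurable M boundedly_finite_measures"
    and [measurable]: "y \<in> measurable M borel" "s \<in> measurable M borel"
  shows "(\<lambda>x. add_atoms h {y x} (m x) (\<lambda>_. s x)) \<in> measurable M boundedly_finite_measures"
proof (rule measurable_measures_algebra)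
  have bf: "boundedly_finite (m x)" if "x \<in> space M" for x
    using measurable_space[OF m that] by simp
  then show "add_atoms h {y x} (m x) (\<lambda>_. s x) \<in> Collect boundedly_finite" if "x \<in> space M" for x
    using that by (auto intro: boundedly_finite_add_atoms)
  fix A :: "'y set" assume [measurable]: "A \<in> sets borel"
  have "(\<lambda>x. emeasure (m x) A + ennreal (h (s x)) * indicator A (y x)) \<in> borel_measurable M"
    by measurable
  then show "(\<lambda>x. emeasure (add_atoms h {y x} (m x) (\<lambda>_. s x)) A) \<in> borel_measurable M"
    by (subst measurable_cong) (use bf in \<open>auto simp: emeasure_add_atom boundedly_finite_def\<close>)
qed

text \<open>The derivative of \<open>1 - e^{-u}\<close> at \<open>0\<close>, taken along
  \<open>u = 2^-n X n\<close> with a moving \<open>X n\<close>. Both bounds come from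
  \<open>1 + u \<le> e^u\<close>, applied to \<open>u\<close> and to \<open>-u\<close>. The steps
  are dyadic so that the quotients for a fixed \<open>x\<close> are monotone.\<close>

lemma tendsto_scaled_one_minus_nexp:
  fixes x :: real
  assumes x: "0 \<le> x" and X: "X \<longlonglongrightarrow> ennreal x"
  shows "(\<lambda>n. ennreal (2 ^ n) * (1 - nexp (ennreal ((1/2) ^ n) * X n))) \<longlonglongrightarrow> ennreal x"
proof -
  define Y where "Y = (\<lambda>n. enn2real (X n))"
  have Y: "Y \<longlonglongrightarrow> x" unfolding Y_def using X x by (rule tendsto_enn2real)
  have Y0: "0 \<le> Y n" for n by (simp add: Y_def)
  have p: "(\<lambda>n. (1/2::real) ^ n) \<longlonglongrightarrow> 0" by (intro LIMSEQ_power_zero) simp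
  have "(\<lambda>n. Y n / (1 + (1/2) ^ n * Y n)) \<longlonglongrightarrow> x / (1 + 0 * x)"
    by (intro tendsto_intros p Y) simp
  then have lo: "(\<lambda>n. Y n / (1 + (1/2) ^ n * Y n)) \<longlonglongrightarrow> x" by simp
  have "(\<lambda>n. 2 ^ n * (1 - exp (- ((1/2) ^ n * Y n)))) \<longlonglongrightarrow> x"
  proof (rule tendsto_sandwich[OF _ _ lo Y])
    show "\<forall>\<^sub>F n in sequentially. 2 ^ n * (1 - exp (- ((1/2) ^ n * Y n))) \<le> Y n"
    proof (rule always_eventually, rule allI)
      fix n
      have "1 + - ((1/2) ^ n * Y n) \<le> exp (- ((1/2) ^ n * Y n))" by (rule exp_ge_add_one_self)
      then have "2 ^ n * (1 - exp (- ((1/2) ^ n * Y n))) \<le> 2 ^ n * ((1/2) ^ n * Y n)"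
        by (intro mult_left_mono) auto
      also have "\<dots> = Y n" by (simp add: power_one_over)
      finally show "2 ^ n * (1 - exp (- ((1/2) ^ n * Y n))) \<le> Y n" .
    qed
    show "\<forall>\<^sub>F n in sequentially. Y n / (1 + (1/2) ^ n * Y n) \<le> 2 ^ n * (1 - exp (- ((1/2) ^ n * Y n)))"
    proof (rule always_eventually, rule allI)
      fix n
      define u where "u = (1/2) ^ n * Y n"
      have u: "0 \<le> u" using Y0 by (simp add: u_def)
      have Yu: "2 ^ n * u = Y n" by (simp add: u_def power_one_over)
      have "1 + u \<le> exp u" by (rule exp_ge_add_one_self)
      then have "exp (- u) \<le> 1 / (1 + u)" using u by (simp add: exp_minus field_simps)
      then have "u / (1 + u) \<le> 1 - exp (- u)" using u by (simp add: field_simps)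
      then have "2 ^ n * (u / (1 + u)) \<le> 2 ^ n * (1 - exp (- u))" by (rule mult_left_mono) simp
      then have "Y n / (1 + u) \<le> 2 ^ n * (1 - exp (- u))" by (simp only: times_divide_eq_right Yu)
      then show "Y n / (1 + (1/2) ^ n * Y n) \<le> 2 ^ n * (1 - exp (- ((1/2) ^ n * Y n)))"
        by (simp only: u_def)
    qed
  qed
  then have "(\<lambda>n. ennreal (2 ^ n * (1 - exp (- ((1/2) ^ n * Y n))))) \<longlonglongrightarrow> ennreal x"
    by (rule tendsto_ennrealI)
  moreover have "\<forall>\<^sub>F n in sequentially. X n < \<top>"
    by (intro order_tendstoD(2)[OF X]) simp
  then have "\<forall>\<^sub>F n in sequentially. ennreal (2 ^ n * (1 - exp (- ((1/2) ^ n * Y n)))) =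
      ennreal (2 ^ n) * (1 - nexp (ennreal ((1/2) ^ n) * X n))"
  proof eventually_elim
    case (elim n)
    then have "X n = ennreal (Y n)" by (simp add: Y_def)
    then have "ennreal ((1/2) ^ n) * X n = ennreal ((1/2) ^ n * Y n)" by (simp add: ennreal_mult Y0)
    then show ?case
      using Y0 by (simp only: nexp_ennreal mult_nonneg_nonneg zero_le_power zero_le_divide_1_iff zero_le_numeral)
        (simp add: ennreal_minus ennreal_mult flip: ennreal_1)
  qed
  ultimately show ?thesis by (rule Lim_transform_eventually)
qed

lemma tendsto_scaled_one_minus_nexp_const:
  "(\<lambda>n. ennreal (2 ^ n) * (1 - nexp (ennreal ((1/2) ^ n) * x))) \<longlonglongrightarrow> x"
proof (cases x)
  case (real r)
  then show ?thesis using tendsto_scaled_one_minus_nexp[of r "\<lambda>_. ennreal r"] by simp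
next
  case top
  have "ennreal ((1/2) ^ n) \<noteq> 0" for n by (simp add: ennreal_eq_0_iff not_le)
  then have "ennreal (2 ^ n) * (1 - nexp (ennreal ((1/2) ^ n) * x)) = of_nat (2 ^ n)" for n
    by (simp add: top ennreal_mult_top ennreal_of_nat_eq_real_of_nat)
  moreover have "(\<lambda>n. of_nat (2 ^ n) :: ennreal) \<longlonglongrightarrow> \<top>"
  proof -
    have "filterlim (\<lambda>n::nat. (2::nat) ^ n) sequentially sequentially"
      by (rule filterlim_subseq) (simp add: strict_mono_def)
    from filterlim_compose[OF of_nat_tendsto_top_ennreal this] show ?thesis by simp
  qed
  ultimately show ?thesis by (simp add: top)
qed

text \<open>Halving the step:
  \<open>1 - e^{-2y} = (1 - e^{-y}) (1 + e^{-y}) \<le> 2 (1 - e^{-y})\<close>. Difference quotients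
  then pass through integrals by monotone convergence.\<close>

lemma incseq_scaled_one_minus_nexp:
  "incseq (\<lambda>n. ennreal (2 ^ n) * (1 - nexp (ennreal ((1/2) ^ n) * x)))"
proof (rule incseq_SucI)
  fix n
  define y where "y = ennreal ((1/2) ^ Suc n) * x"
  have "ennreal ((1/2) ^ n) = ennreal ((1/2) ^ Suc n) + ennreal ((1/2) ^ Suc n)"
    by (subst ennreal_plus[symmetric]) auto
  then have "ennreal ((1/2) ^ n) * x = y + y" by (simp add: y_def distrib_right)
  then have "1 - nexp (ennreal ((1/2) ^ n) * x) = (1 - nexp y) + nexp y * (1 - nexp y)"
    by (simp add: one_minus_nexp_add)
  also have "\<dots> \<le> (1 - nexp y) + 1 * (1 - nexp y)"
    by (intro add_left_mono mult_right_mono) auto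
  finally have "ennreal (2 ^ n) * (1 - nexp (ennreal ((1/2) ^ n) * x)) \<le> ennreal (2 ^ n) * ((1 - nexp y) + (1 - nexp y))"
    by (intro mult_left_mono) auto
  also have "\<dots> = ennreal (2 ^ Suc n) * (1 - nexp y)"
    by (simp add: distrib_left[symmetric] ennreal_mult mult_2[symmetric] mult.assoc mult.left_commute)
  finally show "ennreal (2 ^ n) * (1 - nexp (ennreal ((1/2) ^ n) * x)) \<le> ennreal (2 ^ Suc n) * (1 - nexp (ennreal ((1/2) ^ Suc n) * x))"
    by (simp add: y_def)
qed

lemma measurable_nn_integral_boundedly_finite:
  fixes F :: "'x \<times> 'y::polish_space \<Rightarrow> ennreal"
  assumes m: "m \<in> measurable M boundedly_finite_measures" and F: "F \<in> borel_measurable (M \<Otimes>\<^sub>M borel)"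
  shows "(\<lambda>x. \<integral>\<^sup>+y. F (x, y) \<partial>m x) \<in> borel_measurable M"
proof -
  obtain a :: 'y where True by simp
  have bf: "boundedly_finite (m x)" if "x \<in> space M" for x
    using measurable_space[OF m that] by simp
  show ?thesis
  proof (rule measurable_nn_integral_kernel[where D = "\<lambda>k. ball a (real k)"])
    show "(\<lambda>x. emeasure (m x) A) \<in> borel_measurable M" if "A \<in> sets borel" for A
      using measurable_compose[OF m measurable_emeasure_measures_algebra[OF that]] .
    show "emeasure (m x) (ball a (real k)) < \<infinity>" if "x \<in> space M" for x and k :: nat
      using bf[OF that] by (auto simp: boundedly_finite_def)
  qed (use bf F in \<open>simp_all add: boundedly_finite_def UN_ball_nat incseq_ball_nat image_subset_iff\<close>)
qed

section \<open>The Campbell measure of the random measure\<close>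

context crm
begin

lemma measurable_integral_bf [measurable]:
  assumes "g \<in> borel_measurable borel"
  shows "(\<lambda>\<mu>. integral\<^sup>N \<mu> g) \<in> borel_measurable (boundedly_finite_measures :: 'y measure measure)"
  by (rule measurable_nn_integral_measures_algebra) (use assms in \<open>auto simp: boundedly_finite_def\<close>)

lemma borel_measurable_intensity_iff:
  "u \<in> borel_measurable borel \<Longrightarrow> u \<in> borel_measurable (intensity \<rho> \<eta>)"
  by (simp cong: measurable_cong_sets)

text \<open>Differentiating the Laplace functional in the direction of an indicator function.\<close>

lemma laplace_moment_C:
  assumes B[measurable]: "B \<in> sets borel" and g[measurable]: "g \<in> borel_measurable borel"
    and fin: "(\<integral>\<^sup>+x. ennreal (h (fst x)) * indicator B (snd x) \<partial>intensity \<rho> \<eta>) < \<infinity>"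
  shows "(\<integral>\<^sup>+\<mu>. nexp (integral\<^sup>N \<mu> g) * emeasure \<mu> B \<partial>C) =
    (\<integral>\<^sup>+\<mu>. nexp (integral\<^sup>N \<mu> g) \<partial>C) *
    (\<integral>\<^sup>+x. nexp (ennreal (h (fst x)) * g (snd x)) * (ennreal (h (fst x)) * indicator B (snd x)) \<partial>intensity \<rho> \<eta>)"
proof -
  interpret C: prob_space C by (rule prob_space_C)
  define t where "t = (\<lambda>n. ennreal ((1/2) ^ n))"
  let ?hg = "\<lambda>x. ennreal (h (fst x)) * g (snd x)" and ?hB = "\<lambda>x. ennreal (h (fst x)) * indicator B (snd x)"
  have [measurable]: "?hg \<in> borel_measurable (borel :: ('s \<times> 'y) measure)" "?hB \<in> borel_measurable (borel :: ('s \<times> 'y) measure)"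
    by (rule measurable_hN, measurable)+
  define a where "a = (\<integral>\<^sup>+x. 1 - nexp (?hg x) \<partial>intensity \<rho> \<eta>)"
  define b where "b = (\<lambda>n. \<integral>\<^sup>+x. nexp (?hg x) * (1 - nexp (t n * ?hB x)) \<partial>intensity \<rho> \<eta>)"
  define \<beta> where "\<beta> = (\<integral>\<^sup>+x. nexp (?hg x) * ?hB x \<partial>intensity \<rho> \<eta>)"
  \<comment> \<open>\<open>2^n * I n\<close> is the difference quotient of the Laplace functional at
    \<open>g\<close> in the direction of \<open>indicator B\<close>, up to sign; its limit is
    computed once under \<open>C\<close> and once from the explicit formula.\<close>
  define I where "I = (\<lambda>n. \<integral>\<^sup>+\<mu>. nexp (integral\<^sup>N \<mu> g) * (1 - nexp (t n * emeasure \<mu> B)) \<partial>C)"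
  have La: "(\<integral>\<^sup>+\<mu>. nexp (integral\<^sup>N \<mu> g) \<partial>C) = nexp a" unfolding a_def by (rule laplace_C[OF g])
  have "(\<integral>\<^sup>+\<mu>. nexp (integral\<^sup>N \<mu> g) * nexp (t n * emeasure \<mu> B) \<partial>C) = nexp a * nexp (b n)" for n
  proof -
    have "(\<integral>\<^sup>+\<mu>. nexp (integral\<^sup>N \<mu> g) * nexp (t n * emeasure \<mu> B) \<partial>C) = (\<integral>\<^sup>+\<mu>. nexp (\<integral>\<^sup>+y. g y + t n * indicator B y \<partial>\<mu>) \<partial>C)"
    proof (intro nn_integral_cong)
      fix \<mu> assume "\<mu> \<in> space C"
      then have [measurable_cong]: "sets \<mu> = sets borel" by (simp add: boundedly_finite_def)
      have "(\<integral>\<^sup>+y. g y + t n * indicator B y \<partial>\<mu>) = integral\<^sup>N \<mu> g + t n * emeasure \<mu> B"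
        by (simp add: nn_integral_add nn_integral_cmult_indicator)
      then show "nexp (integral\<^sup>N \<mu> g) * nexp (t n * emeasure \<mu> B) = nexp (\<integral>\<^sup>+y. g y + t n * indicator B y \<partial>\<mu>)"
        by (simp add: nexp_add)
    qed
    also have "\<dots> = nexp (\<integral>\<^sup>+x. 1 - nexp (ennreal (h (fst x)) * (g (snd x) + t n * indicator B (snd x))) \<partial>intensity \<rho> \<eta>)"
      by (rule laplace_C) measurable
    also have "(\<integral>\<^sup>+x. 1 - nexp (ennreal (h (fst x)) * (g (snd x) + t n * indicator B (snd x))) \<partial>intensity \<rho> \<eta>) =
      (\<integral>\<^sup>+x. (1 - nexp (?hg x)) + nexp (?hg x) * (1 - nexp (t n * ?hB x)) \<partial>intensity \<rho> \<eta>)"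
      by (intro nn_integral_cong) (simp add: distrib_left one_minus_nexp_add mult_ac)
    also have "\<dots> = a + b n"
      unfolding a_def b_def by (intro nn_integral_add borel_measurable_intensity_iff) measurable
    finally show ?thesis by (simp add: nexp_add)
  qed
  moreover have "I n = nexp a - (\<integral>\<^sup>+\<mu>. nexp (integral\<^sup>N \<mu> g) * nexp (t n * emeasure \<mu> B) \<partial>C)" for n
  proof -
    have "I n = (\<integral>\<^sup>+\<mu>. nexp (integral\<^sup>N \<mu> g) - nexp (integral\<^sup>N \<mu> g) * nexp (t n * emeasure \<mu> B) \<partial>C)"
      unfolding I_def by (intro nn_integral_cong) (simp add: ennreal_right_diff_distrib)
    also have "\<dots> = (\<integral>\<^sup>+\<mu>. nexp (integral\<^sup>N \<mu> g) \<partial>C) - (\<integral>\<^sup>+\<mu>. nexp (integral\<^sup>N \<mu> g) * nexp (t n * emeasure \<mu> B) \<partial>C)"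
    proof (rule nn_integral_diff)
      show "AE \<mu> in C. nexp (integral\<^sup>N \<mu> g) * nexp (t n * emeasure \<mu> B) \<le> nexp (integral\<^sup>N \<mu> g)"
        using mult_left_mono[OF nexp_le_1] by (intro AE_I2) fastforce
      have "(\<integral>\<^sup>+\<mu>. nexp (integral\<^sup>N \<mu> g) * nexp (t n * emeasure \<mu> B) \<partial>C) \<le> (\<integral>\<^sup>+\<mu>. 1 \<partial>C)"
        by (intro nn_integral_mono mult_le_one) auto
      then show "(\<integral>\<^sup>+\<mu>. nexp (integral\<^sup>N \<mu> g) * nexp (t n * emeasure \<mu> B) \<partial>C) \<noteq> \<infinity>"
        using C.emeasure_space_1 by (auto simp: top_unique)
    qed measurable
    finally show ?thesis by (simp add: La)
  qed
  ultimately have I: "I n = nexp a * (1 - nexp (b n))" for n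
    by (simp add: ennreal_right_diff_distrib)
  have "(\<lambda>n. ennreal (2 ^ n) * b n) \<longlonglongrightarrow> \<beta>"
  proof -
    have eq: "ennreal (2 ^ n) * b n = (\<integral>\<^sup>+x. nexp (?hg x) * (ennreal (2 ^ n) * (1 - nexp (t n * ?hB x))) \<partial>intensity \<rho> \<eta>)" for n
    proof -
      have "ennreal (2 ^ n) * b n = (\<integral>\<^sup>+x. ennreal (2 ^ n) * (nexp (?hg x) * (1 - nexp (t n * ?hB x))) \<partial>intensity \<rho> \<eta>)"
        unfolding b_def by (intro nn_integral_cmult[symmetric] borel_measurable_intensity_iff) measurable
      then show ?thesis by (simp add: mult_ac)
    qed
    show ?thesis
      unfolding eq \<beta>_def
    proof (rule nn_integral_LIMSEQ)
      show "incseq (\<lambda>n x. nexp (?hg x) * (ennreal (2 ^ n) * (1 - nexp (t n * ?hB x))))"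
        using incseq_scaled_one_minus_nexp unfolding t_def
        by (auto simp: incseq_def le_fun_def intro!: mult_left_mono)
      show "(\<lambda>x. nexp (?hg x) * (ennreal (2 ^ n) * (1 - nexp (t n * ?hB x)))) \<in> borel_measurable (intensity \<rho> \<eta>)" for n
        by (rule borel_measurable_intensity_iff) measurable
      show "(\<lambda>n. nexp (?hg x) * (ennreal (2 ^ n) * (1 - nexp (t n * ?hB x)))) \<longlonglongrightarrow> nexp (?hg x) * ?hB x" for x
        unfolding t_def by (intro ennreal_tendsto_cmult tendsto_scaled_one_minus_nexp_const) simp
    qed
  qed
  \<comment> \<open>The outer exponential is differentiated along the moving sequence
    \<open>2^n * b n\<close>, and for that its limit has to be a real number.\<close>
  moreover have "\<beta> < \<infinity>"
  proof -
    have "\<beta> \<le> (\<integral>\<^sup>+x. 1 * ?hB x \<partial>intensity \<rho> \<eta>)"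
      unfolding \<beta>_def by (intro nn_integral_mono mult_right_mono) auto
    with fin show ?thesis by simp
  qed
  ultimately have "(\<lambda>n. ennreal (2 ^ n) * (1 - nexp (t n * (ennreal (2 ^ n) * b n)))) \<longlonglongrightarrow> \<beta>"
    using tendsto_scaled_one_minus_nexp[of "enn2real \<beta>" "\<lambda>n. ennreal (2 ^ n) * b n"] unfolding t_def by simp
  moreover have "t n * (ennreal (2 ^ n) * b n) = b n" for n
  proof -
    have "t n * ennreal (2 ^ n) = 1"
      unfolding t_def by (subst ennreal_mult[symmetric]) (auto simp: power_mult_distrib[symmetric])
    then show ?thesis by (simp add: mult.assoc[symmetric])
  qed
  ultimately have "(\<lambda>n. nexp a * (ennreal (2 ^ n) * (1 - nexp (b n)))) \<longlonglongrightarrow> nexp a * \<beta>"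
    by (intro ennreal_tendsto_cmult) simp_all
  then have lim1: "(\<lambda>n. ennreal (2 ^ n) * I n) \<longlonglongrightarrow> nexp a * \<beta>"
    by (simp add: I mult.left_commute)
  have lim2: "(\<lambda>n. ennreal (2 ^ n) * I n) \<longlonglongrightarrow> (\<integral>\<^sup>+\<mu>. nexp (integral\<^sup>N \<mu> g) * emeasure \<mu> B \<partial>C)"
  proof -
    have eq: "ennreal (2 ^ n) * I n = (\<integral>\<^sup>+\<mu>. nexp (integral\<^sup>N \<mu> g) * (ennreal (2 ^ n) * (1 - nexp (t n * emeasure \<mu> B))) \<partial>C)" for n
    proof -
      have "ennreal (2 ^ n) * I n = (\<integral>\<^sup>+\<mu>. ennreal (2 ^ n) * (nexp (integral\<^sup>N \<mu> g) * (1 - nexp (t n * emeasure \<mu> B))) \<partial>C)"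
        unfolding I_def by (intro nn_integral_cmult[symmetric]) measurable
      then show ?thesis by (simp add: mult_ac)
    qed
    show ?thesis
      unfolding eq
    proof (rule nn_integral_LIMSEQ)
      show "incseq (\<lambda>n \<mu>. nexp (integral\<^sup>N \<mu> g) * (ennreal (2 ^ n) * (1 - nexp (t n * emeasure \<mu> B))))"
        using incseq_scaled_one_minus_nexp unfolding t_def
        by (auto simp: incseq_def le_fun_def intro!: mult_left_mono)
      show "(\<lambda>n. nexp (integral\<^sup>N \<mu> g) * (ennreal (2 ^ n) * (1 - nexp (t n * emeasure \<mu> B)))) \<longlonglongrightarrow> nexp (integral\<^sup>N \<mu> g) * emeasure \<mu> B" for \<mu>
        unfolding t_def by (intro ennreal_tendsto_cmult tendsto_scaled_one_minus_nexp_const) simp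
    qed measurable
  qed
  show ?thesis
    unfolding La using LIMSEQ_unique[OF lim2 lim1] by (simp add: \<beta>_def)
qed

lemma measurable_add_atom_pair [measurable]:
  "(\<lambda>(\<mu>, x). add_atoms h {snd x} \<mu> (\<lambda>_. fst x)) \<in>
     measurable (boundedly_finite_measures \<Otimes>\<^sub>M (borel :: ('s \<times> 'y) measure)) boundedly_finite_measures"
  unfolding borel_prod[symmetric] case_prod_unfold by (rule measurable_add_atom) measurable

text \<open>Both sides are finite measures as functions of \<open>A\<close>, and their Laplace
  functionals agree by \<open>laplace_moment_C\<close>: an extra atom of size \<open>h s\<close> at
  \<open>y\<close> multiplies \<open>e^{-\<mu>(g)}\<close> by \<open>e^{-h(s) g(y)}\<close>.\<close>

lemma mecke_set:
  assumes B[measurable]: "B \<in> sets borel" and A[measurable]: "A \<in> sets boundedly_finite_measures"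
    and fin: "(\<integral>\<^sup>+x. ennreal (h (fst x)) * indicator B (snd x) \<partial>intensity \<rho> \<eta>) < \<infinity>"
  shows "(\<integral>\<^sup>+\<mu>. indicator A \<mu> * emeasure \<mu> B \<partial>C) =
    (\<integral>\<^sup>+x. ennreal (h (fst x)) * indicator B (snd x) *
       (\<integral>\<^sup>+\<mu>. indicator A (add_atoms h {snd x} \<mu> (\<lambda>_. fst x)) \<partial>C) \<partial>intensity \<rho> \<eta>)"
proof -
  interpret C: prob_space C by (rule prob_space_C)
  let ?hB = "\<lambda>x. ennreal (h (fst x)) * indicator B (snd x)"
  have hB[measurable]: "?hB \<in> borel_measurable (borel :: ('s \<times> 'y) measure)" by (rule measurable_hN) measurable
  \<comment> \<open>The law of the added point, weighted by its jump size and confined to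
    \<open>B\<close>; \<open>fin\<close> makes it a finite measure.\<close>
  define \<sigma> where "\<sigma> = density (intensity \<rho> \<eta>) ?hB"
  have s\<sigma>[measurable_cong, simp]: "sets \<sigma> = sets borel" by (simp add: \<sigma>_def)
  have int\<sigma>: "integral\<^sup>N \<sigma> u = (\<integral>\<^sup>+x. ?hB x * u x \<partial>intensity \<rho> \<eta>)" if "u \<in> borel_measurable borel" for u
    unfolding \<sigma>_def by (intro nn_integral_density borel_measurable_intensity_iff hB that)
  interpret \<sigma>: finite_measure \<sigma>
  proof (rule finite_measureI)
    have "emeasure \<sigma> (space \<sigma>) = (\<integral>\<^sup>+x. 1 \<partial>\<sigma>)" by simp
    also have "\<dots> < \<infinity>" using fin by (subst int\<sigma>) auto
    finally show "emeasure \<sigma> (space \<sigma>) \<noteq> \<infinity>" by simp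
  qed
  interpret P: pair_sigma_finite C \<sigma> ..
  let ?add = "\<lambda>(\<mu>, x). add_atoms h {snd x} \<mu> (\<lambda>_. fst x)"
  have addm[measurable]: "?add \<in> measurable (C \<Otimes>\<^sub>M \<sigma>) boundedly_finite_measures" by measurable
  define Q1 where "Q1 = density C (\<lambda>\<mu>. emeasure \<mu> B)"
  define Q2 where "Q2 = distr (C \<Otimes>\<^sub>M \<sigma>) boundedly_finite_measures ?add"
  have intQ2: "integral\<^sup>N Q2 u = (\<integral>\<^sup>+x. \<integral>\<^sup>+\<mu>. u (add_atoms h {snd x} \<mu> (\<lambda>_. fst x)) \<partial>C \<partial>\<sigma>)"
    if [measurable]: "u \<in> borel_measurable boundedly_finite_measures" for u
    unfolding Q2_def by (subst nn_integral_distr) (auto simp: P.nn_integral_snd[symmetric])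
  have intQ1: "integral\<^sup>N Q1 u = (\<integral>\<^sup>+\<mu>. u \<mu> * emeasure \<mu> B \<partial>C)"
    if [measurable]: "u \<in> borel_measurable boundedly_finite_measures" for u
    unfolding Q1_def by (subst nn_integral_density) (auto simp: mult.commute)
  have lapQ: "(\<integral>\<^sup>+\<mu>. nexp (integral\<^sup>N \<mu> g) \<partial>Q1) = (\<integral>\<^sup>+\<mu>. nexp (integral\<^sup>N \<mu> g) \<partial>Q2)"
    if g[measurable]: "g \<in> borel_measurable borel" for g
  proof -
    let ?hg = "\<lambda>x. ennreal (h (fst x)) * g (snd x)"
    have [measurable]: "?hg \<in> borel_measurable (borel :: ('s \<times> 'y) measure)" by (rule measurable_hN[OF g])
    have "(\<integral>\<^sup>+\<mu>. nexp (integral\<^sup>N \<mu> g) \<partial>Q1) = (\<integral>\<^sup>+\<mu>. nexp (integral\<^sup>N \<mu> g) \<partial>C) * (\<integral>\<^sup>+x. nexp (?hg x) * ?hB x \<partial>intensity \<rho> \<eta>)"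
      using laplace_moment_C[OF B g fin] by (simp add: intQ1)
    also have "(\<integral>\<^sup>+x. nexp (?hg x) * ?hB x \<partial>intensity \<rho> \<eta>) = (\<integral>\<^sup>+x. nexp (?hg x) \<partial>\<sigma>)"
    proof (subst int\<sigma>)
      show "(\<lambda>x. nexp (?hg x)) \<in> borel_measurable borel" by measurable
    qed (simp add: mult.commute)
    also have "(\<integral>\<^sup>+\<mu>. nexp (integral\<^sup>N \<mu> g) \<partial>C) * \<dots> = (\<integral>\<^sup>+x. (\<integral>\<^sup>+\<mu>. nexp (integral\<^sup>N \<mu> g) \<partial>C) * nexp (?hg x) \<partial>\<sigma>)"
      by (rule nn_integral_cmult[symmetric]) measurable
    also have "\<dots> = (\<integral>\<^sup>+x. \<integral>\<^sup>+\<mu>. nexp (integral\<^sup>N (add_atoms h {snd x} \<mu> (\<lambda>_. fst x)) g) \<partial>C \<partial>\<sigma>)"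
    proof (intro nn_integral_cong)
      fix x :: "'s \<times> 'y"
      have "(\<integral>\<^sup>+\<mu>. nexp (integral\<^sup>N \<mu> g) \<partial>C) * nexp (?hg x) = (\<integral>\<^sup>+\<mu>. nexp (integral\<^sup>N \<mu> g) * nexp (?hg x) \<partial>C)"
        by (rule nn_integral_multc[symmetric]) measurable
      also have "\<dots> = (\<integral>\<^sup>+\<mu>. nexp (integral\<^sup>N (add_atoms h {snd x} \<mu> (\<lambda>_. fst x)) g) \<partial>C)"
        by (intro nn_integral_cong) (simp add: boundedly_finite_def nn_integral_add_atoms nexp_add)
      finally show "(\<integral>\<^sup>+\<mu>. nexp (integral\<^sup>N \<mu> g) \<partial>C) * nexp (?hg x) = (\<integral>\<^sup>+\<mu>. nexp (integral\<^sup>N (add_atoms h {snd x} \<mu> (\<lambda>_. fst x)) g) \<partial>C)" .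
    qed
    also have "\<dots> = (\<integral>\<^sup>+\<mu>. nexp (integral\<^sup>N \<mu> g) \<partial>Q2)" by (rule intQ2[symmetric]) measurable
    finally show ?thesis .
  qed
  have "emeasure Q2 (space Q2) < \<infinity>"
  proof -
    have "emeasure Q2 (space Q2) = (\<integral>\<^sup>+\<mu>. 1 \<partial>Q2)" by simp
    also have "\<dots> = emeasure \<sigma> (space \<sigma>)" using C.emeasure_space_1 by (subst intQ2) simp_all
    also have "\<dots> < \<infinity>" using \<sigma>.emeasure_finite[of "space \<sigma>"] by (simp add: less_top[symmetric])
    finally show ?thesis .
  qed
  moreover have "emeasure Q1 (space Q1) = emeasure Q2 (space Q2)"
    using lapQ[of "\<lambda>_. 0"] by simp
  ultimately have fQ: "finite_measure Q1" "finite_measure Q2" by (auto intro!: finite_measureI)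
  have "Q1 = Q2"
    by (rule finite_measure_eqI_laplace_integral[OF fQ _ _ _ lapQ]) (auto simp: Q1_def Q2_def boundedly_finite_def)
  moreover have "integral\<^sup>N Q1 (indicator A) = (\<integral>\<^sup>+\<mu>. indicator A \<mu> * emeasure \<mu> B \<partial>C)"
    by (rule intQ1) measurable
  moreover have "integral\<^sup>N Q2 (indicator A) = (\<integral>\<^sup>+x. ?hB x * (\<integral>\<^sup>+\<mu>. indicator A (add_atoms h {snd x} \<mu> (\<lambda>_. fst x)) \<partial>C) \<partial>intensity \<rho> \<eta>)"
  proof -
    have "(\<lambda>x. \<integral>\<^sup>+\<mu>. indicator A (add_atoms h {snd x} \<mu> (\<lambda>_. fst x)) \<partial>C) \<in> borel_measurable \<sigma>"
      using C.borel_measurable_nn_integral_fst[OF measurable_pair_swap[OF measurable_compose[OF addm borel_measurable_indicator[OF A]]]]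
      by simp
    then have "(\<lambda>x. \<integral>\<^sup>+\<mu>. indicator A (add_atoms h {snd x} \<mu> (\<lambda>_. fst x)) \<partial>C) \<in> borel_measurable borel"
      by (simp cong: measurable_cong_sets)
    then show ?thesis by (simp add: intQ2 int\<sigma>)
  qed
  ultimately show ?thesis by simp
qed

text \<open>Finite first moments are available only over suitable sets, so these are passed as the
  exhaustion \<open>E\<close>. Rectangles with second side inside some \<open>E k\<close> have
  finite mass and determine both measures.\<close>

lemma nn_integral_mecke:
  assumes E: "range E \<subseteq> sets borel" "incseq E" "(\<Union>k. E k) = UNIV"
    and fin: "\<And>k::nat. (\<integral>\<^sup>+x. ennreal (h (fst x)) * indicator (E k) (snd x) \<partial>intensity \<rho> \<eta>) < \<infinity>"
    and F[measurable]: "F \<in> borel_measurable (boundedly_finite_measures \<Otimes>\<^sub>M borel)"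
  shows "(\<integral>\<^sup>+\<mu>. \<integral>\<^sup>+y. F (\<mu>, y) \<partial>\<mu> \<partial>C) =
    (\<integral>\<^sup>+y. \<integral>\<^sup>+s. ennreal (h s) * (\<integral>\<^sup>+\<mu>. F (add_atoms h {y} \<mu> (\<lambda>_. s), y) \<partial>C) \<partial>\<rho> y \<partial>\<eta>)"
proof -
  interpret C: prob_space C by (rule prob_space_C)
  have Ek[measurable]: "E k \<in> sets borel" for k using E(1) by auto
  let ?h = "\<lambda>x. ennreal (h (fst x))"
  have h[measurable]: "?h \<in> borel_measurable (borel :: ('s \<times> 'y) measure)"
    using measurable_hN[of "\<lambda>_. 1"] by simp
  define \<sigma> where "\<sigma> = density (intensity \<rho> \<eta>) ?h"
  have s\<sigma>[measurable_cong, simp]: "sets \<sigma> = sets borel" by (simp add: \<sigma>_def)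
  have int\<sigma>: "integral\<^sup>N \<sigma> u = (\<integral>\<^sup>+x. ?h x * u x \<partial>intensity \<rho> \<eta>)" if "u \<in> borel_measurable borel" for u
    unfolding \<sigma>_def by (intro nn_integral_density borel_measurable_intensity_iff h that)
  have sndm: "snd \<in> measurable (borel :: ('s \<times> 'y) measure) borel" unfolding borel_prod[symmetric] by measurable
  have UE: "UNIV \<times> E k \<in> sets (borel :: ('s \<times> 'y) measure)" for k
    unfolding borel_prod[symmetric] by measurable
  have \<sigma>E: "emeasure \<sigma> (UNIV \<times> E k) < \<infinity>" for k
  proof -
    have "emeasure \<sigma> (UNIV \<times> E k) = (\<integral>\<^sup>+x. indicator (UNIV \<times> E k) x \<partial>\<sigma>)" using UE by simp
    also have "\<dots> = (\<integral>\<^sup>+x. ?h x * indicator (E k) (snd x) \<partial>intensity \<rho> \<eta>)"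
      using UE by (subst int\<sigma>) (auto simp: indicator_def intro!: nn_integral_cong)
    finally show ?thesis using fin by simp
  qed
  interpret \<sigma>: sigma_finite_measure \<sigma>
  proof
    have "\<exists>k. y \<in> E k" for y using E(3) by blast
    then show "\<exists>A. countable A \<and> A \<subseteq> sets \<sigma> \<and> \<Union> A = space \<sigma> \<and> (\<forall>a\<in>A. emeasure \<sigma> a \<noteq> \<infinity>)"
      using UE \<sigma>E sets_eq_imp_space_eq[OF s\<sigma>]
      by (intro exI[of _ "range (\<lambda>k. UNIV \<times> E k)"]) (auto simp: less_top)
  qed
  interpret P: pair_sigma_finite C \<sigma> ..
  let ?add = "\<lambda>(\<mu>, x). (add_atoms h {snd x} \<mu> (\<lambda>_. fst x), snd x)"
  have addm[measurable]: "?add \<in> measurable (C \<Otimes>\<^sub>M \<sigma>) (boundedly_finite_measures \<Otimes>\<^sub>M borel)"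
  proof -
    have "(\<lambda>z. (case z of (\<mu>, x) \<Rightarrow> add_atoms h {snd x} \<mu> (\<lambda>_. fst x), snd (snd z))) \<in> measurable (C \<Otimes>\<^sub>M \<sigma>) (boundedly_finite_measures \<Otimes>\<^sub>M borel)"
      using measurable_compose[OF measurable_snd sndm] by (intro measurable_Pair) (auto cong: measurable_cong_sets)
    then show ?thesis by (simp add: case_prod_unfold)
  qed
  \<comment> \<open>\<open>m1\<close> is the Campbell measure of \<open>\<mu>\<close>;
    \<open>m2\<close> is built by sampling a point from \<open>\<sigma>\<close> and adding it to an
    independent copy of \<open>\<mu>\<close>.\<close>
  define m1 where "m1 = kernel_prod C (borel :: 'y measure) (\<lambda>\<mu>. \<mu>)"
  define m2 where "m2 = distr (C \<Otimes>\<^sub>M \<sigma>) (boundedly_finite_measures \<Otimes>\<^sub>M borel) ?add"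
  have idm: "(\<lambda>\<mu>. \<mu>) \<in> measurable C (boundedly_finite_measures :: 'y measure measure)" by measurable
  have intm1: "integral\<^sup>N m1 u = (\<integral>\<^sup>+\<mu>. \<integral>\<^sup>+y. u (\<mu>, y) \<partial>\<mu> \<partial>C)" if "u \<in> borel_measurable (boundedly_finite_measures \<Otimes>\<^sub>M borel)" for u
    unfolding m1_def
  proof (intro nn_integral_kernel_prod)
    have sC: "borel_measurable (C \<Otimes>\<^sub>M (borel :: 'y measure)) = (borel_measurable (boundedly_finite_measures \<Otimes>\<^sub>M borel) :: (_ \<Rightarrow> ennreal) set)"
      by (intro measurable_cong_sets sets_pair_measure_cong) simp_all
    show "u \<in> borel_measurable (C \<Otimes>\<^sub>M borel)" using that unfolding sC .
    show "(\<lambda>\<mu>. \<integral>\<^sup>+y. v (\<mu>, y) \<partial>\<mu>) \<in> borel_measurable C"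
      if "v \<in> borel_measurable (C \<Otimes>\<^sub>M borel)" for v
      using measurable_nn_integral_boundedly_finite[OF idm that] .
  qed (simp add: boundedly_finite_def)
  have intm2: "integral\<^sup>N m2 u = (\<integral>\<^sup>+x. \<integral>\<^sup>+\<mu>. u (add_atoms h {snd x} \<mu> (\<lambda>_. fst x), snd x) \<partial>C \<partial>\<sigma>)"
    and measm2: "(\<lambda>x. \<integral>\<^sup>+\<mu>. u (add_atoms h {snd x} \<mu> (\<lambda>_. fst x), snd x) \<partial>C) \<in> borel_measurable borel"
    if [measurable]: "u \<in> borel_measurable (boundedly_finite_measures \<Otimes>\<^sub>M borel)" for u
  proof -
    have um: "(\<lambda>z. u (?add z)) \<in> borel_measurable (C \<Otimes>\<^sub>M \<sigma>)"
      using measurable_compose[OF addm that] .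
    show "integral\<^sup>N m2 u = (\<integral>\<^sup>+x. \<integral>\<^sup>+\<mu>. u (add_atoms h {snd x} \<mu> (\<lambda>_. fst x), snd x) \<partial>C \<partial>\<sigma>)"
      unfolding m2_def using P.nn_integral_snd[OF um] by (subst nn_integral_distr[OF addm]) (simp_all add: that)
    show "(\<lambda>x. \<integral>\<^sup>+\<mu>. u (add_atoms h {snd x} \<mu> (\<lambda>_. fst x), snd x) \<partial>C) \<in> borel_measurable borel"
    proof -
      have "(\<lambda>(x, \<mu>). u (add_atoms h {snd x} \<mu> (\<lambda>_. fst x), snd x)) \<in> borel_measurable (\<sigma> \<Otimes>\<^sub>M C)"
        using measurable_pair_swap[OF um] by (simp only: prod.case)
      from C.borel_measurable_nn_integral_fst[OF this] show ?thesis
        unfolding measurable_cong_sets[OF s\<sigma> refl] by (simp only: prod.case)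
    qed
  qed
  have sm[simp]: "sets m1 = sets (boundedly_finite_measures \<Otimes>\<^sub>M borel)" "sets m2 = sets (boundedly_finite_measures \<Otimes>\<^sub>M borel)"
    unfolding m1_def m2_def by (simp_all only: sets_kernel_prod sets_distr sets_pair_measure_cong[OF sets_C refl])
  have rect: "emeasure m1 (A \<times> B) = emeasure m2 (A \<times> B)" "emeasure m2 (A \<times> B) < \<infinity>"
    if A[measurable]: "A \<in> sets boundedly_finite_measures" and B[measurable]: "B \<in> sets borel" and Bk: "B \<subseteq> E k" for A B k
  proof -
    have AB: "A \<times> B \<in> sets (boundedly_finite_measures \<Otimes>\<^sub>M borel)" by measurable
    have "(\<integral>\<^sup>+x. ?h x * indicator B (snd x) \<partial>intensity \<rho> \<eta>) \<le> (\<integral>\<^sup>+x. ?h x * indicator (E k) (snd x) \<partial>intensity \<rho> \<eta>)"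
      using Bk by (intro nn_integral_mono mult_left_mono) (auto simp: indicator_def)
    then have fB: "(\<integral>\<^sup>+x. ?h x * indicator B (snd x) \<partial>intensity \<rho> \<eta>) < \<infinity>" using fin[of k] by (rule le_less_trans)
    have "emeasure m1 (A \<times> B) = integral\<^sup>N m1 (indicator (A \<times> B))" using AB by simp
    also have "\<dots> = (\<integral>\<^sup>+\<mu>. indicator A \<mu> * emeasure \<mu> B \<partial>C)"
      using AB B by (subst intm1) (auto simp: indicator_times nn_integral_cmult boundedly_finite_def intro!: nn_integral_cong)
    also have "\<dots> = (\<integral>\<^sup>+x. ?h x * indicator B (snd x) * (\<integral>\<^sup>+\<mu>. indicator A (add_atoms h {snd x} \<mu> (\<lambda>_. fst x)) \<partial>C) \<partial>intensity \<rho> \<eta>)"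
      by (rule mecke_set[OF B A fB])
    also have "\<dots> = (\<integral>\<^sup>+x. \<integral>\<^sup>+\<mu>. indicator (A \<times> B) (add_atoms h {snd x} \<mu> (\<lambda>_. fst x), snd x) \<partial>C \<partial>\<sigma>)"
    proof (subst int\<sigma>)
      show "(\<lambda>x. \<integral>\<^sup>+\<mu>. indicator (A \<times> B) (add_atoms h {snd x} \<mu> (\<lambda>_. fst x), snd x) \<partial>C) \<in> borel_measurable borel"
        by (rule measm2) (use AB in simp)
    qed (auto simp: indicator_def mult.assoc intro!: nn_integral_cong)
    also have "\<dots> = integral\<^sup>N m2 (indicator (A \<times> B))" using AB by (intro intm2[symmetric]) simp
    also have "\<dots> = emeasure m2 (A \<times> B)" using AB by simp
    finally show "emeasure m1 (A \<times> B) = emeasure m2 (A \<times> B)" .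
    have "emeasure m2 (A \<times> B) = (\<integral>\<^sup>+x. \<integral>\<^sup>+\<mu>. indicator (A \<times> B) (add_atoms h {snd x} \<mu> (\<lambda>_. fst x), snd x) \<partial>C \<partial>\<sigma>)"
      using AB by (subst intm2[symmetric]) simp_all
    also have "\<dots> \<le> (\<integral>\<^sup>+x. \<integral>\<^sup>+\<mu>. indicator (UNIV \<times> E k) x \<partial>C \<partial>\<sigma>)"
      using Bk by (intro nn_integral_mono) (auto simp: indicator_def)
    also have "\<dots> = emeasure \<sigma> (UNIV \<times> E k)" using C.emeasure_space_1 UE by simp
    also have "\<dots> < \<infinity>" by (rule \<sigma>E)
    finally show "emeasure m2 (A \<times> B) < \<infinity>" .
  qed
  have "m1 = m2"
  proof (rule measure_eqI_generator_eq)
    let ?E = "{A \<times> B | A B. A \<in> sets (boundedly_finite_measures :: 'y measure measure) \<and> B \<in> sets (borel :: 'y measure)}"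
    let ?\<Omega> = "space (boundedly_finite_measures :: 'y measure measure) \<times> space (borel :: 'y measure)"
    show "Int_stable ?E" by (rule Int_stable_pair_measure_generator)
    show "?E \<subseteq> Pow ?\<Omega>" by (rule pair_measure_closed)
    show "sets m1 = sigma_sets ?\<Omega> ?E" "sets m2 = sigma_sets ?\<Omega> ?E" by (simp_all add: sets_pair_measure)
    show "range (\<lambda>k. space (boundedly_finite_measures :: 'y measure measure) \<times> E k) \<subseteq> ?E"
      by (intro image_subsetI CollectI exI conjI) (rule refl, rule sets.top, rule Ek)
    show "(\<Union>k. space (boundedly_finite_measures :: 'y measure measure) \<times> E k) = ?\<Omega>"
      using E(3) by auto
    show "emeasure m1 (space (boundedly_finite_measures :: 'y measure measure) \<times> E k) \<noteq> \<infinity>" for k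
      using rect[OF sets.top Ek order_refl, of k] by (simp add: less_top)
    fix X assume "X \<in> ?E"
    then obtain A B where X: "X = A \<times> B" and AB[measurable]: "A \<in> sets (boundedly_finite_measures :: 'y measure measure)" "B \<in> sets borel" by auto
    have AB': "A \<times> B = (\<Union>k. A \<times> (B \<inter> E k))" using E(3) by auto
    have inc: "incseq (\<lambda>k. A \<times> (B \<inter> E k))" using E(2) by (auto simp: incseq_def)
    have "emeasure m (A \<times> B) = (SUP k. emeasure m (A \<times> (B \<inter> E k)))"
      if "sets m = sets (boundedly_finite_measures \<Otimes>\<^sub>M borel)" for m
      unfolding AB' by (rule SUP_emeasure_incseq[OF _ inc, symmetric]) (auto simp: that)
    then show "emeasure m1 X = emeasure m2 X"
      using rect(1)[OF AB(1), of "B \<inter> E k" k for k] by (simp add: X)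
  qed
  then have "integral\<^sup>N m1 F = integral\<^sup>N m2 F" by simp
  then have "(\<integral>\<^sup>+\<mu>. \<integral>\<^sup>+y. F (\<mu>, y) \<partial>\<mu> \<partial>C) = (\<integral>\<^sup>+x. \<integral>\<^sup>+\<mu>. F (add_atoms h {snd x} \<mu> (\<lambda>_. fst x), snd x) \<partial>C \<partial>\<sigma>)"
    by (simp add: intm1 intm2 F)
  also have "\<dots> = (\<integral>\<^sup>+x. ?h x * (\<integral>\<^sup>+\<mu>. F (add_atoms h {snd x} \<mu> (\<lambda>_. fst x), snd x) \<partial>C) \<partial>intensity \<rho> \<eta>)"
    by (rule int\<sigma>[OF measm2[OF F]])
  also have "\<dots> = (\<integral>\<^sup>+y. \<integral>\<^sup>+s. ennreal (h s) * (\<integral>\<^sup>+\<mu>. F (add_atoms h {y} \<mu> (\<lambda>_. s), y) \<partial>C) \<partial>\<rho> y \<partial>\<eta>)"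
    using nn_integral_intensity[OF borel_measurable_times_ennreal[OF h measm2[OF F]]] by (simp only: fst_conv snd_conv)
  finally show ?thesis .
qed

end

section \<open>Palm formula and posterior laws\<close>

lemma borel_tuples_Suc: "borel_tuples (Suc n) = PiM (insert (Suc n) {1..n}) (\<lambda>_. borel)"
  by (simp add: atLeastAtMostSuc_conv)

lemma measurable_append_tuple [measurable]:
  "(\<lambda>(Y, y). Y(Suc n := y)) \<in> measurable (borel_tuples n \<Otimes>\<^sub>M borel) (borel_tuples (Suc n))"
  unfolding borel_tuples_Suc by (rule measurable_add_dim)

lemma measurable_append_tuple' [measurable (raw)]:
  assumes "Y \<in> measurable M (borel_tuples n)" "y \<in> measurable M borel"
  shows "(\<lambda>x. (Y x)(Suc n := y x)) \<in> measurable M (borel_tuples (Suc n))"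
  using measurable_compose[OF measurable_Pair[OF assms] measurable_append_tuple] by simp

lemma measurable_tuple_component:
  "i \<in> {1..n} \<Longrightarrow> (\<lambda>Y. Y i) \<in> measurable (borel_tuples n) borel"
  by (rule measurable_component_singleton)

lemma measurable_mem_image_tuple:
  assumes "i \<in> {1..n}" "k \<le> n"
  shows "Measurable.pred (borel_tuples n :: (nat \<Rightarrow> 'y::polish_space) measure) (\<lambda>Y. Y i \<in> Y ` {1..k})"
proof -
  have [measurable]: "(\<lambda>Y. Y i) \<in> measurable (borel_tuples n) (borel :: 'y measure)"
    using assms by (auto intro: measurable_tuple_component)
  have "Measurable.pred (borel_tuples n) (\<lambda>Y. Y i = (Y j :: 'y))" if j: "j \<in> {1..k}" for j
  proof -
    have [measurable]: "(\<lambda>Y. Y j) \<in> measurable (borel_tuples n) (borel :: 'y measure)"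
      using assms j by (auto intro: measurable_tuple_component)
    show ?thesis unfolding pred_def by (rule measurable_equality_set) measurable
  qed
  then have "Measurable.pred (borel_tuples n) (\<lambda>Y. \<exists>j\<in>{1..k}. Y i = (Y j :: 'y))"
    by (intro pred_intros_finite) auto
  then show ?thesis by (simp add: image_iff)
qed

text \<open>The set of values depends on \<open>Y\<close> and counts ties once, so the sum is built
  up coordinate by coordinate, with a measurable test whether the next value is already
  present.\<close>

lemma sum_tuple_image_measurable:
  fixes G :: "(nat \<Rightarrow> 'y::polish_space) \<times> 'y \<Rightarrow> ennreal"
  assumes G: "G \<in> borel_measurable (borel_tuples n \<Otimes>\<^sub>M borel)" and "k \<le> n"
  shows "(\<lambda>Y. \<Sum>u\<in>Y ` {1..k}. G (Y, u)) \<in> borel_measurable (borel_tuples n)"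
  using \<open>k \<le> n\<close>
proof (induction k)
  case (Suc k)
  have [measurable]: "(\<lambda>Y. Y (Suc k)) \<in> measurable (borel_tuples n) (borel :: 'y measure)"
    using Suc by (intro measurable_tuple_component) auto
  have [measurable]: "(\<lambda>Y. G (Y, Y (Suc k))) \<in> borel_measurable (borel_tuples n)"
    by (rule measurable_compose[OF _ G]) measurable
  have [measurable]: "Measurable.pred (borel_tuples n) (\<lambda>Y :: nat \<Rightarrow> 'y. Y (Suc k) \<in> Y ` {1..k})"
    using Suc by (intro measurable_mem_image_tuple) auto
  have [measurable]: "(\<lambda>Y. \<Sum>u\<in>Y ` {1..k}. G (Y, u)) \<in> borel_measurable (borel_tuples n)"
    using Suc by simp
  have "(\<lambda>Y. (\<Sum>u\<in>Y ` {1..k}. G (Y, u)) + (if Y (Suc k) \<in> Y ` {1..k} then 0 else G (Y, Y (Suc k)))) \<in> borel_measurable (borel_tuples n)"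
    by measurable
  also have "(\<lambda>Y. (\<Sum>u\<in>Y ` {1..k}. G (Y, u)) + (if Y (Suc k) \<in> Y ` {1..k} then 0 else G (Y, Y (Suc k)))) =
     (\<lambda>Y. \<Sum>u\<in>Y ` {1..Suc k}. G (Y, u))"
    by (auto simp: atLeastAtMostSuc_conv insert_absorb add.commute)
  finally show ?case .
qed simp

text \<open>The measure that lets each new coordinate be either \<open>\<eta>\<close>-distributed or equal to one of the
  previous values: the reference measure \<open>\<Prod>\<^sub>j \<eta>(dY\<^sub>j\<^sup>*)\<close>, summed over the partitions.\<close>

primrec tuple_measure :: "'y::topological_space measure \<Rightarrow> nat \<Rightarrow> (nat \<Rightarrow> 'y) measure" where
  "tuple_measure \<eta> 0 = return (borel_tuples 0) (\<lambda>_. undefined)"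
| "tuple_measure \<eta> (Suc n) =
     distr (kernel_prod (tuple_measure \<eta> n) borel (\<lambda>Y. add_atoms (\<lambda>_. 1) (Y ` {1..n}) \<eta> (\<lambda>_. ())))
       (borel_tuples (Suc n)) (\<lambda>(Y, y). Y(Suc n := y))"

lemma sets_tuple_measure [simp, measurable_cong]: "sets (tuple_measure \<eta> n) = sets (borel_tuples n)"
  by (cases n) simp_all

lemma space_tuple_measure [simp]: "space (tuple_measure \<eta> n) = space (borel_tuples n)"
  by (rule sets_eq_imp_space_eq) simp

lemma nn_integral_tuple_measure_Suc:
  fixes \<eta> :: "'y::polish_space measure"
  assumes \<eta>: "sets \<eta> = sets borel" "sigma_finite_measure \<eta>"
    and G: "G \<in> borel_measurable (borel_tuples (Suc n))"
  shows "integral\<^sup>N (tuple_measure \<eta> (Suc n)) G =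
    (\<integral>\<^sup>+Y. (\<integral>\<^sup>+y. G (Y(Suc n := y)) \<partial>\<eta>) + (\<Sum>u\<in>Y ` {1..n}. G (Y(Suc n := u))) \<partial>tuple_measure \<eta> n)"
proof -
  interpret sigma_finite_measure \<eta> by fact
  let ?K = "\<lambda>Y. add_atoms (\<lambda>_. 1) (Y ` {1..n}) \<eta> (\<lambda>_. ())"
  have int: "(\<integral>\<^sup>+y. f (Y, y) \<partial>?K Y) = (\<integral>\<^sup>+y. f (Y, y) \<partial>\<eta>) + (\<Sum>u\<in>Y ` {1..n}. f (Y, u))"
    if f: "f \<in> borel_measurable (borel_tuples n \<Otimes>\<^sub>M borel)" and Y: "Y \<in> space (borel_tuples n)"
    for f :: "(nat \<Rightarrow> 'y) \<times> 'y \<Rightarrow> ennreal" and Y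
    using measurable_compose[OF measurable_Pair1'[OF Y] f] \<eta> by (subst nn_integral_add_atoms) auto
  have sb: "borel_measurable (tuple_measure \<eta> n \<Otimes>\<^sub>M borel) = (borel_measurable (borel_tuples n \<Otimes>\<^sub>M borel) :: (_ \<Rightarrow> ennreal) set)"
    by (intro measurable_cong_sets sets_pair_measure_cong) simp_all
  have s\<eta>: "borel_measurable (borel_tuples n \<Otimes>\<^sub>M borel) = (borel_measurable (borel_tuples n \<Otimes>\<^sub>M \<eta>) :: (_ \<Rightarrow> ennreal) set)"
    by (intro measurable_cong_sets sets_pair_measure_cong) (simp_all add: \<eta>)
  have app: "(\<lambda>(Y, y). Y(Suc n := y)) \<in> measurable (kernel_prod (tuple_measure \<eta> n) borel ?K) (borel_tuples (Suc n))"
    using measurable_append_tuple[of n]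
    by (subst measurable_cong_sets[OF _ refl, of _ "borel_tuples n \<Otimes>\<^sub>M borel"]) (simp_all cong: sets_pair_measure_cong)
  have Gm: "(\<lambda>z. G (case z of (Y, y) \<Rightarrow> Y(Suc n := y))) \<in> borel_measurable (borel_tuples n \<Otimes>\<^sub>M borel)"
    by (rule measurable_compose[OF measurable_append_tuple G])
  have "integral\<^sup>N (tuple_measure \<eta> (Suc n)) G = (\<integral>\<^sup>+z. G (case z of (Y, y) \<Rightarrow> Y(Suc n := y)) \<partial>kernel_prod (tuple_measure \<eta> n) borel ?K)"
    unfolding tuple_measure.simps using G by (intro nn_integral_distr[OF app]) (simp only: measurable_distr_eq1)
  also have "\<dots> = (\<integral>\<^sup>+Y. \<integral>\<^sup>+y. G (case (Y, y) of (Y, y) \<Rightarrow> Y(Suc n := y)) \<partial>?K Y \<partial>tuple_measure \<eta> n)"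
  proof (rule nn_integral_kernel_prod)
    show "(\<lambda>z. G (case z of (Y, y) \<Rightarrow> Y(Suc n := y))) \<in> borel_measurable (tuple_measure \<eta> n \<Otimes>\<^sub>M borel)"
      unfolding sb by (rule Gm)
    fix f :: "(nat \<Rightarrow> 'y) \<times> 'y \<Rightarrow> ennreal" assume "f \<in> borel_measurable (tuple_measure \<eta> n \<Otimes>\<^sub>M borel)"
    then have f: "f \<in> borel_measurable (borel_tuples n \<Otimes>\<^sub>M borel)" unfolding sb .
    have "(\<lambda>Y. (\<integral>\<^sup>+y. f (Y, y) \<partial>\<eta>) + (\<Sum>u\<in>Y ` {1..n}. f (Y, u))) \<in> borel_measurable (borel_tuples n)"
      using f unfolding s\<eta> by (intro borel_measurable_add borel_measurable_nn_integral_fst sum_tuple_image_measurable[OF f]) auto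
    then have "(\<lambda>Y. \<integral>\<^sup>+y. f (Y, y) \<partial>?K Y) \<in> borel_measurable (borel_tuples n)"
      by (subst measurable_cong[OF int[OF f]])
    then show "(\<lambda>Y. \<integral>\<^sup>+y. f (Y, y) \<partial>?K Y) \<in> borel_measurable (tuple_measure \<eta> n)"
      by (simp cong: measurable_cong_sets)
  qed simp
  also have "\<dots> = (\<integral>\<^sup>+Y. (\<integral>\<^sup>+y. G (Y(Suc n := y)) \<partial>\<eta>) + (\<Sum>u\<in>Y ` {1..n}. G (Y(Suc n := u))) \<partial>tuple_measure \<eta> n)"
    using int[OF Gm] by (intro nn_integral_cong) simp
  finally show ?thesis .
qed

lemma boundedly_finite_sigma_finite:
  fixes \<mu> :: "'y::metric_space measure"
  assumes "boundedly_finite \<mu>" shows "sigma_finite_measure \<mu>"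
proof
  obtain a :: 'y where True by simp
  have s: "sets \<mu> = sets borel" using assms by (simp add: boundedly_finite_def)
  show "\<exists>A. countable A \<and> A \<subseteq> sets \<mu> \<and> \<Union>A = space \<mu> \<and> (\<forall>b\<in>A. emeasure \<mu> b \<noteq> \<infinity>)"
    using assms sets_eq_imp_space_eq[OF s]
    by (intro exI[of _ "range (\<lambda>k::nat. ball a (real k))"]) (simp add: s UN_ball_nat boundedly_finite_def image_subset_iff less_top)
qed

section \<open>Powers of a measure, and the blocks of a tuple\<close>

lemma sets_power_measure: "sets \<mu> = sets borel \<Longrightarrow> sets (power_measure n \<mu>) = sets (borel_tuples n)"
  unfolding power_measure_def by (intro sets_PiM_cong) auto

lemma nn_integral_power_measure_0: "integral\<^sup>N (power_measure 0 \<mu>) G = G (\<lambda>_. undefined)"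
  by (simp add: power_measure_def PiM_empty nn_integral_count_space_finite)

lemma nn_integral_power_measure_Suc:
  fixes \<mu> :: "'y::metric_space measure"
  assumes \<mu>: "boundedly_finite \<mu>" and G: "G \<in> borel_measurable (borel_tuples (Suc n))"
  shows "integral\<^sup>N (power_measure (Suc n) \<mu>) G = (\<integral>\<^sup>+Y. \<integral>\<^sup>+y. G (Y(Suc n := y)) \<partial>\<mu> \<partial>power_measure n \<mu>)"
proof -
  interpret product_sigma_finite "\<lambda>_ :: nat. \<mu>"
    using boundedly_finite_sigma_finite[OF \<mu>] by (intro product_sigma_finite.intro)
  have s: "sets \<mu> = sets borel" using \<mu> by (simp add: boundedly_finite_def)
  have "G \<in> borel_measurable (PiM (insert (Suc n) {1..n}) (\<lambda>_. \<mu>))"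
    using G sets_power_measure[OF s, of "Suc n"]
    by (simp add: power_measure_def atLeastAtMostSuc_conv cong: measurable_cong_sets)
  then show ?thesis
    unfolding power_measure_def by (simp add: atLeastAtMostSuc_conv product_nn_integral_insert)
qed

text \<open>The last coordinate is integrated out first: the inner integral is again a measurable
  function of the measure and the shorter tuple.\<close>

lemma measurable_nn_integral_power_measure:
  fixes G :: "'y::polish_space measure \<times> (nat \<Rightarrow> 'y) \<Rightarrow> ennreal"
  assumes "G \<in> borel_measurable (boundedly_finite_measures \<Otimes>\<^sub>M borel_tuples n)"
  shows "(\<lambda>\<mu>. \<integral>\<^sup>+Y. G (\<mu>, Y) \<partial>power_measure n \<mu>) \<in> borel_measurable boundedly_finite_measures"
  using assms
proof (induction n arbitrary: G)
  case 0
  have "(\<lambda>_. undefined) \<in> space (borel_tuples 0 :: (nat \<Rightarrow> 'y) measure)" by (simp add: space_PiM)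
  then show ?case unfolding nn_integral_power_measure_0
    by (intro measurable_compose[OF measurable_Pair2' 0])
next
  case (Suc n)
  have m: "(\<lambda>x. G (fst (fst x), (snd (fst x))(Suc n := snd x))) \<in> borel_measurable ((boundedly_finite_measures \<Otimes>\<^sub>M borel_tuples n) \<Otimes>\<^sub>M borel)"
    by (rule measurable_compose[OF _ Suc.prems]) measurable
  have "(\<lambda>z. \<integral>\<^sup>+y. G (fst z, (snd z)(Suc n := y)) \<partial>fst z) \<in> borel_measurable (boundedly_finite_measures \<Otimes>\<^sub>M borel_tuples n)"
    using measurable_nn_integral_boundedly_finite[OF measurable_fst m] by simp
  from Suc.IH[OF this]
  have *: "(\<lambda>\<mu>. \<integral>\<^sup>+Y. \<integral>\<^sup>+y. G (\<mu>, Y(Suc n := y)) \<partial>\<mu> \<partial>power_measure n \<mu>) \<in> borel_measurable boundedly_finite_measures"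
    by simp
  have "(\<integral>\<^sup>+Y. G (\<mu>, Y) \<partial>power_measure (Suc n) \<mu>) = (\<integral>\<^sup>+Y. \<integral>\<^sup>+y. G (\<mu>, Y(Suc n := y)) \<partial>\<mu> \<partial>power_measure n \<mu>)"
    if "\<mu> \<in> space boundedly_finite_measures" for \<mu>
    using that measurable_compose[OF measurable_Pair1'[OF that] Suc.prems]
    by (intro nn_integral_power_measure_Suc) auto
  then show ?case by (subst measurable_cong) (assumption, rule *)
qed

lemma card_block_append:
  "card (block (Suc n) (Y(Suc n := y)) v) = card (block n Y v) + (if v = y then 1 else 0)"
proof -
  have "block (Suc n) (Y(Suc n := y)) v = block n Y v \<union> (if v = y then {Suc n} else {})"
    by (auto simp: block_def le_Suc_eq)
  then show ?thesis by (auto simp: block_def card_insert_if)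
qed

lemma card_block_pos: "v \<in> Y ` {1..n} \<Longrightarrow> 1 \<le> card (block n Y v)"
  by (auto simp: block_def card_gt_0_iff Suc_le_eq)

lemma card_block_notin: "v \<notin> Y ` {1..n} \<Longrightarrow> card (block n Y v) = 0"
  by (auto simp: block_def)

lemma measurable_card_block:
  assumes "i \<in> {1..n}"
  shows "(\<lambda>Y. card (block n Y (Y i))) \<in> measurable (borel_tuples n :: (nat \<Rightarrow> 'y::polish_space) measure) (count_space UNIV)"
proof (rule measurable_card)
  fix j :: nat
  show "{Y \<in> space (borel_tuples n :: (nat \<Rightarrow> 'y) measure). j \<in> block n Y (Y i)} \<in> sets (borel_tuples n)"
  proof (cases "j \<in> {1..n}")
    case True
    have [measurable]: "(\<lambda>Y. Y j) \<in> measurable (borel_tuples n) (borel :: 'y measure)"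
       "(\<lambda>Y. Y i) \<in> measurable (borel_tuples n) (borel :: 'y measure)"
      using assms True by (auto intro: measurable_tuple_component)
    have "{Y \<in> space (borel_tuples n :: (nat \<Rightarrow> 'y) measure). Y j = Y i} \<in> sets (borel_tuples n)"
      by measurable
    then show ?thesis using True by (simp add: block_def)
  next
    case False
    then have "{Y \<in> space (borel_tuples n :: (nat \<Rightarrow> 'y) measure). j \<in> block n Y (Y i)} = {}"
      unfolding block_def by blast
    then show ?thesis by (simp only: sets.empty_sets)
  qed
qed

text \<open>Measurability of the kernel and finiteness of \<open>kappa\<close> hold here at every
  point, so that posterior laws form a kernel in \<open>Y\<close>. The exponent starts at
  \<open>1\<close> because \<open>kappa h 0 \<rho> y\<close> is the total mass of
  \<open>\<rho> y\<close>, possibly infinite. Non-atomicity enters as nullity of points.\<close>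

locale crm_kappa = crm \<eta> \<rho> h \<Omega> N
  for \<eta> :: "'y::polish_space measure" and \<rho> :: "'y \<Rightarrow> 's::polish_space measure" and h :: "'s \<Rightarrow> real"
    and \<Omega> :: "'w measure" and N :: "'w \<Rightarrow> ('s \<times> 'y) measure" +
  assumes rho_measurable: "\<And>A. A \<in> sets borel \<Longrightarrow> (\<lambda>y. emeasure (\<rho> y) A) \<in> borel_measurable borel"
    and kappa_finite: "\<And>n y. 1 \<le> n \<Longrightarrow> kappa h n \<rho> y < \<infinity>"
    and diffuse: "\<And>y. emeasure \<eta> {y} = 0"
begin

text \<open>\<open>jump_law\<close> without its normalisation. A further factor \<open>h\<close>
  raises \<open>e\<close> by one, which is how a repeated value enlarges its block.\<close>

definition jump_measure :: "nat \<Rightarrow> 'y \<Rightarrow> 's measure" where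
  "jump_measure e v = density (\<rho> v) (\<lambda>s. ennreal (h s ^ e))"

lemma sets_jump_measure [simp, measurable_cong]: "sets (jump_measure e v) = sets borel"
  by (simp add: jump_measure_def sets_rho)

lemma space_jump_measure [simp]: "space (jump_measure e v) = UNIV"
  using sets_eq_imp_space_eq[OF sets_jump_measure] by simp

lemma nn_integral_jump_measure:
  assumes [measurable]: "g \<in> borel_measurable borel"
  shows "integral\<^sup>N (jump_measure e v) g = (\<integral>\<^sup>+s. ennreal (h s ^ e) * g s \<partial>\<rho> v)"
proof -
  note [measurable_cong] = sets_rho
  show ?thesis unfolding jump_measure_def by (rule nn_integral_density) measurable
qed

lemma emeasure_jump_measure_UNIV: "emeasure (jump_measure e v) UNIV = kappa h e \<rho> v"
  using nn_integral_jump_measure[of "\<lambda>_. 1" e v] by (simp add: kappa_def)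

lemma rho_kernel [measurable]: "\<rho> \<in> measurable borel borel_measures"
  using sets_rho rho_measurable by (intro measurable_measures_algebra) auto

lemma borel_measurable_nn_integral_rho:
  "g \<in> borel_measurable borel \<Longrightarrow> (\<lambda>v. integral\<^sup>N (\<rho> v) g) \<in> borel_measurable borel"
  by (rule measurable_compose[OF rho_kernel measurable_nn_integral_measures_algebra]) auto

lemma kappa_measurable [measurable]: "kappa h e \<rho> \<in> borel_measurable borel"
  unfolding kappa_def by (rule borel_measurable_nn_integral_rho) measurable

lemma sigma_finite_rho: "sigma_finite_measure (\<rho> v)"
proof
  have "(\<integral>\<^sup>+s. ennreal (min (h s) 1) \<partial>\<rho> v) \<le> kappa h 1 \<rho> v"
    unfolding kappa_def by (intro nn_integral_mono ennreal_leI) simp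
  also have "\<dots> < \<infinity>" using kappa_finite[of 1] by simp
  finally have "emeasure (\<rho> v) (cover k) < \<infinity>" for k
    by (rule emeasure_cover_finite[OF sets_rho])
  then show "\<exists>A. countable A \<and> A \<subseteq> sets (\<rho> v) \<and> \<Union>A = space (\<rho> v) \<and> (\<forall>a\<in>A. emeasure (\<rho> v) a \<noteq> \<infinity>)"
    using sets_eq_imp_space_eq[OF sets_rho[of v]]
    by (intro exI[of _ "range cover"]) (simp add: UN_cover image_subset_iff sets_rho less_top)
qed

text \<open>The product theory speaks of all \<open>v\<close>. Off the values of a tuple the block
  is empty and the exponent is \<open>0\<close>, where the jump measure is \<open>\<rho> v\<close>
  itself and sigma-finite only.\<close>

lemma product_sigma_finite_jump_measure: "product_sigma_finite (\<lambda>v. jump_measure (c v) v)"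
proof (rule product_sigma_finite.intro)
  fix v
  interpret sigma_finite_measure "\<rho> v" by (rule sigma_finite_rho)
  note [measurable_cong] = sets_rho
  show "sigma_finite_measure (jump_measure (c v) v)"
    unfolding jump_measure_def by (subst sigma_finite_iff_density_finite) auto
qed

lemma sets_PiM_jump_measure: "sets (PiM V (\<lambda>v. jump_measure (c v) v)) = sets (PiM V (\<lambda>_. borel))"
  by (intro sets_PiM_cong) auto

lemma emeasure_jump_measure_measurable:
  assumes "A \<in> sets borel"
  shows "(\<lambda>v. emeasure (jump_measure e v) A) \<in> borel_measurable borel"
proof -
  have "emeasure (jump_measure e v) A = (\<integral>\<^sup>+s. ennreal (h s ^ e) * indicator A s \<partial>\<rho> v)" for v
    using assms by (subst nn_integral_jump_measure[symmetric]) simp_all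
  moreover have "(\<lambda>v. \<integral>\<^sup>+s. ennreal (h s ^ e) * indicator A s \<partial>\<rho> v) \<in> borel_measurable borel"
    by (rule borel_measurable_nn_integral_rho) (use assms in measurable)
  ultimately show ?thesis by simp
qed

lemma mecke:
  assumes F: "F \<in> borel_measurable (boundedly_finite_measures \<Otimes>\<^sub>M borel)"
  shows "(\<integral>\<^sup>+\<mu>. \<integral>\<^sup>+y. F (\<mu>, y) \<partial>\<mu> \<partial>C) =
    (\<integral>\<^sup>+y. \<integral>\<^sup>+s. ennreal (h s) * (\<integral>\<^sup>+\<mu>. F (add_atoms h {y} \<mu> (\<lambda>_. s), y) \<partial>C) \<partial>\<rho> y \<partial>\<eta>)"
proof -
  obtain H where H: "range H \<subseteq> sets \<eta>" "incseq H" "(\<Union>k. H k) = space \<eta>" "\<And>k. emeasure \<eta> (H k) < \<infinity>"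
    using sigma_finite_cover_nat[OF sigma_finite_eta] by metis
  have Hk[measurable]: "H k \<in> sets borel" for k using H(1) by (auto simp: sets_eta)
  have k1: "kappa h 1 \<rho> y < \<infinity>" for y using kappa_finite[of 1] by simp
  \<comment> \<open>Bounding \<open>kappa h 1\<close> by \<open>k\<close> on a set of finite
    \<open>\<eta>\<close>-mass keeps the first moment over \<open>E k\<close> below
    \<open>k * \<eta>(H k)\<close>; these sets exhaust the space since \<open>kappa h 1\<close> is
    finite everywhere.\<close>
  define E where "E = (\<lambda>k. H k \<inter> {y. kappa h 1 \<rho> y \<le> of_nat k})"
  have Ek[measurable]: "E k \<in> sets borel" for k unfolding E_def by measurable
  show ?thesis
  proof (rule nn_integral_mecke[OF _ _ _ _ F])
    show "range E \<subseteq> sets borel" using Ek by auto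
    show "incseq E"
    proof (rule incseq_SucI)
      fix k
      have "of_nat k \<le> (of_nat (Suc k) :: ennreal)" by (simp add: of_nat_mono)
      then show "E k \<subseteq> E (Suc k)"
        using incseqD[OF H(2), of k "Suc k"] unfolding E_def by (auto intro: order_trans)
    qed
    have "\<exists>k. y \<in> E k" for y
    proof -
      obtain i where i: "y \<in> H i" using H(3) sets_eq_imp_space_eq[OF sets_eta] by auto
      obtain j :: nat where j: "kappa h 1 \<rho> y \<le> of_nat j"
        using k1[of y] by (metis ennreal_of_nat_eq_real_of_nat ennreal_cases infinity_ennreal_def ennreal_leI less_irrefl real_arch_simple)
      have "of_nat j \<le> (of_nat (max i j) :: ennreal)" by (simp add: of_nat_mono)
      then have "y \<in> E (max i j)"
        using i j incseqD[OF H(2), of i "max i j"] by (auto simp: E_def intro: order_trans)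
      then show ?thesis ..
    qed
    then show "(\<Union>k. E k) = UNIV" by auto
    fix k
    have "(\<integral>\<^sup>+x. ennreal (h (fst x)) * indicator (E k) (snd x) \<partial>intensity \<rho> \<eta>) =
       (\<integral>\<^sup>+y. \<integral>\<^sup>+s. ennreal (h s) * indicator (E k) y \<partial>\<rho> y \<partial>\<eta>)"
      by (subst nn_integral_intensity[OF measurable_hN]) auto
    also have "\<dots> = (\<integral>\<^sup>+y. kappa h 1 \<rho> y * indicator (E k) y \<partial>\<eta>)"
      unfolding kappa_def power_one_right
      by (intro nn_integral_cong nn_integral_multc) (simp cong: measurable_cong_sets add: sets_rho)
    also have "\<dots> \<le> (\<integral>\<^sup>+y. of_nat k * indicator (H k) y \<partial>\<eta>)"
      by (intro nn_integral_mono) (auto simp: E_def indicator_def)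
    also have "\<dots> = of_nat k * emeasure \<eta> (H k)" by (simp add: nn_integral_cmult_indicator)
    also have "\<dots> < \<infinity>" using H(4)[of k] by (simp add: ennreal_mult_less_top of_nat_less_top)
    finally show "(\<integral>\<^sup>+x. ennreal (h (fst x)) * indicator (E k) (snd x) \<partial>intensity \<rho> \<eta>) < \<infinity>" .
  qed
qed

text \<open>\<open>atoms_integral n F i \<mu> Y\<close> integrates out the jumps at the values among the first \<open>i\<close> coordinates.
  Processing the coordinates one at a time gives measurability in \<open>Y\<close>, although the index set of the
  product measure depends on \<open>Y\<close>.\<close>

definition atoms_integral ::
  "nat \<Rightarrow> ('y measure \<times> (nat \<Rightarrow> 'y) \<Rightarrow> ennreal) \<Rightarrow> nat \<Rightarrow> 'y measure \<Rightarrow> (nat \<Rightarrow> 'y) \<Rightarrow> ennreal" where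
  "atoms_integral n F i \<mu> Y =
    (\<integral>\<^sup>+J. F (add_atoms h (Y ` {1..i}) \<mu> J, Y) \<partial>PiM (Y ` {1..i}) (\<lambda>v. jump_measure (card (block n Y v)) v))"

lemma measurable_add_atoms_section:
  assumes F: "F \<in> borel_measurable (boundedly_finite_measures \<Otimes>\<^sub>M M)"
    and \<mu>: "boundedly_finite \<mu>" and V: "finite V" and Y: "Y \<in> space M"
  shows "(\<lambda>J. F (add_atoms h V \<mu> J, Y)) \<in> borel_measurable (PiM V (\<lambda>v. jump_measure (c v) v))"
proof -
  have "(\<lambda>J. add_atoms h V \<mu> J) \<in> measurable (PiM V (\<lambda>_. borel)) boundedly_finite_measures"
    using \<mu> V by (intro measurable_add_atoms) (auto intro: measurable_component_singleton)
  then have "(\<lambda>J. F (add_atoms h V \<mu> J, Y)) \<in> borel_measurable (PiM V (\<lambda>_. borel))"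
    using Y by (intro measurable_compose[OF measurable_Pair F]) auto
  then show ?thesis unfolding measurable_cong_sets[OF sets_PiM_jump_measure refl] .
qed

lemma atoms_integral_0: "boundedly_finite \<mu> \<Longrightarrow> atoms_integral n F 0 \<mu> Y = F (\<mu>, Y)"
  by (simp add: atoms_integral_def PiM_empty nn_integral_count_space_finite add_atoms_empty boundedly_finite_def)

lemma atoms_integral_Suc_old:
  assumes "Y (Suc i) \<in> Y ` {1..i}"
  shows "atoms_integral n F (Suc i) \<mu> Y = atoms_integral n F i \<mu> Y"
  using assms by (simp only: atoms_integral_def atLeastAtMostSuc_conv[of 1 i] image_insert insert_absorb le_add2 plus_1_eq_Suc)

text \<open>Fubini splits off the jump at the fresh value, and its atom is moved into the base
  measure, leaving an integral over the earlier values.\<close>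

lemma atoms_integral_Suc_new:
  assumes F: "F \<in> borel_measurable (boundedly_finite_measures \<Otimes>\<^sub>M borel_tuples n)"
    and \<mu>: "boundedly_finite \<mu>" and Y: "Y \<in> space (borel_tuples n)" and new: "Y (Suc i) \<notin> Y ` {1..i}"
  shows "atoms_integral n F (Suc i) \<mu> Y =
    (\<integral>\<^sup>+s. atoms_integral n F i (add_atoms h {Y (Suc i)} \<mu> (\<lambda>_. s)) Y
       \<partial>jump_measure (card (block n Y (Y (Suc i)))) (Y (Suc i)))"
proof -
  let ?V = "Y ` {1..i}" and ?y = "Y (Suc i)"
  interpret product_sigma_finite "\<lambda>v. jump_measure (card (block n Y v)) v"
    by (rule product_sigma_finite_jump_measure)
  have img: "Y ` {1..Suc i} = insert ?y ?V" by (simp add: atLeastAtMostSuc_conv)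
  have s: "sets \<mu> = sets borel" using \<mu> by (simp add: boundedly_finite_def)
  have "atoms_integral n F (Suc i) \<mu> Y =
    (\<integral>\<^sup>+s. \<integral>\<^sup>+J. F (add_atoms h (insert ?y ?V) \<mu> (J(?y := s)), Y) \<partial>PiM ?V (\<lambda>v. jump_measure (card (block n Y v)) v)
       \<partial>jump_measure (card (block n Y ?y)) ?y)"
    unfolding atoms_integral_def img
    using new by (intro product_nn_integral_insert_rev measurable_add_atoms_section[OF F \<mu> _ Y]) auto
  then show ?thesis
    unfolding atoms_integral_def using new by (simp add: add_atoms_insert[OF s])
qed

lemma measurable_atoms_integral:
  assumes F: "F \<in> borel_measurable (boundedly_finite_measures \<Otimes>\<^sub>M borel_tuples n)" and "i \<le> n"
  shows "(\<lambda>z. atoms_integral n F i (fst z) (snd z)) \<in> borel_measurable (boundedly_finite_measures \<Otimes>\<^sub>M borel_tuples n)"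
  using \<open>i \<le> n\<close>
proof (induction i)
  case 0
  show ?case by (subst measurable_cong[where g = F]) (use F in \<open>auto simp: atoms_integral_0 space_pair_measure\<close>)
next
  case (Suc i)
  let ?M = "boundedly_finite_measures \<Otimes>\<^sub>M (borel_tuples n :: (nat \<Rightarrow> 'y) measure)"
  have IH: "(\<lambda>z. atoms_integral n F i (fst z) (snd z)) \<in> borel_measurable ?M" using Suc by simp
  have yi: "(\<lambda>Y. Y (Suc i)) \<in> measurable (borel_tuples n) (borel :: 'y measure)"
    using Suc by (intro measurable_tuple_component) auto
  have y[measurable]: "(\<lambda>z. snd z (Suc i)) \<in> measurable ?M borel"
    by (rule measurable_compose[OF measurable_snd yi])
  have [measurable]: "Measurable.pred ?M (\<lambda>z. snd z (Suc i) \<in> snd z ` {1..i})"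
    using Suc by (intro measurable_compose[OF measurable_snd measurable_mem_image_tuple]) auto
  have c: "(\<lambda>z. card (block n (snd z) (snd z (Suc i)))) \<in> measurable ?M (count_space UNIV)"
    using Suc by (intro measurable_compose[OF measurable_snd measurable_card_block]) auto
  let ?K = "\<lambda>z. jump_measure (card (block n (snd z) (snd z (Suc i)))) (snd z (Suc i))"
  let ?G = "\<lambda>(z, s). atoms_integral n F i (add_atoms h {snd z (Suc i)} (fst z) (\<lambda>_. s)) (snd z)"
  have Gm: "?G \<in> borel_measurable (?M \<Otimes>\<^sub>M borel)"
  proof -
    have y': "(\<lambda>x. snd (fst x) (Suc i)) \<in> measurable (?M \<Otimes>\<^sub>M (borel :: 's measure)) borel"
      by (rule measurable_compose[OF measurable_fst y])
    have "(\<lambda>x. add_atoms h {snd (fst x) (Suc i)} (fst (fst x)) (\<lambda>_. snd x)) \<in> measurable (?M \<Otimes>\<^sub>M borel) boundedly_finite_measures"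
      using y' by (intro measurable_add_atom) measurable
    then have "(\<lambda>x. (add_atoms h {snd (fst x) (Suc i)} (fst (fst x)) (\<lambda>_. snd x), snd (fst x))) \<in> measurable (?M \<Otimes>\<^sub>M borel) ?M"
      by (rule measurable_Pair) (rule measurable_compose[OF measurable_fst measurable_snd])
    from measurable_compose[OF this IH] show ?thesis by (simp add: case_prod_unfold)
  qed
  have "(\<lambda>z. \<integral>\<^sup>+s. ?G (z, s) \<partial>?K z) \<in> borel_measurable ?M"
  proof (rule measurable_nn_integral_kernel[where D = "\<lambda>_. UNIV", OF _ _ _ _ _ _ Gm])
    fix A :: "'s set" assume A: "A \<in> sets borel"
    show "(\<lambda>z. emeasure (?K z) A) \<in> borel_measurable ?M"
      by (rule measurable_compose_countable[OF _ c])
        (rule measurable_compose[OF y emeasure_jump_measure_measurable[OF A]])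
  next
    fix z :: "'y measure \<times> (nat \<Rightarrow> 'y)"
    \<comment> \<open>Coordinate \<open>i + 1\<close> lies in its own block, so the exponent is at
      least \<open>1\<close>, the range in which \<open>kappa\<close> is finite.\<close>
    have "1 \<le> card (block n (snd z) (snd z (Suc i)))"
      using Suc by (intro card_block_pos) auto
    then show "emeasure (?K z) UNIV < \<infinity>"
      unfolding emeasure_jump_measure_UNIV by (rule kappa_finite)
  qed (auto simp: incseq_def)
  then have "(\<lambda>z. if snd z (Suc i) \<in> snd z ` {1..i} then atoms_integral n F i (fst z) (snd z)
      else \<integral>\<^sup>+s. ?G (z, s) \<partial>?K z) \<in> borel_measurable ?M"
    using IH by measurable
  then show ?case
    by (rule measurable_cong[THEN iffD2, rotated])
      (auto simp: atoms_integral_Suc_old atoms_integral_Suc_new[OF F] space_pair_measure)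
qed

lemma measurable_C_atoms_integral:
  assumes F: "F \<in> borel_measurable (boundedly_finite_measures \<Otimes>\<^sub>M borel_tuples n)"
  shows "(\<lambda>Y. \<integral>\<^sup>+\<mu>. atoms_integral n F n \<mu> Y \<partial>C) \<in> borel_measurable (borel_tuples n)"
proof -
  interpret C: prob_space C by (rule prob_space_C)
  have sb: "borel_measurable (borel_tuples n \<Otimes>\<^sub>M C) = (borel_measurable (borel_tuples n \<Otimes>\<^sub>M boundedly_finite_measures) :: (_ \<Rightarrow> ennreal) set)"
    by (intro measurable_cong_sets sets_pair_measure_cong) simp_all
  have "(\<lambda>(Y, \<mu>). atoms_integral n F n \<mu> Y) \<in> borel_measurable (borel_tuples n \<Otimes>\<^sub>M C)"
    unfolding sb using measurable_pair_swap[OF measurable_atoms_integral[OF F order_refl]] by simp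
  from C.borel_measurable_nn_integral_fst[OF this] show ?thesis by simp
qed

text \<open>Size biasing: the weight \<open>h (J u)\<close> is absorbed into the density of the
  factor at \<open>u\<close>. It accounts for drawing the value \<open>u\<close> once more.\<close>

lemma nn_integral_PiM_jump_measure_upd:
  assumes V: "finite V" "u \<in> V" and G: "G \<in> borel_measurable (PiM V (\<lambda>_. borel))"
  shows "(\<integral>\<^sup>+J. ennreal (h (J u)) * G J \<partial>PiM V (\<lambda>v. jump_measure (c v) v)) =
    (\<integral>\<^sup>+J. G J \<partial>PiM V (\<lambda>v. jump_measure (c v + (if v = u then 1 else 0)) v))"
proof -
  interpret A: product_sigma_finite "\<lambda>v. jump_measure (c v) v" by (rule product_sigma_finite_jump_measure)
  interpret B: product_sigma_finite "\<lambda>v. jump_measure (c v + (if v = u then 1 else 0)) v"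
    by (rule product_sigma_finite_jump_measure)
  define V' where "V' = V - {u}"
  have V': "V = insert u V'" "finite V'" "u \<notin> V'" using V by (auto simp: V'_def)
  have Ju: "(\<lambda>J. J u) \<in> measurable (PiM V (\<lambda>_. borel)) (borel :: 's measure)"
    using V by (intro measurable_component_singleton)
  have hG: "(\<lambda>J. ennreal (h (J u)) * G J) \<in> borel_measurable (PiM V (\<lambda>_. borel))"
    using measurable_compose[OF Ju h_measurable] G by measurable
  have upd: "(\<lambda>s. G (J(u := s))) \<in> borel_measurable borel" if "J \<in> space (PiM V' (\<lambda>_. borel))" for J
  proof -
    have "(\<lambda>(f, y). f(u := y)) \<in> measurable (PiM V' (\<lambda>_. borel) \<Otimes>\<^sub>M borel) (PiM V (\<lambda>_. borel :: 's measure))"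
      unfolding V'(1) by (rule measurable_add_dim)
    from measurable_compose[OF measurable_Pair1'[OF that] measurable_compose[OF this G]]
    show ?thesis by simp
  qed
  have "(\<integral>\<^sup>+J. ennreal (h (J u)) * G J \<partial>PiM V (\<lambda>v. jump_measure (c v) v)) =
      (\<integral>\<^sup>+J. \<integral>\<^sup>+s. ennreal (h s) * G (J(u := s)) \<partial>jump_measure (c u) u \<partial>PiM V' (\<lambda>v. jump_measure (c v) v))"
    using hG unfolding V'(1)
    by (subst A.product_nn_integral_insert[OF V'(2,3)]) (simp_all add: measurable_cong_sets[OF sets_PiM_jump_measure refl])
  also have "\<dots> = (\<integral>\<^sup>+J. \<integral>\<^sup>+s. G (J(u := s)) \<partial>jump_measure (c u + 1) u \<partial>PiM V' (\<lambda>v. jump_measure (c v) v))"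
  proof (intro nn_integral_cong)
    fix J assume "J \<in> space (PiM V' (\<lambda>v. jump_measure (c v) v))"
    then have "J \<in> space (PiM V' (\<lambda>_. borel))" by (simp add: space_PiM)
    note [measurable] = upd[OF this]
    show "(\<integral>\<^sup>+s. ennreal (h s) * G (J(u := s)) \<partial>jump_measure (c u) u) = (\<integral>\<^sup>+s. G (J(u := s)) \<partial>jump_measure (c u + 1) u)"
      using h_pos by (simp add: nn_integral_jump_measure ennreal_mult less_imp_le mult_ac)
  qed
  also have "PiM V' (\<lambda>v. jump_measure (c v) v) = PiM V' (\<lambda>v. jump_measure (c v + (if v = u then 1 else 0)) v)"
    using V'(3) by (intro PiM_cong) auto
  also have "(\<integral>\<^sup>+J. \<integral>\<^sup>+s. G (J(u := s)) \<partial>jump_measure (c u + 1) u \<partial>\<dots>) =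
      (\<integral>\<^sup>+J. G J \<partial>PiM V (\<lambda>v. jump_measure (c v + (if v = u then 1 else 0)) v))"
    using G unfolding V'(1)
    by (subst B.product_nn_integral_insert[OF V'(2,3)]) (simp_all add: measurable_cong_sets[OF sets_PiM_jump_measure refl])
  finally show ?thesis .
qed

end

section \<open>The Palm formula for tuples drawn from the random measure\<close>

context crm_kappa
begin

lemma AE_notin_finite: "finite V \<Longrightarrow> AE y in \<eta>. y \<notin> V"
proof (induction V rule: finite_induct)
  case (insert v V)
  have "{v} \<in> null_sets \<eta>" using diffuse[of v] by (auto simp: sets_eta)
  from AE_not_in[OF this] insert.IH show ?case by eventually_elim auto
qed simp

text \<open>Given the first \<open>n\<close> coordinates, \<open>\<mu>\<close> is a fresh copy plus
  atoms at their values. The next coordinate falls either under the fresh part, where the Mecke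
  formula opens a block of size \<open>1\<close>, or on an atom at \<open>u\<close>, where the
  weight \<open>h (J u)\<close> enlarges the block of \<open>u\<close>. \<open>tuple_measure\<close>
  is designed to obey the same recursion.\<close>

theorem palm_formula:
  assumes "F \<in> borel_measurable (boundedly_finite_measures \<Otimes>\<^sub>M borel_tuples n)"
  shows "(\<integral>\<^sup>+\<mu>. \<integral>\<^sup>+Y. F (\<mu>, Y) \<partial>power_measure n \<mu> \<partial>C) =
    (\<integral>\<^sup>+Y. \<integral>\<^sup>+\<mu>. atoms_integral n F n \<mu> Y \<partial>C \<partial>tuple_measure \<eta> n)"
  using assms
proof (induction n arbitrary: F)
  case 0
  have u: "(\<lambda>_. undefined) \<in> space (borel_tuples 0 :: (nat \<Rightarrow> 'y) measure)" by (simp add: space_PiM)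
  have "(\<integral>\<^sup>+Y. \<integral>\<^sup>+\<mu>. atoms_integral 0 F 0 \<mu> Y \<partial>C \<partial>tuple_measure \<eta> 0) = (\<integral>\<^sup>+\<mu>. atoms_integral 0 F 0 \<mu> (\<lambda>_. undefined) \<partial>C)"
    unfolding tuple_measure.simps using measurable_C_atoms_integral[OF 0] by (rule nn_integral_return[OF u])
  also have "\<dots> = (\<integral>\<^sup>+\<mu>. F (\<mu>, \<lambda>_. undefined) \<partial>C)"
    by (intro nn_integral_cong) (simp add: atoms_integral_0)
  finally show ?case by (simp add: nn_integral_power_measure_0)
next
  case (Suc n)
  note F = Suc.prems
  interpret C: prob_space C by (rule prob_space_C)
  let ?B = "boundedly_finite_measures :: 'y measure measure"
  \<comment> \<open>The last coordinate is integrated out under the same \<open>\<mu>\<close>; once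
    the induction hypothesis is applied, this \<open>\<mu>\<close> carries the added atoms.\<close>
  define F' where "F' = (\<lambda>(\<mu>, Y). \<integral>\<^sup>+y. F (\<mu>, Y(Suc n := y)) \<partial>\<mu>)"
  have m3: "(\<lambda>x. F (fst (fst x), (snd (fst x))(Suc n := snd x))) \<in> borel_measurable ((?B \<Otimes>\<^sub>M borel_tuples n) \<Otimes>\<^sub>M borel)"
    by (rule measurable_compose[OF _ F]) measurable
  have F': "F' \<in> borel_measurable (?B \<Otimes>\<^sub>M borel_tuples n)"
    using measurable_nn_integral_boundedly_finite[OF measurable_fst m3] by (simp add: F'_def case_prod_unfold)
  define \<Psi> where "\<Psi> = (\<lambda>Y. \<integral>\<^sup>+\<mu>. atoms_integral (Suc n) F (Suc n) \<mu> Y \<partial>C)"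
  have \<Psi>: "\<Psi> \<in> borel_measurable (borel_tuples (Suc n))"
    unfolding \<Psi>_def by (rule measurable_C_atoms_integral[OF F])
  have step: "(\<integral>\<^sup>+\<mu>. atoms_integral n F' n \<mu> Y \<partial>C) = (\<integral>\<^sup>+y. \<Psi> (Y(Suc n := y)) \<partial>\<eta>) + (\<Sum>u\<in>Y ` {1..n}. \<Psi> (Y(Suc n := u)))"
    if Y: "Y \<in> space (borel_tuples n)" for Y
  proof -
    define V where "V = Y ` {1..n}"
    define c where "c = (\<lambda>v. card (block n Y v))"
    define P where "P = PiM V (\<lambda>v. jump_measure (c v) v)"
    have V: "finite V" by (simp add: V_def)
    interpret psf: product_sigma_finite "\<lambda>v. jump_measure (c v) v" by (rule product_sigma_finite_jump_measure)
    interpret P: sigma_finite_measure P unfolding P_def by (rule psf.sigma_finite[OF V])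
    have sP[measurable_cong]: "sets P = sets (PiM V (\<lambda>_. borel))" unfolding P_def by (rule sets_PiM_jump_measure)
    have YS: "Y(Suc n := y) \<in> space (borel_tuples (Suc n))" for y
      using measurable_space[OF measurable_append_tuple, of "(Y, y)"] Y by (simp add: space_pair_measure)
    have imgn: "(Y(Suc n := y)) ` {1..n} = V" for y unfolding V_def by (intro image_cong) auto
    have imgS: "(Y(Suc n := y)) ` {1..Suc n} = insert y V" for y
      unfolding imgn[of y, symmetric]
      by (simp only: atLeastAtMostSuc_conv[of 1 n] image_insert le_add2 plus_1_eq_Suc fun_upd_same)
    have addm: "(\<lambda>x. add_atoms h V (fst (fst x)) (snd x)) \<in> measurable ((?B \<Otimes>\<^sub>M (borel :: 'y measure)) \<Otimes>\<^sub>M PiM V (\<lambda>_. borel)) ?B"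
    proof (rule measurable_add_atoms[OF h_measurable _ V])
      fix v assume "v \<in> V"
      then show "(\<lambda>x. snd x v) \<in> measurable ((?B \<Otimes>\<^sub>M (borel :: 'y measure)) \<Otimes>\<^sub>M PiM V (\<lambda>_. borel :: 's measure)) borel"
        by (intro measurable_compose[OF measurable_snd measurable_component_singleton])
    qed measurable
    \<comment> \<open>The old jumps are integrated out while base measure and new location stay
      free: this is the function to which the Mecke formula is applied.\<close>
    define G where "G = (\<lambda>(\<mu>, y). \<integral>\<^sup>+J. F (add_atoms h V \<mu> J, Y(Suc n := y)) \<partial>P)"
    have jointm: "(\<lambda>x. F (add_atoms h V (fst (fst x)) (snd x), Y(Suc n := snd (fst x)))) \<in> borel_measurable ((?B \<Otimes>\<^sub>M borel) \<Otimes>\<^sub>M P)"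
    proof -
      have "(\<lambda>x. F (add_atoms h V (fst (fst x)) (snd x), Y(Suc n := snd (fst x)))) \<in> borel_measurable ((?B \<Otimes>\<^sub>M borel) \<Otimes>\<^sub>M PiM V (\<lambda>_. borel))"
      proof (rule measurable_compose[OF measurable_Pair[OF addm] F])
        show "(\<lambda>x. Y(Suc n := snd (fst x))) \<in> measurable ((?B \<Otimes>\<^sub>M borel) \<Otimes>\<^sub>M PiM V (\<lambda>_. borel :: 's measure)) (borel_tuples (Suc n))"
          using Y by (intro measurable_append_tuple') auto
      qed
      then show ?thesis unfolding measurable_cong_sets[OF sets_pair_measure_cong[OF refl sP] refl] .
    qed
    have G: "G \<in> borel_measurable (?B \<Otimes>\<^sub>M borel)"
      unfolding G_def case_prod_unfold using P.borel_measurable_nn_integral_fst[OF jointm] by simp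
    have Fu: "(\<lambda>J. F (add_atoms h V \<mu> J, Y(Suc n := u))) \<in> borel_measurable P" if "boundedly_finite \<mu>" for \<mu> u
      unfolding P_def by (rule measurable_add_atoms_section[OF F that V YS])
    have hFu: "(\<lambda>J. ennreal (h (J u)) * F (add_atoms h V \<mu> J, Y(Suc n := u))) \<in> borel_measurable P"
      if "boundedly_finite \<mu>" "u \<in> V" for \<mu> u
    proof -
      have "(\<lambda>J. J u) \<in> measurable P (borel :: 's measure)"
        unfolding measurable_cong_sets[OF sP refl] using that(2) by (rule measurable_component_singleton)
      from measurable_compose[OF this h_measurable] show ?thesis using Fu[OF that(1)] by measurable
    qed
    have old: "(\<integral>\<^sup>+J. ennreal (h (J u)) * F (add_atoms h V \<mu> J, Y(Suc n := u)) \<partial>P) =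
        atoms_integral (Suc n) F (Suc n) \<mu> (Y(Suc n := u))" if "boundedly_finite \<mu>" "u \<in> V" for \<mu> u
    proof -
      have "(\<integral>\<^sup>+J. ennreal (h (J u)) * F (add_atoms h V \<mu> J, Y(Suc n := u)) \<partial>P) =
        (\<integral>\<^sup>+J. F (add_atoms h V \<mu> J, Y(Suc n := u)) \<partial>PiM V (\<lambda>v. jump_measure (c v + (if v = u then 1 else 0)) v))"
        unfolding P_def using Fu[OF that(1)] unfolding measurable_cong_sets[OF sP refl]
        by (rule nn_integral_PiM_jump_measure_upd[OF V that(2)])
      then show ?thesis
        unfolding atoms_integral_def imgS card_block_append c_def using that(2) by (simp add: insert_absorb)
    qed
    \<comment> \<open>Fubini brings the jump at \<open>y\<close> inside the expectation, and
      \<open>atoms_integral_Suc_new\<close> recognises the result as the atoms integral of the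
      longer tuple.\<close>
    have new: "(\<integral>\<^sup>+s. ennreal (h s) * (\<integral>\<^sup>+\<mu>. G (add_atoms h {y} \<mu> (\<lambda>_. s), y) \<partial>C) \<partial>\<rho> y) = \<Psi> (Y(Suc n := y))"
      if y: "y \<notin> V" for y
    proof -
      interpret jm: sigma_finite_measure "jump_measure 1 y"
        using product_sigma_finite_jump_measure[of "\<lambda>_. 1"] by (simp add: product_sigma_finite_def)
      interpret pj: pair_sigma_finite "jump_measure 1 y" C ..
      have "(\<lambda>x. add_atoms h {y} (snd x) (\<lambda>_. fst x)) \<in> measurable (borel \<Otimes>\<^sub>M ?B) ?B"
        by (intro measurable_add_atom) measurable
      from measurable_compose[OF measurable_Pair[OF this measurable_const[of y]] G]
      have gm: "(\<lambda>x. G (add_atoms h {y} (snd x) (\<lambda>_. fst x), y)) \<in> borel_measurable (borel \<Otimes>\<^sub>M ?B)" by simp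
      have sb: "borel_measurable (borel \<Otimes>\<^sub>M ?B) = (borel_measurable (jump_measure 1 y \<Otimes>\<^sub>M C) :: (_ \<Rightarrow> ennreal) set)"
        by (intro measurable_cong_sets sets_pair_measure_cong) simp_all
      have sb2: "borel_measurable (borel \<Otimes>\<^sub>M ?B) = (borel_measurable (borel \<Otimes>\<^sub>M C) :: (_ \<Rightarrow> ennreal) set)"
        by (intro measurable_cong_sets sets_pair_measure_cong) simp_all
      have gs: "(\<lambda>s. \<integral>\<^sup>+\<mu>. G (add_atoms h {y} \<mu> (\<lambda>_. s), y) \<partial>C) \<in> borel_measurable borel"
        using C.borel_measurable_nn_integral_fst[OF gm[unfolded sb2]] by simp
      have "(\<integral>\<^sup>+s. ennreal (h s) * (\<integral>\<^sup>+\<mu>. G (add_atoms h {y} \<mu> (\<lambda>_. s), y) \<partial>C) \<partial>\<rho> y) =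
          (\<integral>\<^sup>+s. (\<integral>\<^sup>+\<mu>. G (add_atoms h {y} \<mu> (\<lambda>_. s), y) \<partial>C) \<partial>jump_measure 1 y)"
        using gs by (simp add: nn_integral_jump_measure)
      also have "\<dots> = (\<integral>\<^sup>+\<mu>. \<integral>\<^sup>+s. G (add_atoms h {y} \<mu> (\<lambda>_. s), y) \<partial>jump_measure 1 y \<partial>C)"
        using pj.Fubini[OF gm[unfolded sb]] by simp
      also have "\<dots> = \<Psi> (Y(Suc n := y))"
        unfolding \<Psi>_def
      proof (intro nn_integral_cong)
        fix \<mu> assume "\<mu> \<in> space C"
        then have \<mu>: "boundedly_finite \<mu>" by simp
        have cy: "card (block (Suc n) (Y(Suc n := y)) y) = 1"
          using y by (simp add: card_block_append card_block_notin V_def)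
        \<comment> \<open>As \<open>y\<close> is fresh, the block sizes of the old values are
          unchanged.\<close>
        have PP: "PiM V (\<lambda>v. jump_measure (card (block (Suc n) (Y(Suc n := y)) v)) v) = P"
          unfolding P_def c_def using y by (intro PiM_cong) (auto simp: card_block_append)
        have "atoms_integral (Suc n) F (Suc n) \<mu> (Y(Suc n := y)) =
          (\<integral>\<^sup>+s. atoms_integral (Suc n) F n (add_atoms h {y} \<mu> (\<lambda>_. s)) (Y(Suc n := y)) \<partial>jump_measure 1 y)"
          using atoms_integral_Suc_new[OF F \<mu> YS[of y], of n] y cy imgn[of y] by (simp only: fun_upd_same not_False_eq_True True_implies_equals)
        also have "\<dots> = (\<integral>\<^sup>+s. G (add_atoms h {y} \<mu> (\<lambda>_. s), y) \<partial>jump_measure 1 y)"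
          unfolding atoms_integral_def imgn PP G_def by simp
        finally show "(\<integral>\<^sup>+s. G (add_atoms h {y} \<mu> (\<lambda>_. s), y) \<partial>jump_measure 1 y) = atoms_integral (Suc n) F (Suc n) \<mu> (Y(Suc n := y))" ..
      qed
      finally show ?thesis .
    qed
    have "atoms_integral n F' n \<mu> Y = (\<integral>\<^sup>+y. G (\<mu>, y) \<partial>\<mu>) + (\<Sum>u\<in>V. atoms_integral (Suc n) F (Suc n) \<mu> (Y(Suc n := u)))"
      if "boundedly_finite \<mu>" for \<mu>
    proof -
      note \<mu> = that
      have s\<mu>: "sets \<mu> = sets borel" using \<mu> by (simp add: boundedly_finite_def)
      interpret \<mu>: sigma_finite_measure \<mu> by (rule boundedly_finite_sigma_finite[OF \<mu>])
      interpret pm: pair_sigma_finite \<mu> P ..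
      have "(\<lambda>(y, J). ((\<mu>, y), J)) \<in> measurable (borel \<Otimes>\<^sub>M P) ((?B \<Otimes>\<^sub>M borel) \<Otimes>\<^sub>M P)"
        unfolding case_prod_unfold using \<mu>
        by (intro measurable_Pair measurable_const measurable_fst measurable_snd) simp
      from measurable_compose[OF this jointm]
      have jm: "(\<lambda>x. F (add_atoms h V \<mu> (snd x), Y(Suc n := fst x))) \<in> borel_measurable (borel \<Otimes>\<^sub>M P)"
        by (simp add: case_prod_unfold)
      have jm': "(\<lambda>x. F (add_atoms h V \<mu> (snd x), Y(Suc n := fst x))) \<in> borel_measurable (\<mu> \<Otimes>\<^sub>M P)"
        using jm unfolding measurable_cong_sets[OF sets_pair_measure_cong[OF s\<mu> refl] refl] .
      have mu1: "(\<lambda>J. \<integral>\<^sup>+y. F (add_atoms h V \<mu> J, Y(Suc n := y)) \<partial>\<mu>) \<in> borel_measurable P"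
        using \<mu>.borel_measurable_nn_integral_fst[OF measurable_pair_swap[OF jm']] by simp
      have "atoms_integral n F' n \<mu> Y = (\<integral>\<^sup>+J. \<integral>\<^sup>+y. F (add_atoms h V \<mu> J, Y(Suc n := y)) \<partial>add_atoms h V \<mu> J \<partial>P)"
        unfolding atoms_integral_def F'_def P_def V_def c_def by simp
      also have "\<dots> = (\<integral>\<^sup>+J. (\<integral>\<^sup>+y. F (add_atoms h V \<mu> J, Y(Suc n := y)) \<partial>\<mu>) +
          (\<Sum>u\<in>V. ennreal (h (J u)) * F (add_atoms h V \<mu> J, Y(Suc n := u))) \<partial>P)"
      proof (intro nn_integral_cong nn_integral_add_atoms[OF s\<mu> V])
        fix J assume "J \<in> space P"
        have "(\<lambda>y. (add_atoms h V \<mu> J, Y(Suc n := y))) \<in> measurable borel (?B \<Otimes>\<^sub>M borel_tuples (Suc n))"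
          using boundedly_finite_add_atoms[OF \<mu> V, of h J] Y by (intro measurable_Pair measurable_append_tuple') auto
        from measurable_compose[OF this F] show "(\<lambda>y. F (add_atoms h V \<mu> J, Y(Suc n := y))) \<in> borel_measurable borel" .
      qed
      also have "\<dots> = (\<integral>\<^sup>+J. (\<integral>\<^sup>+y. F (add_atoms h V \<mu> J, Y(Suc n := y)) \<partial>\<mu>) \<partial>P) +
          (\<Sum>u\<in>V. \<integral>\<^sup>+J. ennreal (h (J u)) * F (add_atoms h V \<mu> J, Y(Suc n := u)) \<partial>P)"
        using mu1 hFu[OF \<mu>] by (simp add: nn_integral_add nn_integral_sum)
      also have "(\<integral>\<^sup>+J. (\<integral>\<^sup>+y. F (add_atoms h V \<mu> J, Y(Suc n := y)) \<partial>\<mu>) \<partial>P) = (\<integral>\<^sup>+y. G (\<mu>, y) \<partial>\<mu>)"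
        using pm.Fubini[OF jm'] by (simp add: G_def)
      finally show ?thesis using old[OF \<mu>] by (simp cong: sum.cong del: fun_upd_apply)
    qed
    then have "(\<integral>\<^sup>+\<mu>. atoms_integral n F' n \<mu> Y \<partial>C) =
      (\<integral>\<^sup>+\<mu>. (\<integral>\<^sup>+y. G (\<mu>, y) \<partial>\<mu>) + (\<Sum>u\<in>V. atoms_integral (Suc n) F (Suc n) \<mu> (Y(Suc n := u))) \<partial>C)"
      by (intro nn_integral_cong) simp
    also have "\<dots> = (\<integral>\<^sup>+\<mu>. \<integral>\<^sup>+y. G (\<mu>, y) \<partial>\<mu> \<partial>C) + (\<Sum>u\<in>V. \<Psi> (Y(Suc n := u)))"
    proof -
      have 1: "(\<lambda>\<mu>. \<integral>\<^sup>+y. G (\<mu>, y) \<partial>\<mu>) \<in> borel_measurable C"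
        using measurable_nn_integral_boundedly_finite[OF _ G, of "\<lambda>\<mu>. \<mu>"] by simp
      have 2: "(\<lambda>\<mu>. atoms_integral (Suc n) F (Suc n) \<mu> (Y(Suc n := u))) \<in> borel_measurable C" for u
        using measurable_compose[OF measurable_Pair2'[OF YS] measurable_atoms_integral[OF F order_refl]] by simp
      show ?thesis unfolding \<Psi>_def using 1 2 by (simp add: nn_integral_add nn_integral_sum)
    qed
    \<comment> \<open>\<open>new\<close> covers \<open>y \<notin> V\<close>; the finite set
      \<open>V\<close> is \<open>\<eta>\<close>-null because points are.\<close>
    also have "(\<integral>\<^sup>+\<mu>. \<integral>\<^sup>+y. G (\<mu>, y) \<partial>\<mu> \<partial>C) = (\<integral>\<^sup>+y. \<Psi> (Y(Suc n := y)) \<partial>\<eta>)"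
      unfolding mecke[OF G] using AE_notin_finite[OF V] by (intro nn_integral_cong_AE) (auto elim!: eventually_mono simp: new)
    finally show ?thesis unfolding V_def .
  qed
  have "(\<integral>\<^sup>+\<mu>. \<integral>\<^sup>+Y. F (\<mu>, Y) \<partial>power_measure (Suc n) \<mu> \<partial>C) = (\<integral>\<^sup>+\<mu>. \<integral>\<^sup>+Y. F' (\<mu>, Y) \<partial>power_measure n \<mu> \<partial>C)"
  proof (intro nn_integral_cong)
    fix \<mu> assume "\<mu> \<in> space C"
    then have \<mu>: "boundedly_finite \<mu>" by simp
    then have "(\<lambda>Y. F (\<mu>, Y)) \<in> borel_measurable (borel_tuples (Suc n))"
      by (intro measurable_compose[OF measurable_Pair1' F]) simp
    then show "(\<integral>\<^sup>+Y. F (\<mu>, Y) \<partial>power_measure (Suc n) \<mu>) = (\<integral>\<^sup>+Y. F' (\<mu>, Y) \<partial>power_measure n \<mu>)"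
      by (simp add: nn_integral_power_measure_Suc[OF \<mu>] F'_def)
  qed
  also have "\<dots> = (\<integral>\<^sup>+Y. \<integral>\<^sup>+\<mu>. atoms_integral n F' n \<mu> Y \<partial>C \<partial>tuple_measure \<eta> n)"
    by (rule Suc.IH[OF F'])
  also have "\<dots> = (\<integral>\<^sup>+Y. (\<integral>\<^sup>+y. \<Psi> (Y(Suc n := y)) \<partial>\<eta>) + (\<Sum>u\<in>Y ` {1..n}. \<Psi> (Y(Suc n := u))) \<partial>tuple_measure \<eta> n)"
    by (intro nn_integral_cong step) simp
  also have "\<dots> = integral\<^sup>N (tuple_measure \<eta> (Suc n)) \<Psi>"
    by (rule nn_integral_tuple_measure_Suc[OF sets_eta sigma_finite_eta \<Psi>, symmetric])
  finally show ?case by (simp add: \<Psi>_def)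
qed

end

section \<open>Normalised jump laws, posterior laws and the moment measure\<close>

context crm_kappa
begin

text \<open>The density of the moment measure with respect to
  \<open>tuple_measure \<eta> n\<close>.\<close>

definition kappa_prod :: "nat \<Rightarrow> (nat \<Rightarrow> 'y) \<Rightarrow> ennreal" where
  "kappa_prod n Y = (\<Prod>v\<in>distinct_values n Y. kappa h (card (block n Y v)) \<rho> v)"

lemma kappa_prod_less_top: "kappa_prod n Y < \<infinity>"
proof -
  have "kappa h (card (block n Y v)) \<rho> v \<noteq> \<top>" if "v \<in> distinct_values n Y" for v
    using kappa_finite[OF card_block_pos, of v Y n v] that by (simp add: distinct_values_def)
  then show ?thesis
    unfolding kappa_prod_def by (simp add: less_top[symmetric] ennreal_prod_eq_top)
qed

text \<open>Since \<open>h > 0\<close>, \<open>kappa\<close> vanishes only where there are no jumps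
  at all; formulas that divide by \<open>kappa\<close> then degenerate to
  \<open>0 = 0\<close>.\<close>

lemma kappa_eq_0:
  assumes "kappa h e \<rho> v = 0" shows "\<rho> v = null_measure borel"
proof -
  note [measurable_cong] = sets_rho
  have "ennreal (h s ^ e) \<noteq> 0" for s
    using zero_less_power[OF h_pos, of s e] by (simp add: ennreal_eq_0_iff)
  moreover have "emeasure (\<rho> v) {s\<in>space (\<rho> v). ennreal (h s ^ e) \<noteq> 0} = 0"
    using assms unfolding kappa_def by (subst (asm) nn_integral_0_iff) auto
  ultimately have "emeasure (\<rho> v) (space (\<rho> v)) = 0" by simp
  then have "emeasure (\<rho> v) A = 0" if "A \<in> sets borel" for A
    using emeasure_space[of "\<rho> v" A] by simp
  then show ?thesis by (intro measure_eqI) (auto simp: sets_rho)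
qed

lemma sets_jump_law [simp, measurable_cong]: "sets (jump_law h e \<rho> v) = sets borel"
  by (simp add: jump_law_def sets_rho)

lemma space_jump_law [simp]: "space (jump_law h e \<rho> v) = UNIV"
  using sets_eq_imp_space_eq[OF sets_jump_law] by simp

lemma nn_integral_jump_law:
  assumes [measurable]: "g \<in> borel_measurable borel"
  shows "integral\<^sup>N (jump_law h e \<rho> v) g = (\<integral>\<^sup>+s. ennreal (h s ^ e) * g s \<partial>\<rho> v) / kappa h e \<rho> v"
proof -
  note [measurable_cong] = sets_rho
  have "integral\<^sup>N (jump_law h e \<rho> v) g = (\<integral>\<^sup>+s. (ennreal (h s ^ e) * g s) / kappa h e \<rho> v \<partial>\<rho> v)"
    unfolding jump_law_def by (subst nn_integral_density) (auto simp: divide_ennreal_def mult_ac)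
  also have "\<dots> = (\<integral>\<^sup>+s. ennreal (h s ^ e) * g s \<partial>\<rho> v) / kappa h e \<rho> v"
    by (rule nn_integral_divide) measurable
  finally show ?thesis .
qed

lemma emeasure_jump_law_UNIV:
  assumes "1 \<le> e" "kappa h e \<rho> v \<noteq> 0"
  shows "emeasure (jump_law h e \<rho> v) UNIV = 1"
  using nn_integral_jump_law[of "\<lambda>_. 1" e v] assms(2) kappa_finite[OF assms(1), of v]
  by (simp add: kappa_def[symmetric] ennreal_divide_self)

lemma jump_law_null: "kappa h e \<rho> v = 0 \<Longrightarrow> jump_law h e \<rho> v = null_measure borel"
  by (rule measure_eqI) (auto simp: jump_law_def kappa_eq_0 emeasure_density)

text \<open>Where \<open>kappa\<close> vanishes both sides are null by \<open>kappa_eq_0\<close>;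
  elsewhere the normalisation cancels because \<open>1 \<le> e\<close> makes it finite.\<close>

lemma jump_measure_eq_jump_law:
  assumes "1 \<le> e"
  shows "jump_measure e v = scale_measure (kappa h e \<rho> v) (jump_law h e \<rho> v)"
proof (rule measure_eqI)
  fix A assume "A \<in> sets (jump_measure e v)"
  then have A[measurable]: "A \<in> sets borel" by simp
  have kf: "kappa h e \<rho> v < \<infinity>" using assms by (rule kappa_finite)
  have "emeasure (jump_measure e v) A = (\<integral>\<^sup>+s. ennreal (h s ^ e) * indicator A s \<partial>\<rho> v)"
    by (subst nn_integral_jump_measure[symmetric]) simp_all
  moreover have "emeasure (jump_law h e \<rho> v) A = (\<integral>\<^sup>+s. ennreal (h s ^ e) * indicator A s \<partial>\<rho> v) / kappa h e \<rho> v"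
    by (subst nn_integral_jump_law[symmetric]) simp_all
  ultimately show "emeasure (jump_measure e v) A = emeasure (scale_measure (kappa h e \<rho> v) (jump_law h e \<rho> v)) A"
    using kf by (cases "kappa h e \<rho> v = 0")
      (auto simp: kappa_eq_0 ennreal_times_divide mult_divide_eq_ennreal mult.commute[of "kappa h e \<rho> v"])
qed simp

lemma product_sigma_finite_jump_law: "product_sigma_finite (\<lambda>v. jump_law h (c v) \<rho> v)"
proof (rule product_sigma_finite.intro)
  fix v
  show "sigma_finite_measure (jump_law h (c v) \<rho> v)"
  proof (cases "kappa h (c v) \<rho> v = 0")
    case True
    then show ?thesis by (auto intro!: finite_measure.sigma_finite_measure finite_measureI simp: jump_law_null)
  next
    case False
    interpret sigma_finite_measure "\<rho> v" by (rule sigma_finite_rho)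
    note [measurable_cong] = sets_rho
    show ?thesis
      unfolding jump_law_def using False
      by (subst sigma_finite_iff_density_finite) (auto simp: ennreal_divide_eq_top_iff)
  qed
qed

lemma sets_PiM_jump_law: "sets (PiM V (\<lambda>v. jump_law h (c v) \<rho> v)) = sets (PiM V (\<lambda>_. borel))"
  by (intro sets_PiM_cong) auto

lemma PiM_jump_measure_eq:
  assumes V: "finite V" and c: "\<And>v. v \<in> V \<Longrightarrow> 1 \<le> c v"
  shows "PiM V (\<lambda>v. jump_measure (c v) v) =
    scale_measure (\<Prod>v\<in>V. kappa h (c v) \<rho> v) (PiM V (\<lambda>v. jump_law h (c v) \<rho> v))"
proof -
  interpret A: product_sigma_finite "\<lambda>v. jump_measure (c v) v" by (rule product_sigma_finite_jump_measure)
  interpret B: product_sigma_finite "\<lambda>v. jump_law h (c v) \<rho> v" by (rule product_sigma_finite_jump_law)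
  show ?thesis
  proof (rule A.PiM_eqI[OF V, symmetric])
    show "sets (scale_measure (\<Prod>v\<in>V. kappa h (c v) \<rho> v) (PiM V (\<lambda>v. jump_law h (c v) \<rho> v))) = sets (PiM V (\<lambda>v. jump_measure (c v) v))"
      by (simp add: sets_PiM_jump_law sets_PiM_jump_measure)
    fix A assume A: "\<And>v. v \<in> V \<Longrightarrow> A v \<in> sets (jump_measure (c v) v)"
    then show "emeasure (scale_measure (\<Prod>v\<in>V. kappa h (c v) \<rho> v) (PiM V (\<lambda>v. jump_law h (c v) \<rho> v))) (Pi\<^sub>E V A) =
        (\<Prod>v\<in>V. emeasure (jump_measure (c v) v) (A v))"
      using V c by (simp add: B.emeasure_PiM jump_measure_eq_jump_law prod.distrib[symmetric])
  qed
qed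

lemma sets_posterior_law [simp, measurable_cong]: "sets (posterior_law h n \<rho> \<eta> Y) = sets boundedly_finite_measures"
  by (simp add: posterior_law_def)

lemma space_posterior_law [simp]: "space (posterior_law h n \<rho> \<eta> Y) = Collect boundedly_finite"
  by (simp add: posterior_law_def)

lemma nn_integral_posterior_law:
  assumes F: "F \<in> borel_measurable boundedly_finite_measures"
  shows "integral\<^sup>N (posterior_law h n \<rho> \<eta> Y) F =
    (\<integral>\<^sup>+\<mu>. \<integral>\<^sup>+J. F (add_atoms h (distinct_values n Y) \<mu> J)
      \<partial>PiM (distinct_values n Y) (\<lambda>v. jump_law h (card (block n Y v)) \<rho> v) \<partial>C)"
proof -
  let ?V = "distinct_values n Y"
  let ?P = "PiM ?V (\<lambda>v. jump_law h (card (block n Y v)) \<rho> v)"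
  have V: "finite ?V" by (simp add: distinct_values_def)
  interpret psf: product_sigma_finite "\<lambda>v. jump_law h (card (block n Y v)) \<rho> v" by (rule product_sigma_finite_jump_law)
  interpret P: sigma_finite_measure ?P by (rule psf.sigma_finite[OF V])
  have add: "(\<lambda>(\<mu>, J). add_atoms h ?V \<mu> J) \<in> measurable (C \<Otimes>\<^sub>M ?P) boundedly_finite_measures"
    unfolding case_prod_unfold
  proof (rule measurable_add_atoms[OF h_measurable _ V])
    show "fst \<in> measurable (C \<Otimes>\<^sub>M ?P) boundedly_finite_measures"
      using measurable_fst[of C ?P] by (simp add: measurable_cong_sets[OF refl sets_C])
    fix v assume "v \<in> ?V"
    then show "(\<lambda>x. snd x v) \<in> measurable (C \<Otimes>\<^sub>M ?P) borel"
      by (intro measurable_compose[OF measurable_snd])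
        (auto simp: measurable_cong_sets[OF sets_PiM_jump_law refl] intro: measurable_component_singleton)
  qed
  have "integral\<^sup>N (posterior_law h n \<rho> \<eta> Y) F = (\<integral>\<^sup>+x. F (case x of (\<mu>, J) \<Rightarrow> add_atoms h ?V \<mu> J) \<partial>(C \<Otimes>\<^sub>M ?P))"
    unfolding posterior_law_def using F by (intro nn_integral_distr[OF add]) simp
  also have "\<dots> = (\<integral>\<^sup>+\<mu>. \<integral>\<^sup>+J. F (case (\<mu>, J) of (\<mu>, J) \<Rightarrow> add_atoms h ?V \<mu> J) \<partial>?P \<partial>C)"
    by (rule P.nn_integral_fst[symmetric]) (rule measurable_compose[OF add F])
  finally show ?thesis by simp
qed

lemma nn_integral_C_atoms_integral:
  assumes F: "F \<in> borel_measurable (boundedly_finite_measures \<Otimes>\<^sub>M borel_tuples n)" and Y: "Y \<in> space (borel_tuples n)"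
  shows "(\<integral>\<^sup>+\<mu>. atoms_integral n F n \<mu> Y \<partial>C) = kappa_prod n Y * (\<integral>\<^sup>+\<mu>. F (\<mu>, Y) \<partial>posterior_law h n \<rho> \<eta> Y)"
proof -
  let ?V = "distinct_values n Y"
  let ?P = "PiM ?V (\<lambda>v. jump_law h (card (block n Y v)) \<rho> v)"
  have V: "finite ?V" by (simp add: distinct_values_def)
  interpret psf: product_sigma_finite "\<lambda>v. jump_law h (card (block n Y v)) \<rho> v" by (rule product_sigma_finite_jump_law)
  interpret P: sigma_finite_measure ?P by (rule psf.sigma_finite[OF V])
  have FY: "(\<lambda>\<mu>. F (\<mu>, Y)) \<in> borel_measurable boundedly_finite_measures"
    using measurable_compose[OF measurable_Pair2'[OF Y] F] .
  have Pe: "PiM ?V (\<lambda>v. jump_measure (card (block n Y v)) v) = scale_measure (kappa_prod n Y) ?P"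
    unfolding kappa_prod_def using V card_block_pos[of _ Y n]
    by (intro PiM_jump_measure_eq) (auto simp: distinct_values_def)
  have sec: "(\<lambda>J. F (add_atoms h ?V \<mu> J, Y)) \<in> borel_measurable ?P" if "boundedly_finite \<mu>" for \<mu>
    using measurable_add_atoms_section[OF F that V Y, of "\<lambda>v. card (block n Y v)"]
    unfolding measurable_cong_sets[OF sets_PiM_jump_law refl] measurable_cong_sets[OF sets_PiM_jump_measure refl] .
  have "(\<integral>\<^sup>+\<mu>. atoms_integral n F n \<mu> Y \<partial>C) = (\<integral>\<^sup>+\<mu>. kappa_prod n Y * (\<integral>\<^sup>+J. F (add_atoms h ?V \<mu> J, Y) \<partial>?P) \<partial>C)"
    unfolding atoms_integral_def distinct_values_def[symmetric] Pe
    by (intro nn_integral_cong nn_integral_scale_measure sec) simp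
  also have "\<dots> = kappa_prod n Y * (\<integral>\<^sup>+\<mu>. \<integral>\<^sup>+J. F (add_atoms h ?V \<mu> J, Y) \<partial>?P \<partial>C)"
  proof (rule nn_integral_cmult)
    have add: "(\<lambda>x. add_atoms h ?V (fst x) (snd x)) \<in> measurable (C \<Otimes>\<^sub>M ?P) boundedly_finite_measures"
    proof (rule measurable_add_atoms[OF h_measurable _ V])
      show "fst \<in> measurable (C \<Otimes>\<^sub>M ?P) boundedly_finite_measures"
        using measurable_fst[of C ?P] by (simp add: measurable_cong_sets[OF refl sets_C])
      fix v assume "v \<in> ?V"
      then show "(\<lambda>x. snd x v) \<in> measurable (C \<Otimes>\<^sub>M ?P) borel"
        by (intro measurable_compose[OF measurable_snd])
          (auto simp: measurable_cong_sets[OF sets_PiM_jump_law refl] intro: measurable_component_singleton)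
    qed
    from P.borel_measurable_nn_integral_fst[OF measurable_compose[OF add FY]]
    show "(\<lambda>\<mu>. \<integral>\<^sup>+J. F (add_atoms h ?V \<mu> J, Y) \<partial>?P) \<in> borel_measurable C" by simp
  qed
  also have "(\<integral>\<^sup>+\<mu>. \<integral>\<^sup>+J. F (add_atoms h ?V \<mu> J, Y) \<partial>?P \<partial>C) = (\<integral>\<^sup>+\<mu>. F (\<mu>, Y) \<partial>posterior_law h n \<rho> \<eta> Y)"
    by (rule nn_integral_posterior_law[OF FY, symmetric])
  finally show ?thesis .
qed

lemma emeasure_posterior_law_space:
  "emeasure (posterior_law h n \<rho> \<eta> Y) (Collect boundedly_finite) =
    (\<Prod>v\<in>distinct_values n Y. emeasure (jump_law h (card (block n Y v)) \<rho> v) UNIV)"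
proof -
  interpret C: prob_space C by (rule prob_space_C)
  interpret psf: product_sigma_finite "\<lambda>v. jump_law h (card (block n Y v)) \<rho> v" by (rule product_sigma_finite_jump_law)
  let ?V = "distinct_values n Y"
  let ?P = "PiM ?V (\<lambda>v. jump_law h (card (block n Y v)) \<rho> v)"
  have V: "finite ?V" by (simp add: distinct_values_def)
  have sP: "space ?P = Pi\<^sub>E ?V (\<lambda>_. UNIV)" by (simp add: space_PiM)
  have "emeasure (posterior_law h n \<rho> \<eta> Y) (Collect boundedly_finite) = (\<integral>\<^sup>+\<mu>. 1 \<partial>posterior_law h n \<rho> \<eta> Y)" by simp
  also have "\<dots> = emeasure ?P (space ?P)"
    using C.emeasure_space_1 by (subst nn_integral_posterior_law) simp_all
  also have "\<dots> = (\<Prod>v\<in>?V. emeasure (jump_law h (card (block n Y v)) \<rho> v) UNIV)"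
    unfolding sP using V by (subst psf.emeasure_PiM) auto
  finally show ?thesis .
qed

lemma posterior_law_prob:
  assumes "kappa_prod n Y \<noteq> 0"
  shows "emeasure (posterior_law h n \<rho> \<eta> Y) (Collect boundedly_finite) = 1"
  unfolding emeasure_posterior_law_space
  using assms card_block_pos[of _ Y n] unfolding kappa_prod_def
  by (intro prod.neutral ballI emeasure_jump_law_UNIV) (auto simp: distinct_values_def)

text \<open>One vanishing \<open>kappa\<close> turns its jump law into the null measure, and with it
  the whole product.\<close>

lemma posterior_law_null:
  assumes "kappa_prod n Y = 0"
  shows "integral\<^sup>N (posterior_law h n \<rho> \<eta> Y) F = 0"
proof -
  obtain v where v: "v \<in> distinct_values n Y" "kappa h (card (block n Y v)) \<rho> v = 0"
    using assms unfolding kappa_prod_def by (auto simp: distinct_values_def)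
  have "emeasure (posterior_law h n \<rho> \<eta> Y) (space (posterior_law h n \<rho> \<eta> Y)) = 0"
    unfolding space_posterior_law emeasure_posterior_law_space using v
    by (intro prod_zero bexI[of _ v]) (simp_all add: distinct_values_def jump_law_null)
  then have "AE \<mu> in posterior_law h n \<rho> \<eta> Y. F \<mu> = 0"
    using sets.top[of "posterior_law h n \<rho> \<eta> Y"]
    by (intro AE_I[of _ _ "space (posterior_law h n \<rho> \<eta> Y)"]) auto
  then have "integral\<^sup>N (posterior_law h n \<rho> \<eta> Y) F = (\<integral>\<^sup>+\<mu>. 0 \<partial>posterior_law h n \<rho> \<eta> Y)"
    by (rule nn_integral_cong_AE)
  then show ?thesis by simp
qed

text \<open>The index set of the product depends on \<open>Y\<close>, so measurability is borrowed
  from \<open>atoms_integral\<close>: with \<open>F = 1\<close> its expectation is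
  \<open>kappa_prod\<close>.\<close>

lemma kappa_prod_measurable: "kappa_prod n \<in> borel_measurable (borel_tuples n)"
proof -
  interpret C: prob_space C by (rule prob_space_C)
  have "(\<lambda>Y. \<integral>\<^sup>+\<mu>. atoms_integral n (\<lambda>_. 1) n \<mu> Y \<partial>C) \<in> borel_measurable (borel_tuples n)"
    by (rule measurable_C_atoms_integral) simp
  moreover have "(\<integral>\<^sup>+\<mu>. atoms_integral n (\<lambda>_. 1) n \<mu> Y \<partial>C) = kappa_prod n Y" if "Y \<in> space (borel_tuples n)" for Y
    using that posterior_law_prob[of n Y] by (cases "kappa_prod n Y = 0") (simp_all add: nn_integral_C_atoms_integral)
  ultimately show ?thesis by (subst measurable_cong[where g = "\<lambda>Y. \<integral>\<^sup>+\<mu>. atoms_integral n (\<lambda>_. 1) n \<mu> Y \<partial>C"]) auto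
qed

text \<open>The posterior expectation is the quotient of the Palm integral by
  \<open>kappa_prod\<close>; where the latter is \<open>0\<close>, both sides are \<open>0\<close>
  since \<open>0 / 0 = 0\<close> in \<open>ennreal\<close>.\<close>

lemma posterior_law_kernel:
  assumes F: "F \<in> borel_measurable (boundedly_finite_measures \<Otimes>\<^sub>M borel_tuples n)"
  shows "(\<lambda>Y. \<integral>\<^sup>+\<mu>. F (\<mu>, Y) \<partial>posterior_law h n \<rho> \<eta> Y) \<in> borel_measurable (borel_tuples n)"
proof -
  have "(\<lambda>Y. (\<integral>\<^sup>+\<mu>. atoms_integral n F n \<mu> Y \<partial>C) / kappa_prod n Y) \<in> borel_measurable (borel_tuples n)"
    using measurable_C_atoms_integral[OF F] kappa_prod_measurable by measurable
  moreover have "(\<integral>\<^sup>+\<mu>. F (\<mu>, Y) \<partial>posterior_law h n \<rho> \<eta> Y) = (\<integral>\<^sup>+\<mu>. atoms_integral n F n \<mu> Y \<partial>C) / kappa_prod n Y"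
    if "Y \<in> space (borel_tuples n)" for Y
    unfolding nn_integral_C_atoms_integral[OF F that] using kappa_prod_less_top[of n Y]
    by (cases "kappa_prod n Y = 0") (simp_all add: posterior_law_null mult_divide_eq_ennreal mult.commute[of "kappa_prod n Y"])
  ultimately show ?thesis by (subst measurable_cong) auto
qed

lemma palm_formula_posterior:
  assumes F: "F \<in> borel_measurable (boundedly_finite_measures \<Otimes>\<^sub>M borel_tuples n)"
  shows "(\<integral>\<^sup>+\<mu>. \<integral>\<^sup>+Y. F (\<mu>, Y) \<partial>power_measure n \<mu> \<partial>C) =
    (\<integral>\<^sup>+Y. kappa_prod n Y * (\<integral>\<^sup>+\<mu>. F (\<mu>, Y) \<partial>posterior_law h n \<rho> \<eta> Y) \<partial>tuple_measure \<eta> n)"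
  unfolding palm_formula[OF F] by (intro nn_integral_cong nn_integral_C_atoms_integral[OF F]) simp

lemma nn_integral_kernel_prod_power_measure:
  assumes C': "sets C' = sets boundedly_finite_measures"
    and F: "F \<in> borel_measurable (boundedly_finite_measures \<Otimes>\<^sub>M borel_tuples n)"
  shows "integral\<^sup>N (kernel_prod C' (borel_tuples n) (power_measure n)) F =
    (\<integral>\<^sup>+\<mu>. \<integral>\<^sup>+Y. F (\<mu>, Y :: nat \<Rightarrow> 'y) \<partial>power_measure n \<mu> \<partial>C')"
proof -
  have sb: "borel_measurable (C' \<Otimes>\<^sub>M borel_tuples n) = (borel_measurable (boundedly_finite_measures \<Otimes>\<^sub>M borel_tuples n) :: ('y measure \<times> (nat \<Rightarrow> 'y) \<Rightarrow> ennreal) set)"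
    by (intro measurable_cong_sets sets_pair_measure_cong) (simp_all add: C')
  show ?thesis
  proof (rule nn_integral_kernel_prod)
    show "sets (power_measure n \<mu>) = sets (borel_tuples n)" if "\<mu> \<in> space C'" for \<mu> :: "'y measure"
      using that sets_eq_imp_space_eq[OF C'] by (intro sets_power_measure) (simp add: boundedly_finite_def)
    show "F \<in> borel_measurable (C' \<Otimes>\<^sub>M borel_tuples n)" unfolding sb by (rule F)
    fix G :: "'y measure \<times> (nat \<Rightarrow> 'y) \<Rightarrow> ennreal" assume "G \<in> borel_measurable (C' \<Otimes>\<^sub>M borel_tuples n)"
    then have "(\<lambda>\<mu>. \<integral>\<^sup>+Y. G (\<mu>, Y) \<partial>power_measure n \<mu>) \<in> borel_measurable boundedly_finite_measures"
      unfolding sb by (rule measurable_nn_integral_power_measure)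
    then show "(\<lambda>\<mu>. \<integral>\<^sup>+Y. G (\<mu>, Y) \<partial>power_measure n \<mu>) \<in> borel_measurable C'"
      unfolding measurable_cong_sets[OF C' refl] .
  qed
qed

abbreviation "MM n \<equiv> moment_measure h n \<rho> \<eta>"

lemma sets_moment_measure [simp, measurable_cong]: "sets (MM n) = sets (borel_tuples n)"
  by (simp add: moment_measure_def)

lemma space_moment_measure [simp]: "space (MM n) = space (borel_tuples n)"
  by (simp add: moment_measure_def)

text \<open>The Palm formula for an integrand that ignores \<open>\<mu>\<close>: the posterior then
  contributes its total mass, which is \<open>1\<close> wherever \<open>kappa_prod\<close> does not
  vanish.\<close>

lemma nn_integral_moment_measure:
  assumes G: "G \<in> borel_measurable (borel_tuples n)"
  shows "integral\<^sup>N (MM n) G = (\<integral>\<^sup>+Y. kappa_prod n Y * G Y \<partial>tuple_measure \<eta> n)"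
proof -
  have sndm: "snd \<in> measurable (kernel_prod C (borel_tuples n) (power_measure n)) (borel_tuples n :: (nat \<Rightarrow> 'y) measure)"
    by (simp add: measurable_cong_sets[OF sets_kernel_prod refl])
  have Gs: "(\<lambda>x. G (snd x)) \<in> borel_measurable (boundedly_finite_measures \<Otimes>\<^sub>M borel_tuples n)"
    by (rule measurable_compose[OF measurable_snd G])
  have "integral\<^sup>N (MM n) G = (\<integral>\<^sup>+x. G (snd x) \<partial>kernel_prod C (borel_tuples n) (power_measure n))"
    unfolding moment_measure_def using G by (intro nn_integral_distr[OF sndm]) simp
  also have "\<dots> = (\<integral>\<^sup>+\<mu>. \<integral>\<^sup>+Y. G (snd (\<mu>, Y)) \<partial>power_measure n \<mu> \<partial>C)"
    by (rule nn_integral_kernel_prod_power_measure[OF sets_C Gs])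
  also have "\<dots> = (\<integral>\<^sup>+Y. kappa_prod n Y * (\<integral>\<^sup>+\<mu>. G (snd (\<mu>, Y)) \<partial>posterior_law h n \<rho> \<eta> Y) \<partial>tuple_measure \<eta> n)"
    by (rule palm_formula_posterior[OF Gs])
  also have "\<dots> = (\<integral>\<^sup>+Y. kappa_prod n Y * G Y \<partial>tuple_measure \<eta> n)"
  proof (intro nn_integral_cong)
    fix Y :: "nat \<Rightarrow> 'y"
    show "kappa_prod n Y * (\<integral>\<^sup>+\<mu>. G (snd (\<mu>, Y)) \<partial>posterior_law h n \<rho> \<eta> Y) = kappa_prod n Y * G Y"
      using posterior_law_prob[of n Y] by (cases "kappa_prod n Y = 0") simp_all
  qed
  finally show ?thesis .
qed

lemma moment_measure_eq: "MM n = density (tuple_measure \<eta> n) (kappa_prod n)"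
proof (rule measure_eqI)
  have km: "kappa_prod n \<in> borel_measurable (tuple_measure \<eta> n)"
    using kappa_prod_measurable by (simp cong: measurable_cong_sets)
  fix A assume A: "A \<in> sets (MM n)"
  then have "emeasure (MM n) A = integral\<^sup>N (MM n) (indicator A)" by simp
  also have "\<dots> = (\<integral>\<^sup>+Y. kappa_prod n Y * indicator A Y \<partial>tuple_measure \<eta> n)"
    using A by (intro nn_integral_moment_measure) simp
  also have "\<dots> = emeasure (density (tuple_measure \<eta> n) (kappa_prod n)) A"
    using A km by (subst emeasure_density) auto
  finally show "emeasure (MM n) A = emeasure (density (tuple_measure \<eta> n) (kappa_prod n)) A" .
qed simp

text \<open>The scalar \<open>l\<close> is carried along so that, for the tilted kernel, the left
  side can be rewritten as the law of \<open>\<mu>\<close> weighted by \<open>w\<close>.\<close>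

lemma disintegration:
  "kernel_prod (scale_measure l C) (borel_tuples n) (power_measure n) =
    distr (kernel_prod (scale_measure l (MM n)) boundedly_finite_measures (posterior_law h n \<rho> \<eta>))
      (boundedly_finite_measures \<Otimes>\<^sub>M borel_tuples n) prod.swap" (is "?L = distr ?K ?BT _")
proof (rule measure_eqI)
  have sK: "sets ?K = sets (borel_tuples n \<Otimes>\<^sub>M boundedly_finite_measures)"
    by (simp only: sets_kernel_prod sets_pair_measure_cong[OF sets_scale_measure refl] sets_pair_measure_cong[OF sets_moment_measure refl])
  have sL: "sets ?L = sets ?BT"
    by (simp only: sets_kernel_prod sets_pair_measure_cong[OF sets_scale_measure refl] sets_pair_measure_cong[OF sets_C refl])
  have swap: "prod.swap \<in> measurable ?K ?BT"
    unfolding measurable_cong_sets[OF sK refl] prod.swap_def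
    by (intro measurable_Pair measurable_fst measurable_snd)
  show "sets ?L = sets (distr ?K ?BT prod.swap)" by (simp add: sL)
  fix A assume "A \<in> sets ?L"
  then have A: "A \<in> sets ?BT" by (simp add: sL)
  then have iA: "indicator A \<in> borel_measurable ?BT" by simp
  have iAs: "(\<lambda>x. indicator A (prod.swap x) :: ennreal) \<in> borel_measurable (borel_tuples n \<Otimes>\<^sub>M boundedly_finite_measures)"
    using measurable_compose[OF measurable_pair_swap' iA] by (simp add: prod.swap_def case_prod_unfold)
  have sb: "borel_measurable (scale_measure l (MM n) \<Otimes>\<^sub>M boundedly_finite_measures) = (borel_measurable (borel_tuples n \<Otimes>\<^sub>M boundedly_finite_measures) :: ((nat \<Rightarrow> 'y) \<times> 'y measure \<Rightarrow> ennreal) set)"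
    by (intro measurable_cong_sets sets_pair_measure_cong) simp_all
  have "emeasure ?L A = integral\<^sup>N ?L (indicator A)" using A by (simp add: sL)
  also have "\<dots> = (\<integral>\<^sup>+\<mu>. \<integral>\<^sup>+Y. indicator A (\<mu>, Y) \<partial>power_measure n \<mu> \<partial>scale_measure l C)"
    by (rule nn_integral_kernel_prod_power_measure[OF _ iA]) simp
  also have "\<dots> = l * (\<integral>\<^sup>+\<mu>. \<integral>\<^sup>+Y. indicator A (\<mu>, Y) \<partial>power_measure n \<mu> \<partial>C)"
    using measurable_nn_integral_power_measure[OF iA] by (intro nn_integral_scale_measure) simp
  also have "\<dots> = l * (\<integral>\<^sup>+Y. kappa_prod n Y * (\<integral>\<^sup>+\<mu>. indicator A (\<mu>, Y) \<partial>posterior_law h n \<rho> \<eta> Y) \<partial>tuple_measure \<eta> n)"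
    by (simp only: palm_formula_posterior[OF iA])
  also have "\<dots> = l * (\<integral>\<^sup>+Y. \<integral>\<^sup>+\<mu>. indicator A (\<mu>, Y) \<partial>posterior_law h n \<rho> \<eta> Y \<partial>MM n)"
    by (simp only: nn_integral_moment_measure[OF posterior_law_kernel[OF iA]])
  also have "\<dots> = (\<integral>\<^sup>+Y. \<integral>\<^sup>+\<mu>. indicator A (prod.swap (Y, \<mu>)) \<partial>posterior_law h n \<rho> \<eta> Y \<partial>scale_measure l (MM n))"
    using posterior_law_kernel[OF iA]
    by (subst nn_integral_scale_measure) (simp_all add: measurable_cong_sets[OF sets_moment_measure refl])
  also have "\<dots> = (\<integral>\<^sup>+x. indicator A (prod.swap x) \<partial>?K)"
  proof (rule nn_integral_kernel_prod[symmetric])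
    show "(\<lambda>x. indicator A (prod.swap x) :: ennreal) \<in> borel_measurable (scale_measure l (MM n) \<Otimes>\<^sub>M boundedly_finite_measures)"
      unfolding sb by (rule iAs)
    fix G :: "(nat \<Rightarrow> 'y) \<times> 'y measure \<Rightarrow> ennreal" assume "G \<in> borel_measurable (scale_measure l (MM n) \<Otimes>\<^sub>M boundedly_finite_measures)"
    then have "(\<lambda>x. G (snd x, fst x)) \<in> borel_measurable ?BT"
      using measurable_compose[OF measurable_pair_swap'] unfolding sb by (simp add: case_prod_unfold)
    from posterior_law_kernel[OF this]
    show "(\<lambda>Y. \<integral>\<^sup>+\<mu>. G (Y, \<mu>) \<partial>posterior_law h n \<rho> \<eta> Y) \<in> borel_measurable (scale_measure l (MM n))"
      by (simp cong: measurable_cong_sets)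
  qed simp
  also have "\<dots> = integral\<^sup>N (distr ?K ?BT prod.swap) (indicator A)"
    using iA by (intro nn_integral_distr[OF swap, symmetric]) simp
  also have "\<dots> = emeasure (distr ?K ?BT prod.swap) A" using A by simp
  finally show "emeasure ?L A = emeasure (distr ?K ?BT prod.swap) A" .
qed

end

text \<open>Cubes over sets \<open>H k\<close> of finite mass suffice: appending a coordinate, fresh
  or one of at most \<open>n\<close> old values, multiplies the mass of the cube by at most
  \<open>\<eta>(H k) + n\<close>.\<close>

lemma sigma_finite_tuple_measure:
  fixes \<eta> :: "'y::polish_space measure"
  assumes \<eta>: "sets \<eta> = sets borel" "sigma_finite_measure \<eta>"
  shows "sigma_finite_measure (tuple_measure \<eta> n)"
proof -
  obtain H where H: "range H \<subseteq> sets \<eta>" "incseq H" "(\<Union>k. H k) = space \<eta>" "\<And>k. emeasure \<eta> (H k) < \<infinity>"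
    using sigma_finite_cover_nat[OF \<eta>(2)] by metis
  have Hk: "H k \<in> sets borel" for k using H(1) by (auto simp: \<eta>)
  let ?H = "\<lambda>n k. Pi\<^sub>E {1..n} (\<lambda>_. H k)"
  have HP[measurable]: "?H n k \<in> sets (borel_tuples n)" for n k using Hk by (intro sets_PiM_I_finite) auto
  have fin: "emeasure (tuple_measure \<eta> n) (?H n k) < \<infinity>" for k
  proof (induction n)
    case 0
    have "emeasure (tuple_measure \<eta> 0) (?H 0 k) \<le> 1"
      unfolding tuple_measure.simps using HP[of 0 k] by (subst emeasure_return) (auto simp: indicator_def)
    then show ?case by (rule le_less_trans) simp
  next
    case (Suc n)
    have upd: "indicator (?H (Suc n) k) (Y(Suc n := y)) = (indicator (?H n k) Y * indicator (H k) y :: ennreal)"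
      if "Y \<in> space (borel_tuples n)" for Y :: "nat \<Rightarrow> 'y" and y
    proof -
      have "Y(Suc n := y) \<in> ?H (Suc n) k \<longleftrightarrow> Y \<in> ?H n k \<and> y \<in> H k"
      proof
        assume *: "Y(Suc n := y) \<in> ?H (Suc n) k"
        have "Y i \<in> H k" if "i \<in> {1..n}" for i
          using PiE_mem[OF *, of i] that by simp
        moreover have "y \<in> H k" using PiE_mem[OF *, of "Suc n"] by simp
        ultimately show "Y \<in> ?H n k \<and> y \<in> H k"
          using that by (simp add: space_PiM PiE_iff)
      next
        assume "Y \<in> ?H n k \<and> y \<in> H k"
        then show "Y(Suc n := y) \<in> ?H (Suc n) k"
          by (auto simp: PiE_iff extensional_def le_Suc_eq)
      qed
      then show ?thesis by (auto simp: indicator_def)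
    qed
    have "emeasure (tuple_measure \<eta> (Suc n)) (?H (Suc n) k) = integral\<^sup>N (tuple_measure \<eta> (Suc n)) (indicator (?H (Suc n) k))"
      by (rule nn_integral_indicator[symmetric]) (simp only: sets_tuple_measure HP)
    also have "\<dots> = (\<integral>\<^sup>+Y. (\<integral>\<^sup>+y. indicator (?H (Suc n) k) (Y(Suc n := y)) \<partial>\<eta>) + (\<Sum>u\<in>Y ` {1..n}. indicator (?H (Suc n) k) (Y(Suc n := u))) \<partial>tuple_measure \<eta> n)"
      by (rule nn_integral_tuple_measure_Suc[OF \<eta>]) (intro borel_measurable_indicator HP)
    also have "\<dots> \<le> (\<integral>\<^sup>+Y. (emeasure \<eta> (H k) + of_nat n) * indicator (?H n k) Y \<partial>tuple_measure \<eta> n)"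
    proof (rule nn_integral_mono)
      fix Y assume "Y \<in> space (tuple_measure \<eta> n)"
      then have Y: "Y \<in> space (borel_tuples n)" by simp
      have "(\<integral>\<^sup>+y. indicator (?H (Suc n) k) (Y(Suc n := y)) \<partial>\<eta>) = indicator (?H n k) Y * emeasure \<eta> (H k)"
        unfolding upd[OF Y] using Hk by (intro nn_integral_cmult_indicator) (simp add: \<eta>)
      moreover have "(\<Sum>u\<in>Y ` {1..n}. indicator (?H (Suc n) k) (Y(Suc n := u))) \<le> (\<Sum>u\<in>Y ` {1..n}. indicator (?H n k) Y :: ennreal)"
        unfolding upd[OF Y] by (intro sum_mono) (auto simp: indicator_def)
      moreover have "(\<Sum>u\<in>Y ` {1..n}. indicator (?H n k) Y :: ennreal) \<le> of_nat n * indicator (?H n k) Y"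
      proof -
        have "card (Y ` {1..n}) \<le> n" using card_image_le[of "{1..n}" Y] by simp
        then have "(of_nat (card (Y ` {1..n})) :: ennreal) \<le> of_nat n" by (rule of_nat_mono)
        then show ?thesis unfolding sum_constant by (rule mult_right_mono) simp
      qed
      ultimately show "(\<integral>\<^sup>+y. indicator (?H (Suc n) k) (Y(Suc n := y)) \<partial>\<eta>) + (\<Sum>u\<in>Y ` {1..n}. indicator (?H (Suc n) k) (Y(Suc n := u)))
          \<le> (emeasure \<eta> (H k) + of_nat n) * indicator (?H n k) Y"
        unfolding distrib_right by (intro add_mono) (auto simp: mult.commute intro: order_trans)
    qed
    also have "\<dots> = (emeasure \<eta> (H k) + of_nat n) * emeasure (tuple_measure \<eta> n) (?H n k)"
      by (rule nn_integral_cmult_indicator) (simp only: sets_tuple_measure HP)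
    also have "\<dots> < \<infinity>" using Suc H(4)[of k] by (simp add: ennreal_mult_less_top of_nat_less_top)
    finally show ?case .
  qed
  have cov: "\<exists>k. Y \<in> ?H n k" if Y: "Y \<in> space (borel_tuples n)" for Y :: "nat \<Rightarrow> 'y"
  proof -
    have "\<exists>k. Y i \<in> H k" for i using H(3) sets_eq_imp_space_eq[OF \<eta>(1)] by auto
    then obtain k where k: "\<And>i. Y i \<in> H (k i)" by metis
    \<comment> \<open>\<open>insert 0\<close> keeps the maximum defined for
      \<open>n = 0\<close>.\<close>
    define K where "K = Max (insert 0 (k ` {1..n}))"
    have "Y i \<in> H K" if "i \<in> {1..n}" for i
      using k[of i] incseqD[OF H(2), of "k i" K] that by (auto simp: K_def)
    then have "Y \<in> ?H n K" using Y by (simp add: space_PiM PiE_iff)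
    then show ?thesis ..
  qed
  show ?thesis
  proof
    show "\<exists>A. countable A \<and> A \<subseteq> sets (tuple_measure \<eta> n) \<and> \<Union>A = space (tuple_measure \<eta> n) \<and> (\<forall>a\<in>A. emeasure (tuple_measure \<eta> n) a \<noteq> \<infinity>)"
    proof (intro exI[of _ "range (?H n)"] conjI)
      show "\<Union>(range (?H n)) = space (tuple_measure \<eta> n)"
        using cov sets.sets_into_space[OF HP] by (auto simp del: space_PiM) blast
      show "range (?H n) \<subseteq> sets (tuple_measure \<eta> n)" using HP by (simp only: sets_tuple_measure) auto
      show "\<forall>a\<in>range (?H n). emeasure (tuple_measure \<eta> n) a \<noteq> \<infinity>" using fin by (auto simp: less_top)
    qed simp
  qed
qed

section \<open>Tilted posterior laws\<close>

lemma AE_scale_measure: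
  assumes "AE x in M. P x" shows "AE x in scale_measure r M. P x"
proof -
  obtain Z where "{x \<in> space M. \<not> P x} \<subseteq> Z" "emeasure M Z = 0" "Z \<in> sets M"
    using AE_E[OF assms] by metis
  then show ?thesis by (intro AE_I[of _ _ Z]) (auto simp: space_scale_measure)
qed

text \<open>A coordinate of \<open>tuple_measure\<close> is either \<open>\<eta>\<close>-distributed
  or a copy of an earlier one, so an \<open>\<eta>\<close>-null set of values is avoided by all
  coordinates.\<close>

lemma AE_tuple_measure:
  fixes \<eta> :: "'y::polish_space measure"
  assumes \<eta>: "sets \<eta> = sets borel" "sigma_finite_measure \<eta>" and P: "AE y in \<eta>. P y"
  shows "AE Y in tuple_measure \<eta> n. \<forall>i\<in>{1..n}. P (Y i)"
proof -
  obtain Z where Z: "{y \<in> space \<eta>. \<not> P y} \<subseteq> Z" "emeasure \<eta> Z = 0" "Z \<in> sets \<eta>"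
    using AE_E[OF P] by metis
  have Zb: "Z \<in> sets borel" using Z(3) by (simp add: \<eta>)
  have "AE Y in tuple_measure \<eta> n. \<forall>i\<in>{1..n}. Y i \<notin> Z"
  proof (induction n)
    case (Suc n)
    let ?S = "\<lambda>n. {Y \<in> space (borel_tuples n). \<exists>i\<in>{1..n}. Y i \<in> Z}"
    have S: "?S n \<in> sets (borel_tuples n)" for n
    proof -
      have "(\<lambda>Y. Y i) -` Z \<inter> space (borel_tuples n) \<in> sets (borel_tuples n)" if "i \<in> {1..n}" for i
        using measurable_sets[OF measurable_tuple_component[OF that] Zb] .
      then have "(\<Union>i\<in>{1..n}. (\<lambda>Y. Y i) -` Z \<inter> space (borel_tuples n)) \<in> sets (borel_tuples n)"
        by (intro sets.finite_UN) auto
      also have "(\<Union>i\<in>{1..n}. (\<lambda>Y. Y i) -` Z \<inter> space (borel_tuples n)) = ?S n" by auto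
      finally show ?thesis .
    qed
    have "emeasure (tuple_measure \<eta> (Suc n)) (?S (Suc n)) = integral\<^sup>N (tuple_measure \<eta> (Suc n)) (indicator (?S (Suc n)))"
      by (rule nn_integral_indicator[symmetric]) (simp only: sets_tuple_measure S)
    also have "\<dots> = (\<integral>\<^sup>+Y. (\<integral>\<^sup>+y. indicator (?S (Suc n)) (Y(Suc n := y)) \<partial>\<eta>) +
        (\<Sum>u\<in>Y ` {1..n}. indicator (?S (Suc n)) (Y(Suc n := u))) \<partial>tuple_measure \<eta> n)"
      by (rule nn_integral_tuple_measure_Suc[OF \<eta>]) (intro borel_measurable_indicator S)
    also have "\<dots> = (\<integral>\<^sup>+Y. 0 \<partial>tuple_measure \<eta> n)"
    proof (rule nn_integral_cong_AE, use Suc.IH in eventually_elim)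
      fix Y assume Y: "\<forall>i\<in>{1..n}. Y i \<notin> Z"
      have ind: "indicator (?S (Suc n)) (Y(Suc n := y)) \<le> (indicator Z y :: ennreal)" for y
        using Y by (auto simp: indicator_def le_Suc_eq split: if_splits)
      have "(\<integral>\<^sup>+y. indicator (?S (Suc n)) (Y(Suc n := y)) \<partial>\<eta>) \<le> (\<integral>\<^sup>+y. indicator Z y \<partial>\<eta>)"
        by (intro nn_integral_mono ind)
      also have "\<dots> = 0" using Z by simp
      finally have "(\<integral>\<^sup>+y. indicator (?S (Suc n)) (Y(Suc n := y)) \<partial>\<eta>) = 0" by simp
      moreover have "(\<Sum>u\<in>Y ` {1..n}. indicator (?S (Suc n)) (Y(Suc n := u)) :: ennreal) = 0"
      proof (intro sum.neutral ballI)
        fix u assume "u \<in> Y ` {1..n}"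
        then have "indicator Z u = (0 :: ennreal)" using Y by auto
        then show "indicator (?S (Suc n)) (Y(Suc n := u)) = (0 :: ennreal)" using ind[of u] by simp
      qed
      ultimately show "(\<integral>\<^sup>+y. indicator (?S (Suc n)) (Y(Suc n := y)) \<partial>\<eta>) +
        (\<Sum>u\<in>Y ` {1..n}. indicator (?S (Suc n)) (Y(Suc n := u))) = (0 :: ennreal)" by simp
    qed
    finally have "?S (Suc n) \<in> null_sets (tuple_measure \<eta> (Suc n))"
      using S[of "Suc n"] by (simp add: null_sets_def del: tuple_measure.simps)
    then show ?case by (rule AE_I') (auto simp del: tuple_measure.simps)
  qed simp
  then show ?thesis
    using Z(1) sets_eq_imp_space_eq[OF \<eta>(1)] by (auto elim!: eventually_mono)
qed

lemma non_atomic_singleton: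
  fixes M :: "'a::t1_space measure"
  assumes "non_atomic M" "sets M = sets borel" shows "emeasure M {y} = 0"
proof (rule ccontr)
  assume "emeasure M {y} \<noteq> 0"
  then obtain B where "B \<subseteq> {y}" "0 < emeasure M B" "emeasure M B < emeasure M {y}"
    using assms unfolding non_atomic_def by (metis borel_singleton sets.empty_sets not_gr_zero)
  then show False by (auto simp: subset_singleton_iff)
qed

section \<open>Almost everywhere versions of the kernel\<close>

context crm
begin

text \<open>For a tilted kernel, finiteness of all \<open>\<kappa>\<^sub>n\<close> does not make the kernel measurable on an
  \<open>\<eta>\<close>-null set, so we pass to a measurable version.\<close>

lemma crm_kappa_version:
  assumes kap: "\<And>n y. 1 \<le> n \<Longrightarrow> kappa h n \<rho> y < \<infinity>" and diffuse: "\<And>y. emeasure \<eta> {y} = 0"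
  obtains \<rho>' where "crm_kappa \<eta> \<rho>' h \<Omega> N" "AE y in \<eta>. \<rho> y = \<rho>' y" "intensity \<rho> \<eta> = intensity \<rho>' \<eta>"
proof -
  have rho_version_kernel: "rho_version \<in> measurable borel borel_measures"
    using sets_rho_version rho_version_measurable by (intro measurable_measures_algebra) auto
  have kapm[measurable]: "kappa h n rho_version \<in> borel_measurable borel" for n
    unfolding kappa_def by (rule measurable_compose[OF rho_version_kernel measurable_nn_integral_measures_algebra]) auto
  \<comment> \<open>\<open>Suc n\<close> leaves out \<open>kappa h 0\<close>, the total mass, which
    may be infinite; at the exceptional points the null measure makes every \<open>kappa\<close>
    equal to \<open>0\<close>.\<close>
  define \<rho>' where "\<rho>' = (\<lambda>y. if \<forall>n::nat. kappa h (Suc n) rho_version y < \<infinity> then rho_version y else null_measure borel)"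
  have AE: "AE y in \<eta>. \<rho> y = \<rho>' y"
    using rho_version_AE
  proof eventually_elim
    case (elim y)
    have "kappa h (Suc n) rho_version y < \<infinity>" for n
      using kap[of "Suc n" y] elim by (simp add: kappa_def)
    then show ?case using elim by (simp add: \<rho>'_def)
  qed
  have sets': "sets (\<rho>' y) = sets borel" for y by (simp add: \<rho>'_def sets_rho_version)
  have meas': "(\<lambda>y. emeasure (\<rho>' y) A) \<in> borel_measurable borel" if "A \<in> sets borel" for A
  proof -
    note [measurable] = rho_version_measurable[OF that]
    have "(\<lambda>y. if \<forall>n::nat. kappa h (Suc n) rho_version y < \<infinity> then emeasure (rho_version y) A else 0) \<in> borel_measurable borel"
      by measurable
    also have "(\<lambda>y. if \<forall>n::nat. kappa h (Suc n) rho_version y < \<infinity> then emeasure (rho_version y) A else 0) = (\<lambda>y. emeasure (\<rho>' y) A)"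
      by (auto simp: \<rho>'_def)
    finally show ?thesis .
  qed
  have int: "intensity \<rho> \<eta> = intensity \<rho>' \<eta>"
    unfolding intensity_def kernel_prod_cong_AE[OF AE] ..
  have base: "crm_base \<eta> \<rho>' h"
  proof (rule crm_base.intro)
    show "\<exists>\<rho>''. (\<forall>y. sets (\<rho>'' y) = sets borel \<and> (\<integral>\<^sup>+s. ennreal (min (h s) 1) \<partial>\<rho>'' y) < \<infinity>) \<and>
      (\<forall>A\<in>sets borel. (\<lambda>y. emeasure (\<rho>'' y) A) \<in> borel_measurable borel) \<and> (AE y in \<eta>. \<rho>' y = \<rho>'' y)"
      using sets' meas' rho_version_finite by (intro exI[of _ \<rho>']) (auto simp: \<rho>'_def)
    fix B :: "'y set" assume B: "B \<in> sets borel" "bounded B"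
    have "(\<integral>\<^sup>+y\<in>B. (\<integral>\<^sup>+s. ennreal (min (h s) 1) \<partial>\<rho>' y) \<partial>\<eta>) = (\<integral>\<^sup>+y\<in>B. (\<integral>\<^sup>+s. ennreal (min (h s) 1) \<partial>\<rho> y) \<partial>\<eta>)"
      using AE by (intro nn_integral_cong_AE) auto
    then show "(\<integral>\<^sup>+y\<in>B. (\<integral>\<^sup>+s. ennreal (min (h s) 1) \<partial>\<rho>' y) \<partial>\<eta>) < \<infinity>" using levy[OF B] by simp
  qed (use sets' h_pos sigma_finite_eta in \<open>simp_all add: sets_eta h_measurable\<close>)
  have "crm_kappa \<eta> \<rho>' h \<Omega> N"
  proof (intro crm_kappa.intro crm.intro base crm_kappa_axioms.intro)
    show "poisson_rm \<Omega> N (intensity \<rho>' \<eta>)"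
      unfolding int[symmetric] by unfold_locales
    show "kappa h n \<rho>' y < \<infinity>" if "1 \<le> n" for n y
    proof (cases "\<forall>n::nat. kappa h (Suc n) rho_version y < \<infinity>")
      case True
      then show ?thesis using that by (cases n) (auto simp: \<rho>'_def kappa_def)
    next
      case False
      then have "\<rho>' y = null_measure borel" by (simp only: \<rho>'_def if_False)
      then show ?thesis by (simp add: kappa_def)
    qed
  qed (use meas' diffuse in auto)
  then show ?thesis using AE int by (rule that)
qed

end

lemma crm_law_cong: "intensity \<rho> \<eta> = intensity \<rho>' \<eta> \<Longrightarrow> crm_law h \<rho> \<eta> = crm_law h \<rho>' \<eta>"
  by (simp add: crm_law_def prm_law_def)

lemma moment_measure_cong: "intensity \<rho> \<eta> = intensity \<rho>' \<eta> \<Longrightarrow> moment_measure h n \<rho> \<eta> = moment_measure h n \<rho>' \<eta>"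
  unfolding moment_measure_def by (simp only: crm_law_cong[of \<rho> \<eta> \<rho>'])

lemma posterior_law_cong:
  assumes int: "intensity \<rho> \<eta> = intensity \<rho>' \<eta>" and eq: "\<forall>i\<in>{1..n}. \<rho> (Y i) = \<rho>' (Y i)"
  shows "posterior_law h n \<rho> \<eta> Y = posterior_law h n \<rho>' \<eta> Y"
proof -
  have "PiM (distinct_values n Y) (\<lambda>v. jump_law h (card (block n Y v)) \<rho> v) =
      PiM (distinct_values n Y) (\<lambda>v. jump_law h (card (block n Y v)) \<rho>' v)"
    using eq by (intro PiM_cong refl) (auto simp: distinct_values_def jump_law_def kappa_def)
  then show ?thesis by (simp add: posterior_law_def crm_law_cong[OF int])
qed

text \<open>An \<open>\<eta>\<close>-null set of points is invisible to the intensity and,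
  coordinate by coordinate, to the moment measure, so the formula for the version transfers to the
  kernel itself.\<close>

lemma (in crm) disintegration_version:
  assumes kap: "\<And>n y. 1 \<le> n \<Longrightarrow> kappa h n \<rho> y < \<infinity>" and diffuse: "\<And>y. emeasure \<eta> {y} = 0"
  shows "kernel_prod (scale_measure l C) (borel_tuples n) (power_measure n) =
    distr (kernel_prod (scale_measure l (moment_measure h n \<rho> \<eta>)) boundedly_finite_measures (posterior_law h n \<rho> \<eta>))
      (boundedly_finite_measures \<Otimes>\<^sub>M borel_tuples n) prod.swap"
proof -
  obtain \<rho>' where V: "crm_kappa \<eta> \<rho>' h \<Omega> N" and AE: "AE y in \<eta>. \<rho> y = \<rho>' y" and int: "intensity \<rho> \<eta> = intensity \<rho>' \<eta>"
    using crm_kappa_version[OF kap diffuse] by metis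
  interpret V: crm_kappa \<eta> \<rho>' h \<Omega> N by (rule V)
  have "AE Y in tuple_measure \<eta> n. posterior_law h n \<rho> \<eta> Y = posterior_law h n \<rho>' \<eta> Y"
    using AE_tuple_measure[OF sets_eta sigma_finite_eta AE, of n]
    by eventually_elim (rule posterior_law_cong[OF int])
  then have "AE Y in V.MM n. posterior_law h n \<rho> \<eta> Y = posterior_law h n \<rho>' \<eta> Y"
    unfolding V.moment_measure_eq using V.kappa_prod_measurable
    by (subst AE_density) (auto simp: measurable_cong_sets[OF sets_tuple_measure refl] elim!: eventually_mono)
  then have "kernel_prod (scale_measure l (V.MM n)) boundedly_finite_measures (posterior_law h n \<rho> \<eta>) =
      kernel_prod (scale_measure l (V.MM n)) boundedly_finite_measures (posterior_law h n \<rho>' \<eta>)"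
    by (intro kernel_prod_cong_AE AE_scale_measure)
  then show ?thesis
    unfolding crm_law_cong[OF int] moment_measure_cong[OF int] V.disintegration by simp
qed

section \<open>Comparison of the tilted and untilted posterior laws\<close>

context crm_kappa
begin

text \<open>Finiteness of \<open>kappa h 1\<close> at every \<open>y\<close> makes
  \<open>cover\<close> an exhaustion by finite sets for each \<open>\<rho> y\<close>, so the tilted
  kernel is measurable everywhere and not only up to a null set.\<close>

lemma crm_kappa_exp_tilt:
  assumes f: "f \<in> borel_measurable borel" "\<And>x. 0 \<le> f x" and T: "crm \<eta> (exp_tilt f \<rho>) h P (\<lambda>N. N)"
  shows "crm_kappa \<eta> (exp_tilt f \<rho>) h P (\<lambda>N. N)"
proof (intro crm_kappa.intro crm_kappa_axioms.intro T)
  fix A :: "'s set" assume A[measurable]: "A \<in> sets borel"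
  have swapm: "(\<lambda>(y, s). (s, y)) \<in> measurable (borel \<Otimes>\<^sub>M borel) (borel :: ('s \<times> 'y) measure)"
    unfolding borel_prod[symmetric] by measurable
  have [measurable]: "(\<lambda>(y, s). f (s, y)) \<in> borel_measurable (borel \<Otimes>\<^sub>M borel)"
    using measurable_compose[OF swapm f(1)] by (simp add: case_prod_unfold)
  have "(\<integral>\<^sup>+s. ennreal (min (h s) 1) \<partial>\<rho> y) < \<infinity>" for y
  proof -
    have "(\<integral>\<^sup>+s. ennreal (min (h s) 1) \<partial>\<rho> y) \<le> kappa h 1 \<rho> y"
      unfolding kappa_def by (intro nn_integral_mono ennreal_leI) simp
    also have "\<dots> < \<infinity>" using kappa_finite[of 1] by simp
    finally show ?thesis .
  qed
  then have cov: "emeasure (\<rho> y) (cover k) < \<infinity>" for y k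
    by (rule emeasure_cover_finite[OF sets_rho])
  have "(\<lambda>y. \<integral>\<^sup>+s. (\<lambda>(y, s). ennreal (exp (- f (s, y))) * indicator A s) (y, s) \<partial>\<rho> y) \<in> borel_measurable borel"
  proof (rule measurable_nn_integral_kernel[where D = cover and R = borel])
    show "(\<lambda>(y, s). ennreal (exp (- f (s, y))) * indicator A s) \<in> borel_measurable (borel \<Otimes>\<^sub>M borel)" by measurable
  qed (use sets_rho rho_measurable incseq_cover UN_cover cov in auto)
  moreover have "emeasure (exp_tilt f \<rho> y) A = (\<integral>\<^sup>+s. ennreal (exp (- f (s, y))) * indicator A s \<partial>\<rho> y)" for y
    using nn_integral_exp_tilt[where \<rho> = \<rho> and y = y, OF f(1) sets_rho, of "indicator A"] by (simp add: sets_exp_tilt sets_rho)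
  ultimately show "(\<lambda>y. emeasure (exp_tilt f \<rho> y) A) \<in> borel_measurable borel" by simp
next
  fix n y assume "1 \<le> (n :: nat)"
  have "kappa h n (exp_tilt f \<rho>) y \<le> kappa h n \<rho> y"
    unfolding kappa_def by (rule nn_integral_exp_tilt_le[OF f sets_rho]) measurable
  also have "\<dots> < \<infinity>" by (rule kappa_finite) fact
  finally show "kappa h n (exp_tilt f \<rho>) y < \<infinity>" .
qed (rule diffuse)

text \<open>Both sides integrate \<open>h^e\<close> against \<open>\<rho> v\<close>, with the extra
  factor \<open>e^{-f}\<close> after tilting. The ratio is the expectation of \<open>e^{-f}\<close>
  under the jump law, the factor in the final product formula.\<close>

lemma kappa_exp_tilt:
  assumes f: "f \<in> borel_measurable borel" and e: "1 \<le> e"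
  shows "kappa h e (exp_tilt f \<rho>) v = kappa h e \<rho> v * (\<integral>\<^sup>+s. ennreal (exp (- f (s, v))) \<partial>jump_law h e \<rho> v)"
proof -
  have "(\<lambda>s. (s, v)) \<in> measurable borel (borel :: ('s \<times> 'y) measure)"
    unfolding borel_prod[symmetric] by measurable
  from measurable_compose[OF this f] have [measurable]: "(\<lambda>s. f (s, v)) \<in> borel_measurable borel" .
  have "kappa h e (exp_tilt f \<rho>) v = (\<integral>\<^sup>+s. ennreal (h s ^ e) * ennreal (exp (- f (s, v))) \<partial>\<rho> v)"
    unfolding kappa_def by (subst nn_integral_exp_tilt[where \<rho> = \<rho>, OF f sets_rho]) (auto simp: mult.commute)
  then show ?thesis
    using kappa_finite[OF e, of v]
    by (cases "kappa h e \<rho> v = 0")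
      (auto simp: nn_integral_jump_law kappa_eq_0 ennreal_times_divide mult_divide_eq_ennreal mult.commute[of "kappa h e \<rho> v"])
qed

text \<open>\<open>f\<close> is real-valued, so \<open>e^{-f}\<close> is strictly positive and
  tilting creates no new zeros.\<close>

lemma kappa_exp_tilt_eq_0:
  assumes f: "f \<in> borel_measurable borel" and z: "kappa h e (exp_tilt f \<rho>) v = 0"
  shows "kappa h e \<rho> v = 0"
proof -
  have "(\<lambda>s. (s, v)) \<in> measurable borel (borel :: ('s \<times> 'y) measure)"
    unfolding borel_prod[symmetric] by measurable
  from measurable_compose[OF this f] have [measurable]: "(\<lambda>s. f (s, v)) \<in> borel_measurable borel" .
  note [measurable_cong] = sets_rho
  have "(\<integral>\<^sup>+s. ennreal (exp (- f (s, v))) * ennreal (h s ^ e) \<partial>\<rho> v) = 0"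
    using z unfolding kappa_def by (subst (asm) nn_integral_exp_tilt[where \<rho> = \<rho>, OF f sets_rho]) auto
  then have "AE s in \<rho> v. ennreal (exp (- f (s, v))) * ennreal (h s ^ e) = 0"
    by (subst (asm) nn_integral_0_iff_AE) auto
  then have "AE s in \<rho> v. ennreal (h s ^ e) = 0"
    by eventually_elim (simp add: ennreal_eq_0_iff)
  then show ?thesis unfolding kappa_def by (subst nn_integral_0_iff_AE) auto
qed

definition tilt_prod :: "('s \<times> 'y \<Rightarrow> real) \<Rightarrow> nat \<Rightarrow> (nat \<Rightarrow> 'y) \<Rightarrow> ennreal" where
  "tilt_prod f n Y = (\<Prod>v\<in>distinct_values n Y. \<integral>\<^sup>+s. ennreal (exp (- f (s, v))) \<partial>jump_law h (card (block n Y v)) \<rho> v)"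

lemma AE_moment_measure_kappa_prod: "AE Y in MM n. kappa_prod n Y \<noteq> 0"
  unfolding moment_measure_eq using kappa_prod_measurable
  by (subst AE_density) (auto simp: measurable_cong_sets[OF sets_tuple_measure refl])

lemma sigma_finite_moment_measure: "sigma_finite_measure (MM n)"
proof -
  interpret sigma_finite_measure "tuple_measure \<eta> n"
    by (rule sigma_finite_tuple_measure[OF sets_eta sigma_finite_eta])
  have "kappa_prod n \<in> borel_measurable (tuple_measure \<eta> n)"
    using kappa_prod_measurable by (simp add: measurable_cong_sets[OF sets_tuple_measure refl])
  then show ?thesis
    unfolding moment_measure_eq using kappa_prod_less_top[of n]
    by (subst sigma_finite_iff_density_finite) (auto intro!: AE_I2 simp: less_top)
qed

text \<open>\<open>w\<close> times the joint law of \<open>\<mu>\<close> and \<open>Y\<close>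
  disintegrates in two ways, through the posterior of \<open>\<rho>\<close> and through that of the
  tilted kernel; both Palm densities refer to the same \<open>tuple_measure\<close>, and their ratio
  is \<open>tilt_prod\<close>. The exceptional null set of an almost sure identity depends on the
  test function, so only countably many are tested: the \<open>e L\<close> with \<open>L\<close> a
  list over a countable generator.\<close>

theorem posterior_law_tilt:
  assumes f: "f \<in> borel_measurable borel" "\<And>x. 0 \<le> f x"
    and w[measurable]: "w \<in> borel_measurable boundedly_finite_measures"
    and T: "crm_kappa \<eta> (exp_tilt f \<rho>) h P (\<lambda>N. N)"
    and l: "l < \<infinity>" and dens: "density C w = scale_measure l (crm_law h (exp_tilt f \<rho>) \<eta>)"
  shows "AE Y in MM n. density (posterior_law h n \<rho> \<eta> Y) w = scale_measure (l * tilt_prod f n Y) (posterior_law h n (exp_tilt f \<rho>) \<eta> Y)"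
    and "AE Y in MM n. integral\<^sup>N (posterior_law h n \<rho> \<eta> Y) w = l * tilt_prod f n Y"
    and "scale_measure l (moment_measure h n (exp_tilt f \<rho>) \<eta>) = density (MM n) (\<lambda>Y. integral\<^sup>N (posterior_law h n \<rho> \<eta> Y) w)"
proof -
  interpret T: crm_kappa \<eta> "exp_tilt f \<rho>" h P "\<lambda>N. N" by (rule T)
  interpret MM: sigma_finite_measure "MM n" by (rule sigma_finite_moment_measure)
  let ?B = "boundedly_finite_measures :: 'y measure measure"
  obtain G :: "'y set set" and D where G: "countable G" "Int_stable G" "sigma_sets UNIV G = sets borel"
    "\<And>A. A \<in> G \<Longrightarrow> bounded A" "range D \<subseteq> G" "incseq D" "(\<Union>k. D k) = UNIV"
    by (rule bounded_generator_exists, rule that)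
  have GB: "G \<subseteq> sets borel" using G(3) by blast
  define e where "e = (\<lambda>L (\<mu> :: 'y measure). nexp (\<Sum>A\<leftarrow>L. emeasure \<mu> A))"
  have em[measurable]: "e L \<in> borel_measurable ?B" if "L \<in> lists G" for L
  proof -
    have "(\<lambda>\<mu>. \<Sum>A\<leftarrow>L. emeasure \<mu> A) \<in> borel_measurable ?B"
      using that
    proof (induction L)
      case (Cons A L)
      then have "A \<in> sets borel" using GB by auto
      with Cons show ?case by (simp add: measurable_emeasure_measures_algebra)
    qed simp
    from measurable_compose[OF this borel_measurable_nexp] show ?thesis unfolding e_def .
  qed
  have Tk: "T.kappa_prod n Y = kappa_prod n Y * tilt_prod f n Y" for Y
    unfolding T.kappa_prod_def kappa_prod_def tilt_prod_def prod.distrib[symmetric]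
    using card_block_pos[of _ Y n] by (intro prod.cong refl kappa_exp_tilt[OF f(1)]) (auto simp: distinct_values_def)
  have T0: "kappa_prod n Y = 0" if "T.kappa_prod n Y = 0" for Y
    using that kappa_exp_tilt_eq_0[OF f(1)] unfolding T.kappa_prod_def kappa_prod_def
    by (auto simp: distinct_values_def)
  have ratio: "T.kappa_prod n Y / kappa_prod n Y = tilt_prod f n Y" if "kappa_prod n Y \<noteq> 0" for Y
    unfolding Tk using that kappa_prod_less_top[of n Y] mult_divide_eq_ennreal[of "kappa_prod n Y" "tilt_prod f n Y"]
    by (simp add: mult.commute)
  \<comment> \<open>Valid also where \<open>kappa_prod n Y = 0\<close>, as the tilted product
    vanishes there too; under \<open>tuple_measure\<close> such tuples may carry mass.\<close>
  have cancel: "kappa_prod n Y * (T.kappa_prod n Y / kappa_prod n Y) = T.kappa_prod n Y" for Y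
    using ratio[of Y] by (cases "kappa_prod n Y = 0") (simp_all add: Tk)
  have kr: "(\<lambda>Y. T.kappa_prod n Y / kappa_prod n Y) \<in> borel_measurable (borel_tuples n)"
    using kappa_prod_measurable T.kappa_prod_measurable by measurable
  \<comment> \<open>The quotient of the two products stands in for \<open>tilt_prod\<close>: its
    measurability in \<open>Y\<close> is at hand, and the two agree off a null set of the moment
    measure.\<close>
  have AEL: "AE Y in MM n. (\<integral>\<^sup>+\<mu>. w \<mu> * e L \<mu> \<partial>posterior_law h n \<rho> \<eta> Y) =
      l * (T.kappa_prod n Y / kappa_prod n Y) * (\<integral>\<^sup>+\<mu>. e L \<mu> \<partial>posterior_law h n (exp_tilt f \<rho>) \<eta> Y)"
    if L: "L \<in> lists G" for L
  proof -
    define a where "a = (\<lambda>Y. \<integral>\<^sup>+\<mu>. w \<mu> * e L \<mu> \<partial>posterior_law h n \<rho> \<eta> Y)"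
    define b where "b = (\<lambda>Y. l * (T.kappa_prod n Y / kappa_prod n Y) * (\<integral>\<^sup>+\<mu>. e L \<mu> \<partial>posterior_law h n (exp_tilt f \<rho>) \<eta> Y))"
    note [measurable] = em[OF L]
    have am: "a \<in> borel_measurable (borel_tuples n)"
      unfolding a_def using posterior_law_kernel[of "\<lambda>(\<mu>, Y). w \<mu> * e L \<mu>" n] by simp
    have bm: "b \<in> borel_measurable (borel_tuples n)"
    proof -
      have "(\<lambda>Y. \<integral>\<^sup>+\<mu>. e L \<mu> \<partial>posterior_law h n (exp_tilt f \<rho>) \<eta> Y) \<in> borel_measurable (borel_tuples n)"
        using T.posterior_law_kernel[of "\<lambda>(\<mu>, Y). e L \<mu>" n] by simp
      then show ?thesis unfolding b_def using kr by measurable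
    qed
    \<comment> \<open>Both measures give \<open>S\<close> the integral of \<open>F\<close> under
      \<open>w(\<mu>)\<close> times the joint law of \<open>\<mu>\<close> and \<open>Y\<close>,
      computed through one Palm formula each.\<close>
    have "density (MM n) a = density (MM n) b"
    proof (rule measure_eqI)
      fix S assume "S \<in> sets (density (MM n) a)"
      then have S[measurable]: "S \<in> sets (borel_tuples n)" by simp
      define F where "F = (\<lambda>(\<mu>, Y). e L \<mu> * indicator S Y)"
      have F: "F \<in> borel_measurable (?B \<Otimes>\<^sub>M borel_tuples n)" unfolding F_def by measurable
      have wF: "(\<lambda>(\<mu>, Y). w \<mu> * F (\<mu>, Y)) \<in> borel_measurable (?B \<Otimes>\<^sub>M borel_tuples n)" unfolding F_def by measurable
      have em1: "emeasure (density (MM n) u) S = (\<integral>\<^sup>+Y. kappa_prod n Y * (u Y * indicator S Y) \<partial>tuple_measure \<eta> n)"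
        if "u \<in> borel_measurable (borel_tuples n)" for u
        using that S by (subst emeasure_density) (auto simp: measurable_cong_sets[OF sets_moment_measure refl] intro!: nn_integral_moment_measure)
      have "emeasure (density (MM n) a) S = (\<integral>\<^sup>+Y. kappa_prod n Y * (a Y * indicator S Y) \<partial>tuple_measure \<eta> n)"
        by (rule em1[OF am])
      also have "\<dots> = (\<integral>\<^sup>+Y. kappa_prod n Y * (\<integral>\<^sup>+\<mu>. w \<mu> * F (\<mu>, Y) \<partial>posterior_law h n \<rho> \<eta> Y) \<partial>tuple_measure \<eta> n)"
        unfolding a_def F_def
        by (intro nn_integral_cong) (simp add: nn_integral_multc[symmetric] mult.assoc)
      also have "\<dots> = (\<integral>\<^sup>+\<mu>. \<integral>\<^sup>+Y. w \<mu> * F (\<mu>, Y) \<partial>power_measure n \<mu> \<partial>C)"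
        using palm_formula_posterior[OF wF] by simp
      also have "\<dots> = (\<integral>\<^sup>+\<mu>. w \<mu> * (\<integral>\<^sup>+Y. F (\<mu>, Y) \<partial>power_measure n \<mu>) \<partial>C)"
      proof (intro nn_integral_cong nn_integral_cmult)
        fix \<mu> assume "\<mu> \<in> space C"
        then have \<mu>: "\<mu> \<in> space ?B" "sets \<mu> = sets borel" by (simp_all add: boundedly_finite_def)
        show "(\<lambda>Y. F (\<mu>, Y)) \<in> borel_measurable (power_measure n \<mu>)"
          unfolding measurable_cong_sets[OF sets_power_measure[OF \<mu>(2)] refl]
          by (rule measurable_compose[OF measurable_Pair1'[OF \<mu>(1)] F])
      qed
      also have "\<dots> = (\<integral>\<^sup>+\<mu>. \<integral>\<^sup>+Y. F (\<mu>, Y) \<partial>power_measure n \<mu> \<partial>density C w)"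
        using measurable_nn_integral_power_measure[OF F] by (intro nn_integral_density[symmetric]) simp_all
      also have "\<dots> = l * (\<integral>\<^sup>+\<mu>. \<integral>\<^sup>+Y. F (\<mu>, Y) \<partial>power_measure n \<mu> \<partial>T.C)"
        unfolding dens using measurable_nn_integral_power_measure[OF F] by (intro nn_integral_scale_measure) simp
      also have "\<dots> = l * (\<integral>\<^sup>+Y. T.kappa_prod n Y * (\<integral>\<^sup>+\<mu>. F (\<mu>, Y) \<partial>posterior_law h n (exp_tilt f \<rho>) \<eta> Y) \<partial>tuple_measure \<eta> n)"
        by (simp only: T.palm_formula_posterior[OF F])
      also have "\<dots> = (\<integral>\<^sup>+Y. l * (T.kappa_prod n Y * (\<integral>\<^sup>+\<mu>. F (\<mu>, Y) \<partial>posterior_law h n (exp_tilt f \<rho>) \<eta> Y)) \<partial>tuple_measure \<eta> n)"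
        using T.posterior_law_kernel[OF F] T.kappa_prod_measurable
        by (intro nn_integral_cmult[symmetric]) (simp add: measurable_cong_sets[OF sets_tuple_measure refl])
      also have "\<dots> = emeasure (density (MM n) b) S"
        unfolding em1[OF bm]
      proof (intro nn_integral_cong)
        fix Y
        have "(\<integral>\<^sup>+\<mu>. F (\<mu>, Y) \<partial>posterior_law h n (exp_tilt f \<rho>) \<eta> Y) = (\<integral>\<^sup>+\<mu>. e L \<mu> \<partial>posterior_law h n (exp_tilt f \<rho>) \<eta> Y) * indicator S Y"
          unfolding F_def by (simp add: nn_integral_multc)
        then have "l * (T.kappa_prod n Y * (\<integral>\<^sup>+\<mu>. F (\<mu>, Y) \<partial>posterior_law h n (exp_tilt f \<rho>) \<eta> Y)) =
          (kappa_prod n Y * (T.kappa_prod n Y / kappa_prod n Y)) * (l * ((\<integral>\<^sup>+\<mu>. e L \<mu> \<partial>posterior_law h n (exp_tilt f \<rho>) \<eta> Y) * indicator S Y))"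
          unfolding cancel by (simp add: mult_ac)
        then show "l * (T.kappa_prod n Y * (\<integral>\<^sup>+\<mu>. F (\<mu>, Y) \<partial>posterior_law h n (exp_tilt f \<rho>) \<eta> Y)) = kappa_prod n Y * (b Y * indicator S Y)"
          unfolding b_def by (simp only: mult_ac)
      qed
      finally show "emeasure (density (MM n) a) S = emeasure (density (MM n) b) S" .
    qed simp
    \<comment> \<open>Sigma-finiteness of the moment measure enters here: it makes densities unique
      almost everywhere.\<close>
    then have "AE Y in MM n. a Y = b Y"
      using am bm by (intro MM.density_unique) (simp_all add: measurable_cong_sets[OF sets_moment_measure refl])
    then show ?thesis unfolding a_def b_def .
  qed
  have "AE Y in MM n. \<forall>L\<in>lists G. (\<integral>\<^sup>+\<mu>. w \<mu> * e L \<mu> \<partial>posterior_law h n \<rho> \<eta> Y) =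
      l * (T.kappa_prod n Y / kappa_prod n Y) * (\<integral>\<^sup>+\<mu>. e L \<mu> \<partial>posterior_law h n (exp_tilt f \<rho>) \<eta> Y)"
    using AEL by (intro AE_ball_countable') (auto intro: countable_lists G(1))
  then have key: "AE Y in MM n. density (posterior_law h n \<rho> \<eta> Y) w = scale_measure (l * tilt_prod f n Y) (posterior_law h n (exp_tilt f \<rho>) \<eta> Y) \<and>
      integral\<^sup>N (posterior_law h n \<rho> \<eta> Y) w = l * tilt_prod f n Y"
    using AE_moment_measure_kappa_prod
  proof eventually_elim
    case (elim Y)
    let ?post = "posterior_law h n \<rho> \<eta> Y" and ?postT = "posterior_law h n (exp_tilt f \<rho>) \<eta> Y"
    have r: "T.kappa_prod n Y / kappa_prod n Y = tilt_prod f n Y" by (rule ratio[OF elim(2)])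
    have Tn0: "T.kappa_prod n Y \<noteq> 0" using T0 elim(2) by auto
    have tf: "tilt_prod f n Y < \<infinity>"
      unfolding r[symmetric] using elim(2) T.kappa_prod_less_top[of n Y]
      by (simp add: less_top[symmetric] ennreal_divide_eq_top_iff)
    have mass: "emeasure ?postT (Collect boundedly_finite) = 1" by (rule T.posterior_law_prob[OF Tn0])
    have lapeq: "(\<integral>\<^sup>+\<mu>. e L \<mu> \<partial>density ?post w) = (\<integral>\<^sup>+\<mu>. e L \<mu> \<partial>scale_measure (l * tilt_prod f n Y) ?postT)"
      if "L \<in> lists G" for L
      using elim(1)[rule_format, OF that] em[OF that] unfolding r
      by (simp add: nn_integral_density nn_integral_scale_measure)
    \<comment> \<open>The empty list tests against \<open>1\<close>, which yields the normalising
      constant.\<close>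
    have e0: "e [] = (\<lambda>_. 1)" by (simp add: e_def)
    have int: "integral\<^sup>N ?post w = l * tilt_prod f n Y"
      using elim(1)[rule_format, of "[]"] mass unfolding r e0 by simp
    have "density ?post w = scale_measure (l * tilt_prod f n Y) ?postT"
    proof (rule finite_measure_eqI_laplace_functional[where G = G])
      have fin: "l * tilt_prod f n Y < \<infinity>" using l tf by (simp add: ennreal_mult_less_top)
      show "finite_measure (density ?post w)"
      proof (rule finite_measureI)
        have "emeasure (density ?post w) (space (density ?post w)) = (\<integral>\<^sup>+\<mu>. 1 \<partial>density ?post w)" by simp
        also have "\<dots> = l * tilt_prod f n Y" using int by (subst nn_integral_density) auto
        finally show "emeasure (density ?post w) (space (density ?post w)) \<noteq> \<infinity>" using fin by simp
      qed
      show "finite_measure (scale_measure (l * tilt_prod f n Y) ?postT)"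
        using fin mass by (intro finite_measureI) (simp add: space_scale_measure)
      show "G \<subseteq> sets borel" by (rule GB)
      show "(\<integral>\<^sup>+\<mu>. nexp (\<Sum>A\<leftarrow>L. emeasure \<mu> A) \<partial>density ?post w) = (\<integral>\<^sup>+\<mu>. nexp (\<Sum>A\<leftarrow>L. emeasure \<mu> A) \<partial>scale_measure (l * tilt_prod f n Y) ?postT)"
        if "set L \<subseteq> G" for L
        using lapeq[of L] that unfolding e_def by (auto simp: in_lists_conv_set)
      fix A :: "'y set" and M' :: "'y measure measure"
      assume M': "space M' = Collect boundedly_finite" "\<And>A. A \<in> G \<Longrightarrow> (\<lambda>M. emeasure M A) \<in> borel_measurable M'" "A \<in> sets borel"
      show "(\<lambda>M. emeasure M A) \<in> borel_measurable M'"
      \<comment> \<open>The exhaustion \<open>D\<close> is taken from the bounded generator, so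
        boundedly finite measures are finite on it and evaluations at \<open>G\<close> determine all
        others.\<close>
      proof (rule measurable_emeasure_generated[OF _ G(2,3,5,6,7) _ M'(2,3)])
        show "sets a = sets borel" if "a \<in> space M'" for a using that M'(1) by (simp add: boundedly_finite_def)
        show "emeasure a (D k) < \<infinity>" if "a \<in> space M'" for a k
        proof -
          have "D k \<in> G" using G(5) by auto
          then have "bounded (D k)" "D k \<in> sets borel" using G(4) GB by auto
          then show ?thesis using that M'(1) by (simp add: boundedly_finite_def)
        qed
      qed
    qed simp_all
    with int show ?case by simp
  qed
  then show "AE Y in MM n. density (posterior_law h n \<rho> \<eta> Y) w = scale_measure (l * tilt_prod f n Y) (posterior_law h n (exp_tilt f \<rho>) \<eta> Y)"
    by eventually_elim simp
  show int: "AE Y in MM n. integral\<^sup>N (posterior_law h n \<rho> \<eta> Y) w = l * tilt_prod f n Y"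
    using key by eventually_elim simp
  have wk: "(\<lambda>Y. integral\<^sup>N (posterior_law h n \<rho> \<eta> Y) w) \<in> borel_measurable (MM n)"
    using posterior_law_kernel[of "\<lambda>(\<mu>, Y). w \<mu>" n] by (simp add: measurable_cong_sets[OF sets_moment_measure refl])
  have rm: "(\<lambda>Y. l * (T.kappa_prod n Y / kappa_prod n Y)) \<in> borel_measurable (borel_tuples n)" using kr by measurable
  have "density (MM n) (\<lambda>Y. integral\<^sup>N (posterior_law h n \<rho> \<eta> Y) w) = density (MM n) (\<lambda>Y. l * (T.kappa_prod n Y / kappa_prod n Y))"
  proof (rule density_cong[OF wk])
    show "(\<lambda>Y. l * (T.kappa_prod n Y / kappa_prod n Y)) \<in> borel_measurable (MM n)"
      using rm by (simp add: measurable_cong_sets[OF sets_moment_measure refl])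
    show "AE Y in MM n. integral\<^sup>N (posterior_law h n \<rho> \<eta> Y) w = l * (T.kappa_prod n Y / kappa_prod n Y)"
      using int AE_moment_measure_kappa_prod by eventually_elim (simp add: ratio)
  qed
  also have "\<dots> = scale_measure l (T.MM n)"
  proof (rule measure_eqI)
    fix S assume "S \<in> sets (density (MM n) (\<lambda>Y. l * (T.kappa_prod n Y / kappa_prod n Y)))"
    then have S[measurable]: "S \<in> sets (borel_tuples n)" by simp
    have "emeasure (density (MM n) (\<lambda>Y. l * (T.kappa_prod n Y / kappa_prod n Y))) S =
        (\<integral>\<^sup>+Y. kappa_prod n Y * (l * (T.kappa_prod n Y / kappa_prod n Y) * indicator S Y) \<partial>tuple_measure \<eta> n)"
      using rm S by (subst emeasure_density) (auto simp: measurable_cong_sets[OF sets_moment_measure refl] intro!: nn_integral_moment_measure)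
    also have "\<dots> = (\<integral>\<^sup>+Y. l * (T.kappa_prod n Y * indicator S Y) \<partial>tuple_measure \<eta> n)"
    proof (intro nn_integral_cong)
      fix Y
      show "kappa_prod n Y * (l * (T.kappa_prod n Y / kappa_prod n Y) * indicator S Y) = l * (T.kappa_prod n Y * indicator S Y)"
        unfolding arg_cong[OF cancel[of Y, symmetric], of "\<lambda>t. l * (t * indicator S Y)"] by (simp only: mult_ac)
    qed
    also have "\<dots> = l * (\<integral>\<^sup>+Y. T.kappa_prod n Y * indicator S Y \<partial>tuple_measure \<eta> n)"
      using T.kappa_prod_measurable S
      by (intro nn_integral_cmult) (simp add: measurable_cong_sets[OF sets_tuple_measure refl])
    also have "\<dots> = l * emeasure (T.MM n) S"
      using S by (subst T.nn_integral_moment_measure[symmetric]) simp_all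
    finally show "emeasure (density (MM n) (\<lambda>Y. l * (T.kappa_prod n Y / kappa_prod n Y))) S = emeasure (scale_measure l (T.MM n)) S" by simp
  qed simp
  finally show "scale_measure l (moment_measure h n (exp_tilt f \<rho>) \<eta>) = density (MM n) (\<lambda>Y. integral\<^sup>N (posterior_law h n \<rho> \<eta> Y) w)" by simp
qed

end

theorem proposition3p1:
  fixes \<eta> :: "'y::polish_space measure"
    and \<rho> :: "'y \<Rightarrow> 's::polish_space measure"
    and h :: "'s \<Rightarrow> real"
    and \<Omega> :: "'w measure"
    and N :: "'w \<Rightarrow> ('s \<times> 'y) measure"
    and f :: "'s \<times> 'y \<Rightarrow> real"
    and w :: "'y measure \<Rightarrow> real"
  assumes sets_eta: "sets \<eta> = sets borel"
    and sigma_finite_eta: "sigma_finite_measure \<eta>"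
    and non_atomic_eta: "non_atomic \<eta>"
    and kernel_rho: "sigma_finite_kernel \<rho>"
    and h_measurable: "h \<in> borel_measurable borel"
    and h_pos: "\<And>s. 0 < h s"
    and levy: "\<And>B. B \<in> sets borel \<Longrightarrow> bounded B \<Longrightarrow>
      (\<integral>\<^sup>+y\<in>B. (\<integral>\<^sup>+s. ennreal (min (h s) 1) \<partial>\<rho> y) \<partial>\<eta>) < \<infinity>"
    and N_poisson: "poisson_random_measure \<Omega> N (intensity \<rho> \<eta>)"
    and f_measurable: "f \<in> borel_measurable borel"
    and f_pos: "\<And>x. 0 \<le> f x"
    and w_pos: "\<And>\<mu>. boundedly_finite \<mu> \<Longrightarrow> 0 < w \<mu>"
    and w_integrable: "integrable (crm_law h \<rho> \<eta>) w"
    and w_repr: "AE \<omega> in \<Omega>. w (mixed_measure h (N \<omega>)) = exp_neg (\<integral>\<^sup>+x. ennreal (f x) \<partial>N \<omega>)"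
  shows
    \<comment> \<open>(i)\<close>
    "(density (crm_law h \<rho> \<eta>) (\<lambda>\<mu>. ennreal (w \<mu>))
        = scale_measure (\<integral>\<^sup>+\<mu>. ennreal (w \<mu>) \<partial>crm_law h \<rho> \<eta>) (crm_law h (exp_tilt f \<rho>) \<eta>)
      \<and> scale_measure (\<integral>\<^sup>+\<mu>. ennreal (w \<mu>) \<partial>crm_law h \<rho> \<eta>) (crm_law h (exp_tilt f \<rho>) \<eta>)
        = scale_measure (ennreal (laplace_prm f \<rho> \<eta>)) (crm_law h (exp_tilt f \<rho>) \<eta>))
    \<and>
    \<comment> \<open>(ii)\<close>
    ((\<forall>n\<ge>1. \<forall>y. kappa h n (exp_tilt f \<rho>) y < \<infinity>) \<longrightarrow>
      (\<forall>n\<ge>1.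
        kernel_prod (density (crm_law h \<rho> \<eta>) (\<lambda>\<mu>. ennreal (w \<mu>)))
          (borel_tuples n) (power_measure n)
        = distr
            (kernel_prod
              (scale_measure (ennreal (laplace_prm f \<rho> \<eta>)) (moment_measure h n (exp_tilt f \<rho>) \<eta>))
              boundedly_finite_measures
              (\<lambda>Y. posterior_law h n (exp_tilt f \<rho>) \<eta> Y))
            (boundedly_finite_measures \<Otimes>\<^sub>M borel_tuples n) prod.swap))
    \<and>
    \<comment> \<open>(iii)\<close>
    ((\<forall>n\<ge>1. \<forall>y. kappa h n \<rho> y < \<infinity>) \<longrightarrow>
      (\<forall>n\<ge>1.
        (AE Y in moment_measure h n \<rho> \<eta>.
          density (posterior_law h n \<rho> \<eta> Y) (\<lambda>\<mu>. ennreal (w \<mu>))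
          = scale_measure (\<integral>\<^sup>+\<mu>. ennreal (w \<mu>) \<partial>posterior_law h n \<rho> \<eta> Y)
              (posterior_law h n (exp_tilt f \<rho>) \<eta> Y))
        \<and>
        scale_measure (ennreal (laplace_prm f \<rho> \<eta>)) (moment_measure h n (exp_tilt f \<rho>) \<eta>)
          = density (moment_measure h n \<rho> \<eta>)
              (\<lambda>Y. \<integral>\<^sup>+\<mu>. ennreal (w \<mu>) \<partial>posterior_law h n \<rho> \<eta> Y)
        \<and>
        (AE Y in moment_measure h n \<rho> \<eta>.
          (\<integral>\<^sup>+\<mu>. ennreal (w \<mu>) \<partial>posterior_law h n \<rho> \<eta> Y)
          = ennreal (laplace_prm f \<rho> \<eta>) *
              (\<Prod>v\<in>distinct_values n Y.
                 \<integral>\<^sup>+s. ennreal (exp (- f (s, v))) \<partial>jump_law h (card (block n Y v)) \<rho> v))))"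
proof -
  have base: "crm_base \<eta> \<rho> h"
    by (rule crm_base_sigma_finite_kernel[OF sets_eta sigma_finite_eta kernel_rho h_measurable h_pos levy])
  interpret crm \<eta> \<rho> h \<Omega> N
    by (intro crm.intro poisson_rm.intro base N_poisson crm_base.sets_intensity[OF base])
  have diffuse: "emeasure \<eta> {y} = 0" for y by (rule non_atomic_singleton[OF non_atomic_eta sets_eta])
  have w[measurable]: "(\<lambda>\<mu>. ennreal (w \<mu>)) \<in> borel_measurable boundedly_finite_measures"
    using borel_measurable_integrable[OF w_integrable] by (simp add: measurable_cong_sets[OF sets_C refl])
  have repr: "AE \<omega> in \<Omega>. ennreal (w (mixed_measure h (N \<omega>))) = nexp (\<integral>\<^sup>+x. ennreal (f x) \<partial>N \<omega>)"
    using w_repr by eventually_elim (simp add: nexp_def)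
  \<comment> \<open>Were it zero, \<open>e^{-N(f)}\<close> would have expectation \<open>0\<close>,
    and \<open>w\<close> would vanish almost surely on a probability space.\<close>
  have L: "laplace_prm f \<rho> \<eta> \<noteq> 0"
  proof
    assume "laplace_prm f \<rho> \<eta> = 0"
    then have "(\<integral>\<^sup>+\<omega>. nexp (\<integral>\<^sup>+x. ennreal (f x) \<partial>N \<omega>) \<partial>\<Omega>) = 0"
      using laplace_prm_eq[OF f_measurable f_pos] laplace[of "\<lambda>x. ennreal (f x)"] f_measurable by simp
    then have "AE \<omega> in \<Omega>. nexp (\<integral>\<^sup>+x. ennreal (f x) \<partial>N \<omega>) = 0"
      using f_measurable by (subst (asm) nn_integral_0_iff_AE) (auto intro!: measurable_compose[OF measurable_integral_N borel_measurable_nexp])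
    with repr have "AE \<omega> in \<Omega>. False"
    proof eventually_elim
      case (elim \<omega>)
      then show ?case
        using w_pos[OF boundedly_finite_mixed_measure, of h "N \<omega>"] by (simp add: ennreal_eq_0_iff)
    qed
    then show False by simp
  qed
  obtain P where T: "crm \<eta> (exp_tilt f \<rho>) h P (\<lambda>N. N)"
    using crm_exp_tilt[OF f_measurable f_pos L] .
  interpret T: crm \<eta> "exp_tilt f \<rho>" h P "\<lambda>N. N" by (rule T)
  note dens = density_crm_law[OF f_measurable f_pos w repr T]
  show ?thesis
  proof (intro conjI impI allI)
    show "density C (\<lambda>\<mu>. ennreal (w \<mu>)) = scale_measure (\<integral>\<^sup>+\<mu>. ennreal (w \<mu>) \<partial>C) T.C"
      using dens by simp
    show "scale_measure (\<integral>\<^sup>+\<mu>. ennreal (w \<mu>) \<partial>C) T.C = scale_measure (ennreal (laplace_prm f \<rho> \<eta>)) T.C"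
      using dens(2) by simp
  next
    fix n :: nat assume "\<forall>n\<ge>1. \<forall>y. kappa h n (exp_tilt f \<rho>) y < \<infinity>"
    then have "kappa h n (exp_tilt f \<rho>) y < \<infinity>" if "1 \<le> n" for n y using that by blast
    \<comment> \<open>Finite moments are given for the tilted kernel only, whose measurability is
      known up to a null set; hence the almost everywhere form of the disintegration.\<close>
    from T.disintegration_version[OF this diffuse]
    show "kernel_prod (density C (\<lambda>\<mu>. ennreal (w \<mu>))) (borel_tuples n) (power_measure n) =
      distr (kernel_prod (scale_measure (ennreal (laplace_prm f \<rho> \<eta>)) (moment_measure h n (exp_tilt f \<rho>) \<eta>))
          boundedly_finite_measures (\<lambda>Y. posterior_law h n (exp_tilt f \<rho>) \<eta> Y))
        (boundedly_finite_measures \<Otimes>\<^sub>M borel_tuples n) prod.swap"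
      unfolding dens(1) .
  next
    assume kap: "\<forall>n\<ge>1. \<forall>y. kappa h n \<rho> y < \<infinity>"
    \<comment> \<open>Now \<open>\<rho>\<close> itself is measurable everywhere with finite moments
      at every point, so the pointwise results on posterior laws apply to it and to its
      tilting.\<close>
    have K: "crm_kappa \<eta> \<rho> h \<Omega> N"
      using kap kernel_rho diffuse by unfold_locales (auto simp: sigma_finite_kernel_def)
    interpret K: crm_kappa \<eta> \<rho> h \<Omega> N by (rule K)
    have TK: "crm_kappa \<eta> (exp_tilt f \<rho>) h P (\<lambda>N. N)"
      by (rule K.crm_kappa_exp_tilt[OF f_measurable f_pos T])
    note tilt = K.posterior_law_tilt[OF f_measurable f_pos w TK _ dens(1)]
    fix n :: nat
    have 2: "AE Y in moment_measure h n \<rho> \<eta>. (\<integral>\<^sup>+\<mu>. ennreal (w \<mu>) \<partial>posterior_law h n \<rho> \<eta> Y) = ennreal (laplace_prm f \<rho> \<eta>) * K.tilt_prod f n Y"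
      by (rule tilt(2)) simp
    then show "AE Y in moment_measure h n \<rho> \<eta>. (\<integral>\<^sup>+\<mu>. ennreal (w \<mu>) \<partial>posterior_law h n \<rho> \<eta> Y)
        = ennreal (laplace_prm f \<rho> \<eta>) *
          (\<Prod>v\<in>distinct_values n Y. \<integral>\<^sup>+s. ennreal (exp (- f (s, v))) \<partial>jump_law h (card (block n Y v)) \<rho> v)"
      by (simp only: K.tilt_prod_def)
    have 1: "AE Y in moment_measure h n \<rho> \<eta>. density (posterior_law h n \<rho> \<eta> Y) (\<lambda>\<mu>. ennreal (w \<mu>)) =
        scale_measure (ennreal (laplace_prm f \<rho> \<eta>) * K.tilt_prod f n Y) (posterior_law h n (exp_tilt f \<rho>) \<eta> Y)"
      by (rule tilt(1)) simp
    show "AE Y in moment_measure h n \<rho> \<eta>. density (posterior_law h n \<rho> \<eta> Y) (\<lambda>\<mu>. ennreal (w \<mu>)) =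
        scale_measure (\<integral>\<^sup>+\<mu>. ennreal (w \<mu>) \<partial>posterior_law h n \<rho> \<eta> Y) (posterior_law h n (exp_tilt f \<rho>) \<eta> Y)"
      using 1 2 by eventually_elim simp
    show "scale_measure (ennreal (laplace_prm f \<rho> \<eta>)) (moment_measure h n (exp_tilt f \<rho>) \<eta>) =
        density (moment_measure h n \<rho> \<eta>) (\<lambda>Y. \<integral>\<^sup>+\<mu>. ennreal (w \<mu>) \<partial>posterior_law h n \<rho> \<eta> Y)"
      by (rule tilt(3)) simp
  qed
qed

end
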